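(* The tensor product of permutative categories, of symmetric monoidal functors, and of monoidal transformations (as defined in the context) defines a 2-functor $$\otimes\colon\mathrm{PermCat}\times\mathrm{PermCat}\to\mathrm{PermCat}.$$
   Context: **Permutative categories.** A permutative category $C=(C,+,0,\beta)$ is a strict monoidal category $(C,+,0)$ with a natural isomorphism $\beta_{x,y}\colon x+y\to y+x$ such that $\beta_{y,x}\beta_{x,y}=1$ and $\beta_{x,y+z}=(1_y+\beta_{x,z})\circ(\beta_{x,y}+1_z)$. A symmetric monoidal functor $F\colon C\to C'$ (always in the strong sense) is a functor with a natural isomorphism $F_2\colon Fx+Fy\to F(x+y)$ and an isomorphism $F_0\colon 0\to F0$ satisfying the usual associativity, unity and symmetry axioms; it is strict if $F_2,F_0$ are identities. A monoidal transformation $\phi\colon F\Rightarrow G$ is a natural transformation with $\phi_{x+y}\circ F_2=G_2\circ(\phi_x+\phi_y)$ and $\phi_0\circ F_0=G_0$. $\mathrm{PermCat}$ is the 2-category of small permutative categories, symmetric monoidal functors and monoidal transformations. **Tensor product of objects.** For permutative categories $A,B$, start with the free strict monoidal category $\coprod_{n\ge 0}(A\times B)^n$ on $A\times B$, writing objects as finite formal sums $\sum a_i.b_i$ (the empty sum is $0$) and morphisms of $A\times B$ as $f.g$. Freely adjoin (in strict monoidal categories) isomorphisms $\delta^L_a(b,b')\colon a.b+a.b'\to a.(b+b')$, $\delta^R_b(a,a')\colon a.b+a'.b\to(a+a').b$, $\beta_{a.b,a'.b'}\colon a.b+a'.b'\to a'.b'+a.b$, $\zeta^L_a\colon 0\to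 a.0$, $\zeta^R_b\colon 0\to 0.b$ for all $a,a'\in A$, $b,b'\in B$. Impose the relations: (1) all of these are natural in every variable; (2) $\beta$ together with $+,0$ gives a permutative structure; (3) each $a.(-)$ is a symmetric monoidal functor with constraints $\delta^L_a,\zeta^L_a$ and each $(-).b$ is a symmetric monoidal functor with constraints $\delta^R_b,\zeta^R_b$; (4) $\delta^L_{a+a'}\circ(\delta^R_b+\delta^R_{b'})=\delta^R_{b+b'}\circ(\delta^L_a+\delta^L_{a'})\circ(1+\beta+1)$ as morphisms $a.b+a'.b+a.b'+a'.b'\to(a+a').(b+b')$; (5) $\zeta^L_0=\zeta^R_0\colon 0\to 0.0$; (6) $\delta^R_0(a,a')\circ(\zeta^L_a+\zeta^L_{a'})=\zeta^L_{a+a'}$ and $\delta^L_0(b,b')\circ(\zeta^R_b+\zeta^R_{b'})=\zeta^R_{b+b'}$. The result is the permutative category $A\otimes B$. **Tensor product of 1- and 2-cells.** For symmetric monoidal functors $F\colon A\to A'$, $G\colon B\to B'$, the strict symmetric monoidal functor $F\otimes G\colon A\otimes B\to A'\otimes B'$ is given by $a.b\mapsto Fa.Gb$, $f.g\mapsto Ff.Gg$, $\delta^L_a\mapsto(1.G_2)\circ\delta^L_{Fa}$, $\delta^R_b\mapsto(F_2.1)\circ\delta^R_{Gb}$, $\beta\mapsto\beta$, $\zeta^L_a\mapsto(1.G_0)\circ\zeta^L_{Fa}$, $\zeta^R_b\mapsto(F_0.1)\circ\zeta^R_{Gb}$, extended strictly to sums. For monoidal transformations $\phi\colon F\Rightarrow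 F'$, $\psi\colon G\Rightarrow G'$, the monoidal transformation $\phi\otimes\psi\colon F\otimes G\Rightarrow F'\otimes G'$ has components $(\phi\otimes\psi)_{\sum a_i.b_i}=\sum\phi_{a_i}.\psi_{b_i}$ and $(\phi\otimes\psi)_0=1_0$. *)

theory Defs
  imports Main "HOL-Library.FuncSet"
begin

section \<open>Strict 2-categories and 2-functors\<close>

text \<open>
  A 2-category is given globally by its sets of 0-, 1- and 2-cells. In every composition the
  second argument comes first, so \<open>Comp1 G F\<close> is \<open>G\<close> after \<open>F\<close>.
\<close>

record ('p, 'f, 't) two_cat =
  Cell0 :: "'p set"
  Cell1 :: "'f set"
  Cell2 :: "'t set"
  Src1 :: "'f \<Rightarrow> 'p"
  Trg1 :: "'f \<Rightarrow> 'p"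
  Src2 :: "'t \<Rightarrow> 'f"
  Trg2 :: "'t \<Rightarrow> 'f"
  Id1 :: "'p \<Rightarrow> 'f"
  Comp1 :: "'f \<Rightarrow> 'f \<Rightarrow> 'f"
  Id2 :: "'f \<Rightarrow> 't"
  VComp :: "'t \<Rightarrow> 't \<Rightarrow> 't"
  HComp :: "'t \<Rightarrow> 't \<Rightarrow> 't"

locale two_category =
  fixes K :: "('p, 'f, 't) two_cat"
  assumes Src1_cell: "F \<in> Cell1 K \<Longrightarrow> Src1 K F \<in> Cell0 K"
    and Trg1_cell: "F \<in> Cell1 K \<Longrightarrow> Trg1 K F \<in> Cell0 K"
    and Src2_cell: "\<phi> \<in> Cell2 K \<Longrightarrow> Src2 K \<phi> \<in> Cell1 K"
    and Trg2_cell: "\<phi> \<in> Cell2 K \<Longrightarrow> Trg2 K \<phi> \<in> Cell1 K"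
    and globular_src: "\<phi> \<in> Cell2 K \<Longrightarrow> Src1 K (Src2 K \<phi>) = Src1 K (Trg2 K \<phi>)"
    and globular_trg: "\<phi> \<in> Cell2 K \<Longrightarrow> Trg1 K (Src2 K \<phi>) = Trg1 K (Trg2 K \<phi>)"
    and Id1_cell: "A \<in> Cell0 K \<Longrightarrow>
        Id1 K A \<in> Cell1 K \<and> Src1 K (Id1 K A) = A \<and> Trg1 K (Id1 K A) = A"
    and Comp1_cell: "\<lbrakk>F \<in> Cell1 K; G \<in> Cell1 K; Src1 K G = Trg1 K F\<rbrakk> \<Longrightarrow>
        Comp1 K G F \<in> Cell1 K \<and> Src1 K (Comp1 K G F) = Src1 K F
          \<and> Trg1 K (Comp1 K G F) = Trg1 K G"
    and Comp1_Id1_right: "F \<in> Cell1 K \<Longrightarrow> Comp1 K F (Id1 K (Src1 K F)) = F"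
    and Comp1_Id1_left: "F \<in> Cell1 K \<Longrightarrow> Comp1 K (Id1 K (Trg1 K F)) F = F"
    and Comp1_assoc:
      "\<lbrakk>F \<in> Cell1 K; G \<in> Cell1 K; H \<in> Cell1 K; Src1 K G = Trg1 K F; Src1 K H = Trg1 K G\<rbrakk> \<Longrightarrow>
        Comp1 K (Comp1 K H G) F = Comp1 K H (Comp1 K G F)"
    and Id2_cell: "F \<in> Cell1 K \<Longrightarrow>
        Id2 K F \<in> Cell2 K \<and> Src2 K (Id2 K F) = F \<and> Trg2 K (Id2 K F) = F"
    and VComp_cell: "\<lbrakk>\<phi> \<in> Cell2 K; \<psi> \<in> Cell2 K; Src2 K \<psi> = Trg2 K \<phi>\<rbrakk> \<Longrightarrow>
        VComp K \<psi> \<phi> \<in> Cell2 K \<and> Src2 K (VComp K \<psi> \<phi>) = Src2 K \<phi>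
          \<and> Trg2 K (VComp K \<psi> \<phi>) = Trg2 K \<psi>"
    and VComp_Id2_right: "\<phi> \<in> Cell2 K \<Longrightarrow> VComp K \<phi> (Id2 K (Src2 K \<phi>)) = \<phi>"
    and VComp_Id2_left: "\<phi> \<in> Cell2 K \<Longrightarrow> VComp K (Id2 K (Trg2 K \<phi>)) \<phi> = \<phi>"
    and VComp_assoc:
      "\<lbrakk>\<phi> \<in> Cell2 K; \<psi> \<in> Cell2 K; \<chi> \<in> Cell2 K; Src2 K \<psi> = Trg2 K \<phi>; Src2 K \<chi> = Trg2 K \<psi>\<rbrakk> \<Longrightarrow>
        VComp K (VComp K \<chi> \<psi>) \<phi> = VComp K \<chi> (VComp K \<psi> \<phi>)"
    and HComp_cell:
      "\<lbrakk>\<phi> \<in> Cell2 K; \<psi> \<in> Cell2 K; Src1 K (Src2 K \<psi>) = Trg1 K (Src2 K \<phi>)\<rbrakk> \<Longrightarrow>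
        HComp K \<psi> \<phi> \<in> Cell2 K
          \<and> Src2 K (HComp K \<psi> \<phi>) = Comp1 K (Src2 K \<psi>) (Src2 K \<phi>)
          \<and> Trg2 K (HComp K \<psi> \<phi>) = Comp1 K (Trg2 K \<psi>) (Trg2 K \<phi>)"
    and HComp_Id_right:
      "\<phi> \<in> Cell2 K \<Longrightarrow> HComp K \<phi> (Id2 K (Id1 K (Src1 K (Src2 K \<phi>)))) = \<phi>"
    and HComp_Id_left:
      "\<phi> \<in> Cell2 K \<Longrightarrow> HComp K (Id2 K (Id1 K (Trg1 K (Src2 K \<phi>)))) \<phi> = \<phi>"
    and HComp_assoc:
      "\<lbrakk>\<phi> \<in> Cell2 K; \<psi> \<in> Cell2 K; \<chi> \<in> Cell2 K;
        Src1 K (Src2 K \<psi>) = Trg1 K (Src2 K \<phi>); Src1 K (Src2 K \<chi>) = Trg1 K (Src2 K \<psi>)\<rbrakk> \<Longrightarrow>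
        HComp K (HComp K \<chi> \<psi>) \<phi> = HComp K \<chi> (HComp K \<psi> \<phi>)"
    and HComp_Id2:
      "\<lbrakk>F \<in> Cell1 K; G \<in> Cell1 K; Src1 K G = Trg1 K F\<rbrakk> \<Longrightarrow>
        HComp K (Id2 K G) (Id2 K F) = Id2 K (Comp1 K G F)"
    and interchange:
      "\<lbrakk>\<phi> \<in> Cell2 K; \<phi>' \<in> Cell2 K; \<psi> \<in> Cell2 K; \<psi>' \<in> Cell2 K;
        Src2 K \<phi>' = Trg2 K \<phi>; Src2 K \<psi>' = Trg2 K \<psi>;
        Src1 K (Src2 K \<psi>) = Trg1 K (Src2 K \<phi>)\<rbrakk> \<Longrightarrow>
        HComp K (VComp K \<psi>' \<psi>) (VComp K \<phi>' \<phi>) = VComp K (HComp K \<psi>' \<phi>') (HComp K \<psi> \<phi>)"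

definition prod_two_cat ::
    "('p, 'f, 't) two_cat \<Rightarrow> ('q, 'g, 's) two_cat \<Rightarrow> ('p \<times> 'q, 'f \<times> 'g, 't \<times> 's) two_cat"
    (infixr "\<times>\<^sub>2" 80) where
  "K \<times>\<^sub>2 L = \<lparr>
     Cell0 = Cell0 K \<times> Cell0 L,
     Cell1 = Cell1 K \<times> Cell1 L,
     Cell2 = Cell2 K \<times> Cell2 L,
     Src1 = map_prod (Src1 K) (Src1 L),
     Trg1 = map_prod (Trg1 K) (Trg1 L),
     Src2 = map_prod (Src2 K) (Src2 L),
     Trg2 = map_prod (Trg2 K) (Trg2 L),
     Id1 = map_prod (Id1 K) (Id1 L),
     Comp1 = (\<lambda>(G, G') (F, F'). (Comp1 K G F, Comp1 L G' F')),
     Id2 = map_prod (Id2 K) (Id2 L),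
     VComp = (\<lambda>(\<psi>, \<psi>') (\<phi>, \<phi>'). (VComp K \<psi> \<phi>, VComp L \<psi>' \<phi>')),
     HComp = (\<lambda>(\<psi>, \<psi>') (\<phi>, \<phi>'). (HComp K \<psi> \<phi>, HComp L \<psi>' \<phi>')) \<rparr>"

locale two_functor =
  K: two_category K + L: two_category L
  for K :: "('p, 'f, 't) two_cat" and L :: "('q, 'g, 's) two_cat" +
  fixes T0 :: "'p \<Rightarrow> 'q" and T1 :: "'f \<Rightarrow> 'g" and T2 :: "'t \<Rightarrow> 's"
  assumes T0_cell: "A \<in> Cell0 K \<Longrightarrow> T0 A \<in> Cell0 L"
    and T1_cell: "F \<in> Cell1 K \<Longrightarrow>
        T1 F \<in> Cell1 L \<and> Src1 L (T1 F) = T0 (Src1 K F) \<and> Trg1 L (T1 F) = T0 (Trg1 K F)"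
    and T2_cell: "\<phi> \<in> Cell2 K \<Longrightarrow>
        T2 \<phi> \<in> Cell2 L \<and> Src2 L (T2 \<phi>) = T1 (Src2 K \<phi>) \<and> Trg2 L (T2 \<phi>) = T1 (Trg2 K \<phi>)"
    and T1_Id1: "A \<in> Cell0 K \<Longrightarrow> T1 (Id1 K A) = Id1 L (T0 A)"
    and T1_Comp1: "\<lbrakk>F \<in> Cell1 K; G \<in> Cell1 K; Src1 K G = Trg1 K F\<rbrakk> \<Longrightarrow>
        T1 (Comp1 K G F) = Comp1 L (T1 G) (T1 F)"
    and T2_Id2: "F \<in> Cell1 K \<Longrightarrow> T2 (Id2 K F) = Id2 L (T1 F)"
    and T2_VComp: "\<lbrakk>\<phi> \<in> Cell2 K; \<psi> \<in> Cell2 K; Src2 K \<psi> = Trg2 K \<phi>\<rbrakk> \<Longrightarrow>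
        T2 (VComp K \<psi> \<phi>) = VComp L (T2 \<psi>) (T2 \<phi>)"
    and T2_HComp:
      "\<lbrakk>\<phi> \<in> Cell2 K; \<psi> \<in> Cell2 K; Src1 K (Src2 K \<psi>) = Trg1 K (Src2 K \<phi>)\<rbrakk> \<Longrightarrow>
        T2 (HComp K \<psi> \<phi>) = HComp L (T2 \<psi>) (T2 \<phi>)"


section \<open>Permutative categories\<close>

record ('o, 'm) cat =
  Ob :: "'o set"
  Ar :: "'m set"
  Dom :: "'m \<Rightarrow> 'o"
  Cod :: "'m \<Rightarrow> 'o"
  Idt :: "'o \<Rightarrow> 'm" ("\<one>\<index>")
  Cmp :: "'m \<Rightarrow> 'm \<Rightarrow> 'm" (infixr "\<cdot>\<index>" 60)

record ('o, 'm) permcat = "('o, 'm) cat" +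
  Plus_ob :: "'o \<Rightarrow> 'o \<Rightarrow> 'o" (infixr "\<oplus>\<index>" 65)
  Plus_ar :: "'m \<Rightarrow> 'm \<Rightarrow> 'm" (infixr "\<boxplus>\<index>" 65)
  Zero :: "'o" ("\<zero>\<index>")
  Symm :: "'o \<Rightarrow> 'o \<Rightarrow> 'm" ("\<beta>\<index>")

definition Hom :: "('o, 'm, 'z) cat_scheme \<Rightarrow> 'o \<Rightarrow> 'o \<Rightarrow> 'm set" where
  "Hom C x y = {f \<in> Ar C. Dom C f = x \<and> Cod C f = y}"

locale category =
  fixes C :: "('o, 'm, 'z) cat_scheme" (structure)
  assumes Dom_Ob: "f \<in> Ar C \<Longrightarrow> Dom C f \<in> Ob C"
    and Cod_Ob: "f \<in> Ar C \<Longrightarrow> Cod C f \<in> Ob C"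
    and Idt_Hom: "x \<in> Ob C \<Longrightarrow> \<one> x \<in> Hom C x x"
    and Cmp_Hom: "\<lbrakk>f \<in> Hom C x y; g \<in> Hom C y z\<rbrakk> \<Longrightarrow> g \<cdot> f \<in> Hom C x z"
    and Cmp_Idt_right: "f \<in> Hom C x y \<Longrightarrow> f \<cdot> \<one> x = f"
    and Cmp_Idt_left: "f \<in> Hom C x y \<Longrightarrow> \<one> y \<cdot> f = f"
    and Cmp_assoc: "\<lbrakk>f \<in> Hom C x y; g \<in> Hom C y z; h \<in> Hom C z w\<rbrakk> \<Longrightarrow> (h \<cdot> g) \<cdot> f = h \<cdot> (g \<cdot> f)"

definition inverse_pair :: "('o, 'm, 'z) cat_scheme \<Rightarrow> 'm \<Rightarrow> 'm \<Rightarrow> bool" where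
  "inverse_pair C f g \<longleftrightarrow>
     f \<in> Ar C \<and> g \<in> Hom C (Cod C f) (Dom C f) \<and>
     g \<cdot>\<^bsub>C\<^esub> f = \<one>\<^bsub>C\<^esub> (Dom C f) \<and> f \<cdot>\<^bsub>C\<^esub> g = \<one>\<^bsub>C\<^esub> (Cod C f)"

definition is_iso :: "('o, 'm, 'z) cat_scheme \<Rightarrow> 'm \<Rightarrow> bool" where
  "is_iso C f \<longleftrightarrow> (\<exists>g. inverse_pair C f g)"

definition inv_ar :: "('o, 'm, 'z) cat_scheme \<Rightarrow> 'm \<Rightarrow> 'm" where
  "inv_ar C f = (THE g. inverse_pair C f g)"

locale strict_monoidal_category = category C
  for C :: "('o, 'm, 'z) permcat_scheme" (structure) +
  assumes Zero_Ob: "\<zero> \<in> Ob C"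
    and Plus_Ob: "\<lbrakk>x \<in> Ob C; y \<in> Ob C\<rbrakk> \<Longrightarrow> x \<oplus> y \<in> Ob C"
    and Plus_ob_assoc: "\<lbrakk>x \<in> Ob C; y \<in> Ob C; z \<in> Ob C\<rbrakk> \<Longrightarrow> (x \<oplus> y) \<oplus> z = x \<oplus> (y \<oplus> z)"
    and Zero_left: "x \<in> Ob C \<Longrightarrow> \<zero> \<oplus> x = x"
    and Zero_right: "x \<in> Ob C \<Longrightarrow> x \<oplus> \<zero> = x"
    and Plus_Hom: "\<lbrakk>f \<in> Hom C x x'; g \<in> Hom C y y'\<rbrakk> \<Longrightarrow> f \<boxplus> g \<in> Hom C (x \<oplus> y) (x' \<oplus> y')"
    and Plus_Idt: "\<lbrakk>x \<in> Ob C; y \<in> Ob C\<rbrakk> \<Longrightarrow> \<one> x \<boxplus> \<one> y = \<one> (x \<oplus> y)"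
    and Plus_Cmp:
      "\<lbrakk>f \<in> Hom C x x'; f' \<in> Hom C x' x''; g \<in> Hom C y y'; g' \<in> Hom C y' y''\<rbrakk> \<Longrightarrow>
        (f' \<cdot> f) \<boxplus> (g' \<cdot> g) = (f' \<boxplus> g') \<cdot> (f \<boxplus> g)"
    and Plus_ar_assoc: "\<lbrakk>f \<in> Ar C; g \<in> Ar C; h \<in> Ar C\<rbrakk> \<Longrightarrow> (f \<boxplus> g) \<boxplus> h = f \<boxplus> (g \<boxplus> h)"
    and Zero_ar_left: "f \<in> Ar C \<Longrightarrow> \<one> \<zero> \<boxplus> f = f"
    and Zero_ar_right: "f \<in> Ar C \<Longrightarrow> f \<boxplus> \<one> \<zero> = f"

locale permutative_category = strict_monoidal_category C
  for C :: "('o, 'm) permcat" (structure) +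
  assumes Symm_Hom: "\<lbrakk>x \<in> Ob C; y \<in> Ob C\<rbrakk> \<Longrightarrow> \<beta> x y \<in> Hom C (x \<oplus> y) (y \<oplus> x)"
    and Symm_natural:
      "\<lbrakk>f \<in> Hom C x x'; g \<in> Hom C y y'\<rbrakk> \<Longrightarrow> \<beta> x' y' \<cdot> (f \<boxplus> g) = (g \<boxplus> f) \<cdot> \<beta> x y"
    and Symm_Symm: "\<lbrakk>x \<in> Ob C; y \<in> Ob C\<rbrakk> \<Longrightarrow> \<beta> y x \<cdot> \<beta> x y = \<one> (x \<oplus> y)"
    and Symm_Plus:
      "\<lbrakk>x \<in> Ob C; y \<in> Ob C; z \<in> Ob C\<rbrakk> \<Longrightarrow>
        \<beta> x (y \<oplus> z) = (\<one> y \<boxplus> \<beta> x z) \<cdot> (\<beta> x y \<boxplus> \<one> z)"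


section \<open>Symmetric monoidal functors\<close>

text \<open>
  The functions in a functor are extensional (\<open>undefined\<close> outside the source
  category), so that equality of functors, and likewise of transformations below, is equality of
  records.
\<close>

record ('o, 'm, 'p, 'n) smfun =
  Src :: "('o, 'm) permcat"
  Trg :: "('p, 'n) permcat"
  On_ob :: "'o \<Rightarrow> 'p"
  On_ar :: "'m \<Rightarrow> 'n"
  Mul :: "'o \<times> 'o \<Rightarrow> 'n"
  Unt :: "'n"

locale symmetric_monoidal_functor =
  A: permutative_category A + B: permutative_category B
  for A :: "('o, 'm) permcat" and B :: "('p, 'n) permcat" +
  fixes F :: "('o, 'm, 'p, 'n) smfun"
  assumes Src: "Src F = A" and Trg: "Trg F = B"
    and On_ob_ext: "On_ob F \<in> extensional (Ob A)"
    and On_ar_ext: "On_ar F \<in> extensional (Ar A)"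
    and Mul_ext: "Mul F \<in> extensional (Ob A \<times> Ob A)"
    and On_ob: "x \<in> Ob A \<Longrightarrow> On_ob F x \<in> Ob B"
    and On_ar: "f \<in> Hom A x y \<Longrightarrow> On_ar F f \<in> Hom B (On_ob F x) (On_ob F y)"
    and On_Idt: "x \<in> Ob A \<Longrightarrow> On_ar F (\<one>\<^bsub>A\<^esub> x) = \<one>\<^bsub>B\<^esub> (On_ob F x)"
    and On_Cmp: "\<lbrakk>f \<in> Hom A x y; g \<in> Hom A y z\<rbrakk> \<Longrightarrow>
        On_ar F (g \<cdot>\<^bsub>A\<^esub> f) = On_ar F g \<cdot>\<^bsub>B\<^esub> On_ar F f"
    and Mul_Hom: "\<lbrakk>x \<in> Ob A; y \<in> Ob A\<rbrakk> \<Longrightarrow>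
        Mul F (x, y) \<in> Hom B (On_ob F x \<oplus>\<^bsub>B\<^esub> On_ob F y) (On_ob F (x \<oplus>\<^bsub>A\<^esub> y))"
    and Mul_iso: "\<lbrakk>x \<in> Ob A; y \<in> Ob A\<rbrakk> \<Longrightarrow> is_iso B (Mul F (x, y))"
    and Mul_natural: "\<lbrakk>f \<in> Hom A x x'; g \<in> Hom A y y'\<rbrakk> \<Longrightarrow>
        On_ar F (f \<boxplus>\<^bsub>A\<^esub> g) \<cdot>\<^bsub>B\<^esub> Mul F (x, y) = Mul F (x', y') \<cdot>\<^bsub>B\<^esub> (On_ar F f \<boxplus>\<^bsub>B\<^esub> On_ar F g)"
    and Unt_Hom: "Unt F \<in> Hom B \<zero>\<^bsub>B\<^esub> (On_ob F \<zero>\<^bsub>A\<^esub>)"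
    and Unt_iso: "is_iso B (Unt F)"
    and Mul_assoc: "\<lbrakk>x \<in> Ob A; y \<in> Ob A; z \<in> Ob A\<rbrakk> \<Longrightarrow>
        Mul F (x \<oplus>\<^bsub>A\<^esub> y, z) \<cdot>\<^bsub>B\<^esub> (Mul F (x, y) \<boxplus>\<^bsub>B\<^esub> \<one>\<^bsub>B\<^esub> (On_ob F z)) =
        Mul F (x, y \<oplus>\<^bsub>A\<^esub> z) \<cdot>\<^bsub>B\<^esub> (\<one>\<^bsub>B\<^esub> (On_ob F x) \<boxplus>\<^bsub>B\<^esub> Mul F (y, z))"
    and Mul_Unt_right: "x \<in> Ob A \<Longrightarrow>
        Mul F (x, \<zero>\<^bsub>A\<^esub>) \<cdot>\<^bsub>B\<^esub> (\<one>\<^bsub>B\<^esub> (On_ob F x) \<boxplus>\<^bsub>B\<^esub> Unt F) = \<one>\<^bsub>B\<^esub> (On_ob F x)"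
    and Mul_Unt_left: "x \<in> Ob A \<Longrightarrow>
        Mul F (\<zero>\<^bsub>A\<^esub>, x) \<cdot>\<^bsub>B\<^esub> (Unt F \<boxplus>\<^bsub>B\<^esub> \<one>\<^bsub>B\<^esub> (On_ob F x)) = \<one>\<^bsub>B\<^esub> (On_ob F x)"
    and Mul_Symm: "\<lbrakk>x \<in> Ob A; y \<in> Ob A\<rbrakk> \<Longrightarrow>
        On_ar F (\<beta>\<^bsub>A\<^esub> x y) \<cdot>\<^bsub>B\<^esub> Mul F (x, y) =
        Mul F (y, x) \<cdot>\<^bsub>B\<^esub> \<beta>\<^bsub>B\<^esub> (On_ob F x) (On_ob F y)"

definition id_smfun :: "('o, 'm) permcat \<Rightarrow> ('o, 'm, 'o, 'm) smfun" where
  "id_smfun A = \<lparr>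
     Src = A, Trg = A,
     On_ob = restrict (\<lambda>x. x) (Ob A),
     On_ar = restrict (\<lambda>f. f) (Ar A),
     Mul = restrict (\<lambda>(x, y). \<one>\<^bsub>A\<^esub> (x \<oplus>\<^bsub>A\<^esub> y)) (Ob A \<times> Ob A),
     Unt = \<one>\<^bsub>A\<^esub> \<zero>\<^bsub>A\<^esub> \<rparr>"

definition comp_smfun ::
    "('p, 'n, 'q, 'k) smfun \<Rightarrow> ('o, 'm, 'p, 'n) smfun \<Rightarrow> ('o, 'm, 'q, 'k) smfun" where
  "comp_smfun G F = \<lparr>
     Src = Src F, Trg = Trg G,
     On_ob = restrict (\<lambda>x. On_ob G (On_ob F x)) (Ob (Src F)),
     On_ar = restrict (\<lambda>f. On_ar G (On_ar F f)) (Ar (Src F)),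
     Mul = restrict (\<lambda>(x, y). On_ar G (Mul F (x, y)) \<cdot>\<^bsub>Trg G\<^esub> Mul G (On_ob F x, On_ob F y))
             (Ob (Src F) \<times> Ob (Src F)),
     Unt = On_ar G (Unt F) \<cdot>\<^bsub>Trg G\<^esub> Unt G \<rparr>"


section \<open>Monoidal transformations\<close>

record ('o, 'm, 'p, 'n) mtrans =
  Src_fun :: "('o, 'm, 'p, 'n) smfun"
  Trg_fun :: "('o, 'm, 'p, 'n) smfun"
  Component :: "'o \<Rightarrow> 'n"

locale monoidal_transformation =
  F: symmetric_monoidal_functor A B F + G: symmetric_monoidal_functor A B G
  for A :: "('o, 'm) permcat" and B :: "('p, 'n) permcat" and F G +
  fixes \<phi> :: "('o, 'm, 'p, 'n) mtrans"
  assumes Src_fun: "Src_fun \<phi> = F" and Trg_fun: "Trg_fun \<phi> = G"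
    and Component_ext: "Component \<phi> \<in> extensional (Ob A)"
    and Component_Hom: "x \<in> Ob A \<Longrightarrow> Component \<phi> x \<in> Hom B (On_ob F x) (On_ob G x)"
    and Component_natural: "f \<in> Hom A x y \<Longrightarrow>
        Component \<phi> y \<cdot>\<^bsub>B\<^esub> On_ar F f = On_ar G f \<cdot>\<^bsub>B\<^esub> Component \<phi> x"
    and Component_Mul: "\<lbrakk>x \<in> Ob A; y \<in> Ob A\<rbrakk> \<Longrightarrow>
        Component \<phi> (x \<oplus>\<^bsub>A\<^esub> y) \<cdot>\<^bsub>B\<^esub> Mul F (x, y) =
        Mul G (x, y) \<cdot>\<^bsub>B\<^esub> (Component \<phi> x \<boxplus>\<^bsub>B\<^esub> Component \<phi> y)"
    and Component_Unt: "Component \<phi> \<zero>\<^bsub>A\<^esub> \<cdot>\<^bsub>B\<^esub> Unt F = Unt G"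

definition id_mtrans :: "('o, 'm, 'p, 'n) smfun \<Rightarrow> ('o, 'm, 'p, 'n) mtrans" where
  "id_mtrans F = \<lparr>
     Src_fun = F, Trg_fun = F,
     Component = restrict (\<lambda>x. \<one>\<^bsub>Trg F\<^esub> (On_ob F x)) (Ob (Src F)) \<rparr>"

definition vcomp_mtrans ::
    "('o, 'm, 'p, 'n) mtrans \<Rightarrow> ('o, 'm, 'p, 'n) mtrans \<Rightarrow> ('o, 'm, 'p, 'n) mtrans" where
  "vcomp_mtrans \<psi> \<phi> = \<lparr>
     Src_fun = Src_fun \<phi>, Trg_fun = Trg_fun \<psi>,
     Component = restrict (\<lambda>x. Component \<psi> x \<cdot>\<^bsub>Trg (Src_fun \<phi>)\<^esub> Component \<phi> x)
                   (Ob (Src (Src_fun \<phi>))) \<rparr>"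

definition hcomp_mtrans ::
    "('p, 'n, 'q, 'k) mtrans \<Rightarrow> ('o, 'm, 'p, 'n) mtrans \<Rightarrow> ('o, 'm, 'q, 'k) mtrans" where
  "hcomp_mtrans \<psi> \<phi> = \<lparr>
     Src_fun = comp_smfun (Src_fun \<psi>) (Src_fun \<phi>),
     Trg_fun = comp_smfun (Trg_fun \<psi>) (Trg_fun \<phi>),
     Component = restrict
       (\<lambda>x. Component \<psi> (On_ob (Trg_fun \<phi>) x) \<cdot>\<^bsub>Trg (Src_fun \<psi>)\<^esub>
            On_ar (Src_fun \<psi>) (Component \<phi> x))
       (Ob (Src (Src_fun \<phi>))) \<rparr>"

text \<open>
  Smallness is relative to types: the 0-cells of \<open>PermCat\<close> at the type parameters
  \<open>'o\<close> and \<open>'m\<close> are all permutative categories whose objects form a set in \<open>'o\<close> and whose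
  morphisms form a set in \<open>'m\<close>.
\<close>

definition PermCat ::
    "(('o, 'm) permcat, ('o, 'm, 'o, 'm) smfun, ('o, 'm, 'o, 'm) mtrans) two_cat" where
  "PermCat = \<lparr>
     Cell0 = {A. permutative_category A},
     Cell1 = {F. symmetric_monoidal_functor (Src F) (Trg F) F},
     Cell2 = {\<phi>. monoidal_transformation (Src (Src_fun \<phi>)) (Trg (Src_fun \<phi>))
                    (Src_fun \<phi>) (Trg_fun \<phi>) \<phi>},
     Src1 = Src, Trg1 = Trg,
     Src2 = Src_fun, Trg2 = Trg_fun,
     Id1 = id_smfun, Comp1 = comp_smfun,
     Id2 = id_mtrans, VComp = vcomp_mtrans, HComp = hcomp_mtrans \<rparr>"


section \<open>The tensor product of permutative categories\<close>

text \<open>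
  The formal sum \<open>a\<^sub>1.b\<^sub>1 + \<dots> + a\<^sub>n.b\<^sub>n\<close> is the list of pairs \<open>(a\<^sub>i, b\<^sub>i)\<close>.
  The adjoined isomorphisms are \<open>DL a b b'\<close> for \<open>\<delta>\<^sup>L\<^sub>a(b,b')\<close>, \<open>DR b a a'\<close> for \<open>\<delta>\<^sup>R\<^sub>b(a,a')\<close>,
  \<open>BB a b a' b'\<close> for \<open>\<beta>\<close> at \<open>(a.b, a'.b')\<close>, \<open>ZL a\<close> for \<open>\<zeta>\<^sup>L\<^sub>a\<close> and \<open>ZR b\<close> for \<open>\<zeta>\<^sup>R\<^sub>b\<close>.
  Morphisms of the tensor product are classes of words, where \<open>Base\<close> embeds the morphisms
  \<open>f\<^sub>1.g\<^sub>1 + \<dots> + f\<^sub>n.g\<^sub>n\<close> of the free strict monoidal category on the product category, and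
  \<open>Gen\<close> and \<open>GenInv\<close> are the adjoined isomorphisms and their formal inverses.
\<close>

datatype ('a, 'b) gen =
    DL 'a 'b 'b
  | DR 'b 'a 'a
  | BB 'a 'b 'a 'b
  | ZL 'a
  | ZR 'b

datatype ('a, 'm, 'b, 'n) word =
    Base "('m \<times> 'n) list"
  | Gen "('a, 'b) gen"
  | GenInv "('a, 'b) gen"
  | Then "('a, 'm, 'b, 'n) word" "('a, 'm, 'b, 'n) word" (infixr "\<bullet>" 60)
  | Sum "('a, 'm, 'b, 'n) word" "('a, 'm, 'b, 'n) word" (infixr "\<uplus>" 65)

abbreviation dot :: "'m \<Rightarrow> 'n \<Rightarrow> ('a, 'm, 'b, 'n) word" (infix "\<odot>" 70) where
  "f \<odot> g \<equiv> Base [(f, g)]"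

primrec gen_ok :: "('a, 'm) permcat \<Rightarrow> ('b, 'n) permcat \<Rightarrow> ('a, 'b) gen \<Rightarrow> bool" where
  "gen_ok A B (DL a b b') \<longleftrightarrow> a \<in> Ob A \<and> b \<in> Ob B \<and> b' \<in> Ob B"
| "gen_ok A B (DR b a a') \<longleftrightarrow> b \<in> Ob B \<and> a \<in> Ob A \<and> a' \<in> Ob A"
| "gen_ok A B (BB a b a' b') \<longleftrightarrow> a \<in> Ob A \<and> b \<in> Ob B \<and> a' \<in> Ob A \<and> b' \<in> Ob B"
| "gen_ok A B (ZL a) \<longleftrightarrow> a \<in> Ob A"
| "gen_ok A B (ZR b) \<longleftrightarrow> b \<in> Ob B"

primrec gen_dom :: "('a, 'm) permcat \<Rightarrow> ('b, 'n) permcat \<Rightarrow> ('a, 'b) gen \<Rightarrow> ('a \<times> 'b) list" where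
  "gen_dom A B (DL a b b') = [(a, b), (a, b')]"
| "gen_dom A B (DR b a a') = [(a, b), (a', b)]"
| "gen_dom A B (BB a b a' b') = [(a, b), (a', b')]"
| "gen_dom A B (ZL a) = []"
| "gen_dom A B (ZR b) = []"

primrec gen_cod :: "('a, 'm) permcat \<Rightarrow> ('b, 'n) permcat \<Rightarrow> ('a, 'b) gen \<Rightarrow> ('a \<times> 'b) list" where
  "gen_cod A B (DL a b b') = [(a, b \<oplus>\<^bsub>B\<^esub> b')]"
| "gen_cod A B (DR b a a') = [(a \<oplus>\<^bsub>A\<^esub> a', b)]"
| "gen_cod A B (BB a b a' b') = [(a', b'), (a, b)]"
| "gen_cod A B (ZL a) = [(a, \<zero>\<^bsub>B\<^esub>)]"
| "gen_cod A B (ZR b) = [(\<zero>\<^bsub>A\<^esub>, b)]"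

primrec wdom ::
    "('a, 'm) permcat \<Rightarrow> ('b, 'n) permcat \<Rightarrow> ('a, 'm, 'b, 'n) word \<Rightarrow> ('a \<times> 'b) list" where
  "wdom A B (Base fs) = map (map_prod (Dom A) (Dom B)) fs"
| "wdom A B (Gen i) = gen_dom A B i"
| "wdom A B (GenInv i) = gen_cod A B i"
| "wdom A B (w \<bullet> v) = wdom A B v"
| "wdom A B (w \<uplus> v) = wdom A B w @ wdom A B v"

primrec wcod ::
    "('a, 'm) permcat \<Rightarrow> ('b, 'n) permcat \<Rightarrow> ('a, 'm, 'b, 'n) word \<Rightarrow> ('a \<times> 'b) list" where
  "wcod A B (Base fs) = map (map_prod (Cod A) (Cod B)) fs"
| "wcod A B (Gen i) = gen_cod A B i"
| "wcod A B (GenInv i) = gen_dom A B i"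
| "wcod A B (w \<bullet> v) = wcod A B w"
| "wcod A B (w \<uplus> v) = wcod A B w @ wcod A B v"

primrec wf_word ::
    "('a, 'm) permcat \<Rightarrow> ('b, 'n) permcat \<Rightarrow> ('a, 'm, 'b, 'n) word \<Rightarrow> bool" where
  "wf_word A B (Base fs) \<longleftrightarrow> set fs \<subseteq> Ar A \<times> Ar B"
| "wf_word A B (Gen i) \<longleftrightarrow> gen_ok A B i"
| "wf_word A B (GenInv i) \<longleftrightarrow> gen_ok A B i"
| "wf_word A B (w \<bullet> v) \<longleftrightarrow> wf_word A B w \<and> wf_word A B v \<and> wdom A B w = wcod A B v"
| "wf_word A B (w \<uplus> v) \<longleftrightarrow> wf_word A B w \<and> wf_word A B v"

definition id_word ::
    "('a, 'm) permcat \<Rightarrow> ('b, 'n) permcat \<Rightarrow> ('a \<times> 'b) list \<Rightarrow> ('a, 'm, 'b, 'n) word" where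
  "id_word A B x = Base (map (map_prod \<one>\<^bsub>A\<^esub> \<one>\<^bsub>B\<^esub>) x)"

text \<open>
  The adjoined \<open>\<beta>\<close> extends in only one way to arbitrary sums subject to the
  permutative axioms, namely by
  \<open>\<beta>(p, q+y) = (1\<^sub>q + \<beta>(p,y)) \<circ> (\<beta>(p,q) + 1\<^sub>y)\<close> and
  \<open>\<beta>(p+x, y) = (\<beta>(p,y) + 1\<^sub>x) \<circ> (1\<^sub>p + \<beta>(x,y))\<close>, where \<open>p\<close> and \<open>q\<close> are single summands.
\<close>

primrec symm_word1 ::
    "('a, 'm) permcat \<Rightarrow> ('b, 'n) permcat \<Rightarrow> 'a \<times> 'b \<Rightarrow> ('a \<times> 'b) list \<Rightarrow> ('a, 'm, 'b, 'n) word" where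
  "symm_word1 A B p [] = id_word A B [p]"
| "symm_word1 A B p (q # y) =
     (id_word A B [q] \<uplus> symm_word1 A B p y) \<bullet>
     (Gen (BB (fst p) (snd p) (fst q) (snd q)) \<uplus> id_word A B y)"

primrec symm_word ::
    "('a, 'm) permcat \<Rightarrow> ('b, 'n) permcat \<Rightarrow> ('a \<times> 'b) list \<Rightarrow> ('a \<times> 'b) list
      \<Rightarrow> ('a, 'm, 'b, 'n) word" where
  "symm_word A B [] y = id_word A B y"
| "symm_word A B (p # x) y =
     (symm_word1 A B p y \<uplus> id_word A B x) \<bullet> (id_word A B [p] \<uplus> symm_word A B x y)"

definition tensor_ob ::
    "('a, 'm) permcat \<Rightarrow> ('b, 'n) permcat \<Rightarrow> ('a \<times> 'b) list set" where
  "tensor_ob A B = lists (Ob A \<times> Ob B)"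

context
  fixes A :: "('a, 'm) permcat" and B :: "('b, 'n) permcat"
begin

inductive word_eq :: "('a, 'm, 'b, 'n) word \<Rightarrow> ('a, 'm, 'b, 'n) word \<Rightarrow> bool"
    (infix "\<approx>" 50) where
  refl: "wf_word A B w \<Longrightarrow> w \<approx> w"
| sym: "w \<approx> v \<Longrightarrow> v \<approx> w"
| trans: "\<lbrakk>u \<approx> v; v \<approx> w\<rbrakk> \<Longrightarrow> u \<approx> w"
| cong_Then: "\<lbrakk>w \<approx> w'; v \<approx> v'; wdom A B w = wcod A B v\<rbrakk> \<Longrightarrow> w \<bullet> v \<approx> w' \<bullet> v'"
| cong_Sum: "\<lbrakk>w \<approx> w'; v \<approx> v'\<rbrakk> \<Longrightarrow> w \<uplus> v \<approx> w' \<uplus> v'"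
| Then_assoc: "\<lbrakk>wf_word A B (u \<bullet> v); wf_word A B (v \<bullet> w)\<rbrakk> \<Longrightarrow> (u \<bullet> v) \<bullet> w \<approx> u \<bullet> (v \<bullet> w)"
| Then_id_right: "wf_word A B w \<Longrightarrow> w \<bullet> id_word A B (wdom A B w) \<approx> w"
| Then_id_left: "wf_word A B w \<Longrightarrow> id_word A B (wcod A B w) \<bullet> w \<approx> w"
| Sum_assoc: "\<lbrakk>wf_word A B u; wf_word A B v; wf_word A B w\<rbrakk> \<Longrightarrow> (u \<uplus> v) \<uplus> w \<approx> u \<uplus> (v \<uplus> w)"
| Sum_id_right: "wf_word A B w \<Longrightarrow> w \<uplus> id_word A B [] \<approx> w"
| Sum_id_left: "wf_word A B w \<Longrightarrow> id_word A B [] \<uplus> w \<approx> w"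
| interchange: "\<lbrakk>wf_word A B (w' \<bullet> w); wf_word A B (v' \<bullet> v)\<rbrakk> \<Longrightarrow>
    (w' \<bullet> w) \<uplus> (v' \<bullet> v) \<approx> (w' \<uplus> v') \<bullet> (w \<uplus> v)"
  \<comment> \<open>\<open>Base\<close> is a strict monoidal functor; by definition of \<open>id_word\<close> it preserves identities\<close>
| Base_Then: "wf_word A B (Base fs' \<bullet> Base fs) \<Longrightarrow>
    Base fs' \<bullet> Base fs \<approx> Base (map2 (\<lambda>(f', g') (f, g). (f' \<cdot>\<^bsub>A\<^esub> f, g' \<cdot>\<^bsub>B\<^esub> g)) fs' fs)"
| Base_Sum: "wf_word A B (Base fs \<uplus> Base gs) \<Longrightarrow> Base fs \<uplus> Base gs \<approx> Base (fs @ gs)"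
| GenInv_Gen: "gen_ok A B i \<Longrightarrow> GenInv i \<bullet> Gen i \<approx> id_word A B (gen_dom A B i)"
| Gen_GenInv: "gen_ok A B i \<Longrightarrow> Gen i \<bullet> GenInv i \<approx> id_word A B (gen_cod A B i)"
| DL_natural: "\<lbrakk>f \<in> Hom A a c; g \<in> Hom B b d; g' \<in> Hom B b' d'\<rbrakk> \<Longrightarrow>
    Gen (DL c d d') \<bullet> (f \<odot> g \<uplus> f \<odot> g') \<approx> f \<odot> (g \<boxplus>\<^bsub>B\<^esub> g') \<bullet> Gen (DL a b b')"
| DR_natural: "\<lbrakk>g \<in> Hom B b d; f \<in> Hom A a c; f' \<in> Hom A a' c'\<rbrakk> \<Longrightarrow>
    Gen (DR d c c') \<bullet> (f \<odot> g \<uplus> f' \<odot> g) \<approx> (f \<boxplus>\<^bsub>A\<^esub> f') \<odot> g \<bullet> Gen (DR b a a')"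
| BB_natural: "\<lbrakk>f \<in> Hom A a c; g \<in> Hom B b d; f' \<in> Hom A a' c'; g' \<in> Hom B b' d'\<rbrakk> \<Longrightarrow>
    Gen (BB c d c' d') \<bullet> (f \<odot> g \<uplus> f' \<odot> g') \<approx> (f' \<odot> g' \<uplus> f \<odot> g) \<bullet> Gen (BB a b a' b')"
| ZL_natural: "f \<in> Hom A a c \<Longrightarrow> Gen (ZL c) \<approx> f \<odot> \<one>\<^bsub>B\<^esub> \<zero>\<^bsub>B\<^esub> \<bullet> Gen (ZL a)"
| ZR_natural: "g \<in> Hom B b d \<Longrightarrow> Gen (ZR d) \<approx> \<one>\<^bsub>A\<^esub> \<zero>\<^bsub>A\<^esub> \<odot> g \<bullet> Gen (ZR b)"
| symm_natural: "\<lbrakk>wf_word A B w; wf_word A B v\<rbrakk> \<Longrightarrow>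
    symm_word A B (wcod A B w) (wcod A B v) \<bullet> (w \<uplus> v) \<approx>
    (v \<uplus> w) \<bullet> symm_word A B (wdom A B w) (wdom A B v)"
| symm_symm: "\<lbrakk>x \<in> tensor_ob A B; y \<in> tensor_ob A B\<rbrakk> \<Longrightarrow>
    symm_word A B y x \<bullet> symm_word A B x y \<approx> id_word A B (x @ y)"
| symm_Sum: "\<lbrakk>x \<in> tensor_ob A B; y \<in> tensor_ob A B; z \<in> tensor_ob A B\<rbrakk> \<Longrightarrow>
    symm_word A B x (y @ z) \<approx>
    (id_word A B y \<uplus> symm_word A B x z) \<bullet> (symm_word A B x y \<uplus> id_word A B z)"
  \<comment> \<open>\<open>a.(-)\<close> and \<open>(-).b\<close> are symmetric monoidal functors; functoriality is in
      \<open>Base_Then\<close> and naturality of the constraints in \<open>DL_natural\<close>, \<open>DR_natural\<close>\<close>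
| DL_assoc: "\<lbrakk>a \<in> Ob A; b \<in> Ob B; b' \<in> Ob B; b'' \<in> Ob B\<rbrakk> \<Longrightarrow>
    Gen (DL a (b \<oplus>\<^bsub>B\<^esub> b') b'') \<bullet> (Gen (DL a b b') \<uplus> id_word A B [(a, b'')]) \<approx>
    Gen (DL a b (b' \<oplus>\<^bsub>B\<^esub> b'')) \<bullet> (id_word A B [(a, b)] \<uplus> Gen (DL a b' b''))"
| DL_unit_right: "\<lbrakk>a \<in> Ob A; b \<in> Ob B\<rbrakk> \<Longrightarrow>
    Gen (DL a b \<zero>\<^bsub>B\<^esub>) \<bullet> (id_word A B [(a, b)] \<uplus> Gen (ZL a)) \<approx> id_word A B [(a, b)]"
| DL_unit_left: "\<lbrakk>a \<in> Ob A; b \<in> Ob B\<rbrakk> \<Longrightarrow>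
    Gen (DL a \<zero>\<^bsub>B\<^esub> b) \<bullet> (Gen (ZL a) \<uplus> id_word A B [(a, b)]) \<approx> id_word A B [(a, b)]"
| DL_symm: "\<lbrakk>a \<in> Ob A; b \<in> Ob B; b' \<in> Ob B\<rbrakk> \<Longrightarrow>
    \<one>\<^bsub>A\<^esub> a \<odot> \<beta>\<^bsub>B\<^esub> b b' \<bullet> Gen (DL a b b') \<approx> Gen (DL a b' b) \<bullet> Gen (BB a b a b')"
| DR_assoc: "\<lbrakk>b \<in> Ob B; a \<in> Ob A; a' \<in> Ob A; a'' \<in> Ob A\<rbrakk> \<Longrightarrow>
    Gen (DR b (a \<oplus>\<^bsub>A\<^esub> a') a'') \<bullet> (Gen (DR b a a') \<uplus> id_word A B [(a'', b)]) \<approx>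
    Gen (DR b a (a' \<oplus>\<^bsub>A\<^esub> a'')) \<bullet> (id_word A B [(a, b)] \<uplus> Gen (DR b a' a''))"
| DR_unit_right: "\<lbrakk>b \<in> Ob B; a \<in> Ob A\<rbrakk> \<Longrightarrow>
    Gen (DR b a \<zero>\<^bsub>A\<^esub>) \<bullet> (id_word A B [(a, b)] \<uplus> Gen (ZR b)) \<approx> id_word A B [(a, b)]"
| DR_unit_left: "\<lbrakk>b \<in> Ob B; a \<in> Ob A\<rbrakk> \<Longrightarrow>
    Gen (DR b \<zero>\<^bsub>A\<^esub> a) \<bullet> (Gen (ZR b) \<uplus> id_word A B [(a, b)]) \<approx> id_word A B [(a, b)]"
| DR_symm: "\<lbrakk>b \<in> Ob B; a \<in> Ob A; a' \<in> Ob A\<rbrakk> \<Longrightarrow>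
    \<beta>\<^bsub>A\<^esub> a a' \<odot> \<one>\<^bsub>B\<^esub> b \<bullet> Gen (DR b a a') \<approx> Gen (DR b a' a) \<bullet> Gen (BB a b a' b)"
| DL_DR: "\<lbrakk>a \<in> Ob A; a' \<in> Ob A; b \<in> Ob B; b' \<in> Ob B\<rbrakk> \<Longrightarrow>
    Gen (DL (a \<oplus>\<^bsub>A\<^esub> a') b b') \<bullet> (Gen (DR b a a') \<uplus> Gen (DR b' a a')) \<approx>
    Gen (DR (b \<oplus>\<^bsub>B\<^esub> b') a a') \<bullet> (Gen (DL a b b') \<uplus> Gen (DL a' b b')) \<bullet>
      (id_word A B [(a, b)] \<uplus> Gen (BB a' b a b') \<uplus> id_word A B [(a', b')])"
| ZL_ZR: "Gen (ZL \<zero>\<^bsub>A\<^esub>) \<approx> Gen (ZR \<zero>\<^bsub>B\<^esub>)"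
| DR_ZL: "\<lbrakk>a \<in> Ob A; a' \<in> Ob A\<rbrakk> \<Longrightarrow>
    Gen (DR \<zero>\<^bsub>B\<^esub> a a') \<bullet> (Gen (ZL a) \<uplus> Gen (ZL a')) \<approx> Gen (ZL (a \<oplus>\<^bsub>A\<^esub> a'))"
| DL_ZR: "\<lbrakk>b \<in> Ob B; b' \<in> Ob B\<rbrakk> \<Longrightarrow>
    Gen (DL \<zero>\<^bsub>A\<^esub> b b') \<bullet> (Gen (ZR b) \<uplus> Gen (ZR b')) \<approx> Gen (ZR (b \<oplus>\<^bsub>B\<^esub> b'))"

end

definition word_rel ::
    "('a, 'm) permcat \<Rightarrow> ('b, 'n) permcat \<Rightarrow> ('a, 'm, 'b, 'n) word rel" where
  "word_rel A B = {(w, v). word_eq A B w v}"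

definition word_class ::
    "('a, 'm) permcat \<Rightarrow> ('b, 'n) permcat \<Rightarrow> ('a, 'm, 'b, 'n) word \<Rightarrow> ('a, 'm, 'b, 'n) word set" where
  "word_class A B w = word_rel A B `` {w}"

definition tensor ::
    "('a, 'm) permcat \<Rightarrow> ('b, 'n) permcat
      \<Rightarrow> (('a \<times> 'b) list, ('a, 'm, 'b, 'n) word set) permcat" (infixr "\<otimes>\<^sub>0" 70) where
  "A \<otimes>\<^sub>0 B = \<lparr>
     Ob = tensor_ob A B,
     Ar = {w. wf_word A B w} // word_rel A B,
     Dom = (\<lambda>X. the_elem (wdom A B ` X)),
     Cod = (\<lambda>X. the_elem (wcod A B ` X)),
     Idt = (\<lambda>x. word_class A B (id_word A B x)),
     Cmp = (\<lambda>X Y. word_rel A B `` {w \<bullet> v | w v. w \<in> X \<and> v \<in> Y}),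
     Plus_ob = (@),
     Plus_ar = (\<lambda>X Y. word_rel A B `` {w \<uplus> v | w v. w \<in> X \<and> v \<in> Y}),
     Zero = [],
     Symm = (\<lambda>x y. word_class A B (symm_word A B x y)) \<rparr>"


section \<open>The tensor product of functors and transformations\<close>

primrec gen_map ::
    "('a, 'm, 'c, 'k) smfun \<Rightarrow> ('b, 'n, 'd, 'l) smfun \<Rightarrow> ('a, 'b) gen \<Rightarrow> ('c, 'k, 'd, 'l) word" where
  "gen_map F G (DL a b b') =
     \<one>\<^bsub>Trg F\<^esub> (On_ob F a) \<odot> Mul G (b, b') \<bullet> Gen (DL (On_ob F a) (On_ob G b) (On_ob G b'))"
| "gen_map F G (DR b a a') =
     Mul F (a, a') \<odot> \<one>\<^bsub>Trg G\<^esub> (On_ob G b) \<bullet> Gen (DR (On_ob G b) (On_ob F a) (On_ob F a'))"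
| "gen_map F G (BB a b a' b') = Gen (BB (On_ob F a) (On_ob G b) (On_ob F a') (On_ob G b'))"
| "gen_map F G (ZL a) = \<one>\<^bsub>Trg F\<^esub> (On_ob F a) \<odot> Unt G \<bullet> Gen (ZL (On_ob F a))"
| "gen_map F G (ZR b) = Unt F \<odot> \<one>\<^bsub>Trg G\<^esub> (On_ob G b) \<bullet> Gen (ZR (On_ob G b))"

text \<open>The images of the formal inverses are forced: they are the inverses of the above.\<close>

primrec gen_map_inv ::
    "('a, 'm, 'c, 'k) smfun \<Rightarrow> ('b, 'n, 'd, 'l) smfun \<Rightarrow> ('a, 'b) gen \<Rightarrow> ('c, 'k, 'd, 'l) word" where
  "gen_map_inv F G (DL a b b') =
     GenInv (DL (On_ob F a) (On_ob G b) (On_ob G b')) \<bullet>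
     \<one>\<^bsub>Trg F\<^esub> (On_ob F a) \<odot> inv_ar (Trg G) (Mul G (b, b'))"
| "gen_map_inv F G (DR b a a') =
     GenInv (DR (On_ob G b) (On_ob F a) (On_ob F a')) \<bullet>
     inv_ar (Trg F) (Mul F (a, a')) \<odot> \<one>\<^bsub>Trg G\<^esub> (On_ob G b)"
| "gen_map_inv F G (BB a b a' b') =
     GenInv (BB (On_ob F a) (On_ob G b) (On_ob F a') (On_ob G b'))"
| "gen_map_inv F G (ZL a) =
     GenInv (ZL (On_ob F a)) \<bullet> \<one>\<^bsub>Trg F\<^esub> (On_ob F a) \<odot> inv_ar (Trg G) (Unt G)"
| "gen_map_inv F G (ZR b) =
     GenInv (ZR (On_ob G b)) \<bullet> inv_ar (Trg F) (Unt F) \<odot> \<one>\<^bsub>Trg G\<^esub> (On_ob G b)"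

primrec word_map ::
    "('a, 'm, 'c, 'k) smfun \<Rightarrow> ('b, 'n, 'd, 'l) smfun
      \<Rightarrow> ('a, 'm, 'b, 'n) word \<Rightarrow> ('c, 'k, 'd, 'l) word" where
  "word_map F G (Base fs) = Base (map (map_prod (On_ar F) (On_ar G)) fs)"
| "word_map F G (Gen i) = gen_map F G i"
| "word_map F G (GenInv i) = gen_map_inv F G i"
| "word_map F G (w \<bullet> v) = word_map F G w \<bullet> word_map F G v"
| "word_map F G (w \<uplus> v) = word_map F G w \<uplus> word_map F G v"

text \<open>
  On morphisms the tensor product takes a class to the union of the classes of the images of all
  its representatives. This union is a morphism only if it is a single class, that is, only if the
  assignment on generators respects the relations.
\<close>

definition tensor_smfun ::
    "('a, 'm, 'c, 'k) smfun \<Rightarrow> ('b, 'n, 'd, 'l) smfun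
      \<Rightarrow> (('a \<times> 'b) list, ('a, 'm, 'b, 'n) word set,
          ('c \<times> 'd) list, ('c, 'k, 'd, 'l) word set) smfun" (infixr "\<otimes>\<^sub>1" 70) where
  "F \<otimes>\<^sub>1 G =
    (let S = Src F \<otimes>\<^sub>0 Src G; T = Trg F \<otimes>\<^sub>0 Trg G; h = map (map_prod (On_ob F) (On_ob G)) in
     \<lparr> Src = S, Trg = T,
       On_ob = restrict h (Ob S),
       On_ar = restrict (\<lambda>X. word_rel (Trg F) (Trg G) `` (word_map F G ` X)) (Ar S),
       Mul = restrict (\<lambda>(x, y). \<one>\<^bsub>T\<^esub> (h x \<oplus>\<^bsub>T\<^esub> h y)) (Ob S \<times> Ob S),
       Unt = \<one>\<^bsub>T\<^esub> \<zero>\<^bsub>T\<^esub> \<rparr>)"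

definition tensor_mtrans ::
    "('a, 'm, 'c, 'k) mtrans \<Rightarrow> ('b, 'n, 'd, 'l) mtrans
      \<Rightarrow> (('a \<times> 'b) list, ('a, 'm, 'b, 'n) word set,
          ('c \<times> 'd) list, ('c, 'k, 'd, 'l) word set) mtrans" (infixr "\<otimes>\<^sub>2" 70) where
  "\<phi> \<otimes>\<^sub>2 \<psi> = \<lparr>
     Src_fun = Src_fun \<phi> \<otimes>\<^sub>1 Src_fun \<psi>,
     Trg_fun = Trg_fun \<phi> \<otimes>\<^sub>1 Trg_fun \<psi>,
     Component = restrict
       (\<lambda>x. word_class (Trg (Src_fun \<phi>)) (Trg (Src_fun \<psi>))
              (Base (map (map_prod (Component \<phi>) (Component \<psi>)) x)))
       (Ob (Src (Src_fun \<phi>) \<otimes>\<^sub>0 Src (Src_fun \<psi>))) \<rparr>"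

end

theory Submission
  imports Defs
begin

text \<open>
  By functoriality of \<open>Base\<close>, a relation between words over \<open>A\<close> and \<open>B\<close> has only to be checked on
  generators. For fixed \<open>a\<close>, the functor \<open>a.(-)\<close> into \<open>A' \<otimes> B'\<close> is symmetric monoidal with
  constraints \<open>\<delta>\<^sup>L\<close> and \<open>\<zeta>\<^sup>L\<close>, and \<open>F \<otimes> G\<close> sends \<open>\<delta>\<^sup>L\<^sub>a\<close> and \<open>\<zeta>\<^sup>L\<^sub>a\<close> to the constraints of its composite
  \<open>Fa.G(-)\<close> with \<open>G\<close>. Hence the associativity, unit and symmetry relations are preserved because
  symmetric monoidal functors compose. The other relations, and the naturality of \<open>\<phi> \<otimes> \<psi>\<close> at the
  generators, are instances of the naturality of \<open>\<delta>\<close>, \<open>\<zeta>\<close> and \<open>\<beta>\<close> with respect to \<open>f.g\<close>. Formal inverses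
  are dealt with by uniqueness of inverses.
\<close>

section \<open>Arrows of a permutative category\<close>

text \<open>The obstacle is that \<open>F \<otimes>\<^sub>1 G\<close> does not send generators to
  generators: the image of \<delta> or \<zeta> is that isomorphism followed by a constraint of
  \<open>F\<close> or \<open>G\<close> in one slot. The image of a relation between generators is
  therefore not a relation, because constraints stand between the generators. They have to be moved
  to the outside first, and this is possible because \<open>f.g\<close> is both \<open>1.g\<close>
  after \<open>f.1\<close> and \<open>f.1\<close> after \<open>1.g\<close>. The move is made once
  for each kind of generator, in \<open>DL_square\<close>, \<open>DR_square\<close>,
  \<open>ZL_square\<close> and \<open>ZR_square\<close>. For \<delta> the input is a commuting
  square in one factor: naturality of a constraint, monoidality of a transformation, or a degenerate
  square with identities. Words are left behind as early as possible. Once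
  \<open>A \<otimes>\<^sub>0 B\<close> is known to be a permutative category, preservation of
  relations is stated for the arrows \<open>E w\<close> of the target, so that associativity and
  interchange become rewriting. Words come back only to show that the union defining
  \<open>On_ar\<close> of a tensor product is a single class.\<close>

lemma Hom_iff: "f \<in> Hom C x y \<longleftrightarrow> f \<in> Ar C \<and> Dom C f = x \<and> Cod C f = y"
  by (auto simp: Hom_def)

context category
begin

lemma Idt_ar [simp]:
  "x \<in> Ob C \<Longrightarrow> \<one> x \<in> Ar C" "x \<in> Ob C \<Longrightarrow> Dom C (\<one> x) = x" "x \<in> Ob C \<Longrightarrow> Cod C (\<one> x) = x"
  using Idt_Hom by (auto simp: Hom_iff)

lemma Cmp_ar [simp]:
  assumes "f \<in> Ar C" "g \<in> Ar C" "Cod C f = Dom C g"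
  shows "g \<cdot> f \<in> Ar C" "Dom C (g \<cdot> f) = Dom C f" "Cod C (g \<cdot> f) = Cod C g"
  using Cmp_Hom[of f "Dom C f" "Cod C f" g "Cod C g"] assms by (auto simp: Hom_iff)

lemma Dom_Cod_Ob [simp]: "f \<in> Ar C \<Longrightarrow> Dom C f \<in> Ob C" "f \<in> Ar C \<Longrightarrow> Cod C f \<in> Ob C"
  by (auto intro: Dom_Ob Cod_Ob)

lemma Cmp_Idt [simp]:
  "f \<in> Ar C \<Longrightarrow> x = Dom C f \<Longrightarrow> f \<cdot> \<one> x = f" "f \<in> Ar C \<Longrightarrow> x = Cod C f \<Longrightarrow> \<one> x \<cdot> f = f"
  using Cmp_Idt_right Cmp_Idt_left by (auto simp: Hom_iff)

lemma Cmp_assoc_ar [simp]: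
  assumes "f \<in> Ar C" "g \<in> Ar C" "h \<in> Ar C" "Cod C f = Dom C g" "Cod C g = Dom C h"
  shows "(h \<cdot> g) \<cdot> f = h \<cdot> (g \<cdot> f)"
  using Cmp_assoc[of f "Dom C f" "Dom C g" g "Dom C h" h "Cod C h"] assms by (auto simp: Hom_iff)

lemma inverse_pairD:
  assumes "inverse_pair C f g"
  shows "f \<in> Ar C" "g \<in> Ar C" "Dom C g = Cod C f" "Cod C g = Dom C f"
    "g \<cdot> f = \<one> (Dom C f)" "f \<cdot> g = \<one> (Cod C f)"
  using assms by (auto simp: inverse_pair_def Hom_iff)

lemma inverse_pairI:
  assumes "f \<in> Ar C" "g \<in> Ar C" "Dom C g = Cod C f" "Cod C g = Dom C f"
    "g \<cdot> f = \<one> (Dom C f)" "f \<cdot> g = \<one> (Cod C f)"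
  shows "inverse_pair C f g"
  using assms by (auto simp: inverse_pair_def Hom_iff)

lemma inverse_pair_unique:
  assumes "inverse_pair C f g" "inverse_pair C f h" shows "g = h"
proof -
  note g = inverse_pairD[OF assms(1)] and h = inverse_pairD[OF assms(2)]
  have "g = g \<cdot> (f \<cdot> h)" using g(1-4) h by simp
  also have "\<dots> = (g \<cdot> f) \<cdot> h" using g(1-4) h(1-4) by simp
  also have "\<dots> = h" using g h(1-4) by simp
  finally show ?thesis .
qed

lemma inv_ar_eq: "inverse_pair C f g \<Longrightarrow> inv_ar C f = g"
  unfolding inv_ar_def by (blast intro: the_equality inverse_pair_unique)

lemma inverse_pair_inv_ar: "is_iso C f \<Longrightarrow> inverse_pair C f (inv_ar C f)"
  by (auto simp: is_iso_def inv_ar_eq)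

lemma inverse_pair_Idt [simp]: "x \<in> Ob C \<Longrightarrow> inverse_pair C (\<one> x) (\<one> x)"
  by (rule inverse_pairI) auto

lemma inverse_pair_Cmp:
  assumes "inverse_pair C f f'" "inverse_pair C g g'" "Cod C f = Dom C g"
  shows "inverse_pair C (g \<cdot> f) (f' \<cdot> g')"
proof (rule inverse_pairI)
  note f = inverse_pairD[OF assms(1)] and g = inverse_pairD[OF assms(2)]
  show "g \<cdot> f \<in> Ar C" "f' \<cdot> g' \<in> Ar C" "Dom C (f' \<cdot> g') = Cod C (g \<cdot> f)"
    "Cod C (f' \<cdot> g') = Dom C (g \<cdot> f)"
    using f(1-4) g(1-4) assms(3) by auto
  have "(f' \<cdot> g') \<cdot> g \<cdot> f = f' \<cdot> ((g' \<cdot> g) \<cdot> f)" using f(1-4) g(1-4) assms(3) by simp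
  then show "(f' \<cdot> g') \<cdot> g \<cdot> f = \<one> (Dom C (g \<cdot> f))" using f g assms(3) by simp
  have "(g \<cdot> f) \<cdot> f' \<cdot> g' = g \<cdot> ((f \<cdot> f') \<cdot> g')" using f(1-4) g(1-4) assms(3) by simp
  then show "(g \<cdot> f) \<cdot> f' \<cdot> g' = \<one> (Cod C (g \<cdot> f))" using f g assms(3) by simp
qed

text \<open>Multiplying the square by both inverses reverses its two invertible sides. In this way
  naturality at an adjoined isomorphism passes to its formal inverse.\<close>

lemma inverse_pair_square:
  assumes "inverse_pair C f f'" "inverse_pair C g g'" "v \<cdot> f = g \<cdot> u"
    "u \<in> Ar C" "v \<in> Ar C" "Dom C v = Cod C f" "Cod C u = Dom C g"
  shows "u \<cdot> f' = g' \<cdot> v"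
proof -
  note f = inverse_pairD[OF assms(1)] and g = inverse_pairD[OF assms(2)]
  \<comment> \<open>The missing ends are found by comparing domains and codomains of the two sides
    of the commuting square.\<close>
  have du: "Dom C u = Dom C f" "Cod C v = Cod C g"
    using assms f(1) g(1) by (metis Cmp_ar(2), metis Cmp_ar(3))
  have "g' \<cdot> v = g' \<cdot> (v \<cdot> (f \<cdot> f'))" using f g(1-4) assms(4-) du by simp
  also have "\<dots> = g' \<cdot> ((v \<cdot> f) \<cdot> f')" using f(1-4) g(1-4) assms(4-) du by simp
  also have "\<dots> = (g' \<cdot> g) \<cdot> (u \<cdot> f')" unfolding assms(3) using f(1-4) g(1-4) assms(4-) du by simp
  also have "\<dots> = u \<cdot> f'" using f(1-4) g assms(4-) du by simp
  finally show ?thesis by simp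
qed

end

context strict_monoidal_category
begin

lemma Plus_ar_simps [simp]:
  assumes "f \<in> Ar C" "g \<in> Ar C"
  shows "f \<boxplus> g \<in> Ar C" "Dom C (f \<boxplus> g) = Dom C f \<oplus> Dom C g" "Cod C (f \<boxplus> g) = Cod C f \<oplus> Cod C g"
  using Plus_Hom[of f "Dom C f" "Cod C f" g "Dom C g" "Cod C g"] assms by (auto simp: Hom_iff)

lemmas [simp] = Zero_Ob Plus_Ob Plus_ob_assoc Zero_left Zero_right Plus_Idt Plus_ar_assoc
  Zero_ar_left Zero_ar_right

lemma Plus_Cmp_ar:
  assumes "f \<in> Ar C" "f' \<in> Ar C" "g \<in> Ar C" "g' \<in> Ar C" "Cod C f = Dom C f'" "Cod C g = Dom C g'"
  shows "(f' \<boxplus> g') \<cdot> (f \<boxplus> g) = (f' \<cdot> f) \<boxplus> (g' \<cdot> g)"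
  using Plus_Cmp[of f "Dom C f" "Cod C f" f' "Cod C f'" g "Dom C g" "Cod C g" g' "Cod C g'"] assms
  by (auto simp: Hom_iff)

end

context permutative_category
begin

lemma Symm_ar [simp]:
  assumes "x \<in> Ob C" "y \<in> Ob C"
  shows "\<beta> x y \<in> Ar C" "Dom C (\<beta> x y) = x \<oplus> y" "Cod C (\<beta> x y) = y \<oplus> x"
  using Symm_Hom[of x y] assms by (auto simp: Hom_iff)

lemma Symm_natural_ar:
  assumes "f \<in> Ar C" "g \<in> Ar C"
  shows "\<beta> (Cod C f) (Cod C g) \<cdot> (f \<boxplus> g) = (g \<boxplus> f) \<cdot> \<beta> (Dom C f) (Dom C g)"
  using Symm_natural[of f "Dom C f" "Cod C f" g "Dom C g" "Cod C g"] assms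
  by (auto simp: Hom_iff)

end

section \<open>The 2-category of permutative categories\<close>

context symmetric_monoidal_functor
begin

lemma On_simps [simp]:
  "x \<in> Ob A \<Longrightarrow> On_ob F x \<in> Ob B"
  "f \<in> Ar A \<Longrightarrow> On_ar F f \<in> Ar B"
  "f \<in> Ar A \<Longrightarrow> Dom B (On_ar F f) = On_ob F (Dom A f)"
  "f \<in> Ar A \<Longrightarrow> Cod B (On_ar F f) = On_ob F (Cod A f)"
  "x \<in> Ob A \<Longrightarrow> On_ar F (\<one>\<^bsub>A\<^esub> x) = \<one>\<^bsub>B\<^esub> (On_ob F x)"
  using On_ob On_ar[of f "Dom A f" "Cod A f"] On_Idt by (auto simp: Hom_iff)

lemma On_Cmp_ar:
  "\<lbrakk>f \<in> Ar A; g \<in> Ar A; Cod A f = Dom A g\<rbrakk> \<Longrightarrow> On_ar F (g \<cdot>\<^bsub>A\<^esub> f) = On_ar F g \<cdot>\<^bsub>B\<^esub> On_ar F f"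
  using On_Cmp[of f "Dom A f" "Cod A f" g "Cod A g"] by (auto simp: Hom_iff)

lemma Mul_ar [simp]:
  assumes "x \<in> Ob A" "y \<in> Ob A"
  shows "Mul F (x, y) \<in> Ar B" "Dom B (Mul F (x, y)) = On_ob F x \<oplus>\<^bsub>B\<^esub> On_ob F y"
    "Cod B (Mul F (x, y)) = On_ob F (x \<oplus>\<^bsub>A\<^esub> y)"
  using Mul_Hom[OF assms] by (auto simp: Hom_iff)

lemma Unt_ar [simp]:
  "Unt F \<in> Ar B" "Dom B (Unt F) = \<zero>\<^bsub>B\<^esub>" "Cod B (Unt F) = On_ob F \<zero>\<^bsub>A\<^esub>"
  using Unt_Hom by (auto simp: Hom_iff)

lemma Mul_natural_ar:
  assumes "f \<in> Ar A" "g \<in> Ar A"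
  shows "On_ar F (f \<boxplus>\<^bsub>A\<^esub> g) \<cdot>\<^bsub>B\<^esub> Mul F (Dom A f, Dom A g) =
    Mul F (Cod A f, Cod A g) \<cdot>\<^bsub>B\<^esub> (On_ar F f \<boxplus>\<^bsub>B\<^esub> On_ar F g)"
  using Mul_natural[of f "Dom A f" "Cod A f" g "Dom A g" "Cod A g"] assms by (auto simp: Hom_iff)

lemma inverse_pair_On_ar:
  "inverse_pair A f g \<Longrightarrow> inverse_pair B (On_ar F f) (On_ar F g)"
  using A.inverse_pairD[of f g]
  by (intro B.inverse_pairI) (simp_all flip: On_Cmp_ar)

end

text \<open>The locale axioms speak of \<open>Hom\<close> sets. Splitting them into
  \<open>Ar\<close>, \<open>Dom\<close> and \<open>Cod\<close> lets typing conditions be settled by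
  rewriting, without guessing end points.\<close>

lemma symmetric_monoidal_functorI:
  assumes "permutative_category A" "permutative_category B" "Src F = A" "Trg F = B"
    and "On_ob F \<in> extensional (Ob A)" "On_ar F \<in> extensional (Ar A)"
      "Mul F \<in> extensional (Ob A \<times> Ob A)"
    and "\<And>x. x \<in> Ob A \<Longrightarrow> On_ob F x \<in> Ob B"
    and "\<And>f. f \<in> Ar A \<Longrightarrow> On_ar F f \<in> Ar B"
      "\<And>f. f \<in> Ar A \<Longrightarrow> Dom B (On_ar F f) = On_ob F (Dom A f)"
      "\<And>f. f \<in> Ar A \<Longrightarrow> Cod B (On_ar F f) = On_ob F (Cod A f)"
    and "\<And>x. x \<in> Ob A \<Longrightarrow> On_ar F (\<one>\<^bsub>A\<^esub> x) = \<one>\<^bsub>B\<^esub> (On_ob F x)"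
    and "\<And>f g. \<lbrakk>f \<in> Ar A; g \<in> Ar A; Cod A f = Dom A g\<rbrakk> \<Longrightarrow>
      On_ar F (g \<cdot>\<^bsub>A\<^esub> f) = On_ar F g \<cdot>\<^bsub>B\<^esub> On_ar F f"
    and "\<And>x y. \<lbrakk>x \<in> Ob A; y \<in> Ob A\<rbrakk> \<Longrightarrow> Mul F (x, y) \<in> Ar B"
      "\<And>x y. \<lbrakk>x \<in> Ob A; y \<in> Ob A\<rbrakk> \<Longrightarrow> Dom B (Mul F (x, y)) = On_ob F x \<oplus>\<^bsub>B\<^esub> On_ob F y"
      "\<And>x y. \<lbrakk>x \<in> Ob A; y \<in> Ob A\<rbrakk> \<Longrightarrow> Cod B (Mul F (x, y)) = On_ob F (x \<oplus>\<^bsub>A\<^esub> y)"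
      "\<And>x y. \<lbrakk>x \<in> Ob A; y \<in> Ob A\<rbrakk> \<Longrightarrow> is_iso B (Mul F (x, y))"
    and "\<And>f g. \<lbrakk>f \<in> Ar A; g \<in> Ar A\<rbrakk> \<Longrightarrow> On_ar F (f \<boxplus>\<^bsub>A\<^esub> g) \<cdot>\<^bsub>B\<^esub> Mul F (Dom A f, Dom A g) =
      Mul F (Cod A f, Cod A g) \<cdot>\<^bsub>B\<^esub> (On_ar F f \<boxplus>\<^bsub>B\<^esub> On_ar F g)"
    and "Unt F \<in> Ar B" "Dom B (Unt F) = \<zero>\<^bsub>B\<^esub>" "Cod B (Unt F) = On_ob F \<zero>\<^bsub>A\<^esub>"
      "is_iso B (Unt F)"
    and "\<And>x y z. \<lbrakk>x \<in> Ob A; y \<in> Ob A; z \<in> Ob A\<rbrakk> \<Longrightarrow>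
        Mul F (x \<oplus>\<^bsub>A\<^esub> y, z) \<cdot>\<^bsub>B\<^esub> (Mul F (x, y) \<boxplus>\<^bsub>B\<^esub> \<one>\<^bsub>B\<^esub> (On_ob F z)) =
        Mul F (x, y \<oplus>\<^bsub>A\<^esub> z) \<cdot>\<^bsub>B\<^esub> (\<one>\<^bsub>B\<^esub> (On_ob F x) \<boxplus>\<^bsub>B\<^esub> Mul F (y, z))"
    and "\<And>x. x \<in> Ob A \<Longrightarrow>
        Mul F (x, \<zero>\<^bsub>A\<^esub>) \<cdot>\<^bsub>B\<^esub> (\<one>\<^bsub>B\<^esub> (On_ob F x) \<boxplus>\<^bsub>B\<^esub> Unt F) = \<one>\<^bsub>B\<^esub> (On_ob F x)"
    and "\<And>x. x \<in> Ob A \<Longrightarrow>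
        Mul F (\<zero>\<^bsub>A\<^esub>, x) \<cdot>\<^bsub>B\<^esub> (Unt F \<boxplus>\<^bsub>B\<^esub> \<one>\<^bsub>B\<^esub> (On_ob F x)) = \<one>\<^bsub>B\<^esub> (On_ob F x)"
    and "\<And>x y. \<lbrakk>x \<in> Ob A; y \<in> Ob A\<rbrakk> \<Longrightarrow>
        On_ar F (\<beta>\<^bsub>A\<^esub> x y) \<cdot>\<^bsub>B\<^esub> Mul F (x, y) =
        Mul F (y, x) \<cdot>\<^bsub>B\<^esub> \<beta>\<^bsub>B\<^esub> (On_ob F x) (On_ob F y)"
  shows "symmetric_monoidal_functor A B F"
proof -
  interpret A: permutative_category A by fact
  interpret B: permutative_category B by fact
  show ?thesis
  proof unfold_locales
    fix f g x y x' y' assume "f \<in> Hom A x x'" "g \<in> Hom A y y'"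
    then show "On_ar F (f \<boxplus>\<^bsub>A\<^esub> g) \<cdot>\<^bsub>B\<^esub> Mul F (x, y) =
        Mul F (x', y') \<cdot>\<^bsub>B\<^esub> (On_ar F f \<boxplus>\<^bsub>B\<^esub> On_ar F g)"
      using assms(18)[of f g] by (auto simp: Hom_iff)
  qed (use assms in \<open>simp_all add: Hom_iff\<close>)
qed

lemma symmetric_monoidal_functor_id:
  assumes "permutative_category A"
  shows "symmetric_monoidal_functor A A (id_smfun A)"
proof -
  interpret permutative_category A by fact
  show ?thesis
    by (rule symmetric_monoidal_functorI[OF assms assms])
      (auto simp: id_smfun_def is_iso_def intro!: exI inverse_pair_Idt)
qed

section \<open>Composition of symmetric monoidal functors\<close>

locale smfun_pair =
  F: symmetric_monoidal_functor A B F + G: symmetric_monoidal_functor B C G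
  for A :: "('o, 'm) permcat" and B :: "('p, 'n) permcat" and C :: "('q, 'k) permcat" and F G
begin

abbreviation "GF \<equiv> comp_smfun G F"

lemma comp_sel [simp]:
  "Src GF = A" "Trg GF = C"
  "x \<in> Ob A \<Longrightarrow> On_ob GF x = On_ob G (On_ob F x)"
  "f \<in> Ar A \<Longrightarrow> On_ar GF f = On_ar G (On_ar F f)"
  "\<lbrakk>x \<in> Ob A; y \<in> Ob A\<rbrakk> \<Longrightarrow>
    Mul GF (x, y) = On_ar G (Mul F (x, y)) \<cdot>\<^bsub>C\<^esub> Mul G (On_ob F x, On_ob F y)"
  "Unt GF = On_ar G (Unt F) \<cdot>\<^bsub>C\<^esub> Unt G"
  by (simp_all add: comp_smfun_def F.Src G.Trg)

lemma comp_ext: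
  "On_ob GF \<in> extensional (Ob A)" "On_ar GF \<in> extensional (Ar A)"
  "Mul GF \<in> extensional (Ob A \<times> Ob A)"
  by (simp_all add: comp_smfun_def F.Src)

text \<open>Two squares are pasted: \<open>G\<close> applied to the naturality square of
  \<open>Mul F\<close>, and the naturality square of \<open>Mul G\<close> at
  \<open>On_ar F f\<close> and \<open>On_ar F g\<close>.\<close>

lemma comp_Mul_natural:
  assumes f: "f \<in> Ar A" and g: "g \<in> Ar A"
  shows "On_ar GF (f \<boxplus>\<^bsub>A\<^esub> g) \<cdot>\<^bsub>C\<^esub> Mul GF (Dom A f, Dom A g) =
    Mul GF (Cod A f, Cod A g) \<cdot>\<^bsub>C\<^esub> (On_ar GF f \<boxplus>\<^bsub>C\<^esub> On_ar GF g)"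
proof -
  let ?d = "Mul G (On_ob F (Dom A f), On_ob F (Dom A g))"
  have "On_ar GF (f \<boxplus>\<^bsub>A\<^esub> g) \<cdot>\<^bsub>C\<^esub> Mul GF (Dom A f, Dom A g) =
      On_ar G (On_ar F (f \<boxplus>\<^bsub>A\<^esub> g) \<cdot>\<^bsub>B\<^esub> Mul F (Dom A f, Dom A g)) \<cdot>\<^bsub>C\<^esub> ?d"
    using f g by (simp add: G.On_Cmp_ar)
  also have "\<dots> = On_ar G (Mul F (Cod A f, Cod A g)) \<cdot>\<^bsub>C\<^esub>
      (On_ar G (On_ar F f \<boxplus>\<^bsub>B\<^esub> On_ar F g) \<cdot>\<^bsub>C\<^esub> ?d)"
    using f g by (simp add: G.On_Cmp_ar F.Mul_natural_ar)
  also have "\<dots> = On_ar G (Mul F (Cod A f, Cod A g)) \<cdot>\<^bsub>C\<^esub>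
      (Mul G (On_ob F (Cod A f), On_ob F (Cod A g)) \<cdot>\<^bsub>C\<^esub> (On_ar G (On_ar F f) \<boxplus>\<^bsub>C\<^esub> On_ar G (On_ar F g)))"
    using f g G.Mul_natural_ar[of "On_ar F f" "On_ar F g"] by simp
  finally show ?thesis using f g by simp
qed

text \<open>\<open>Mul GF\<close> interleaves \<open>Mul G\<close> with the images of
  \<open>Mul F\<close>. Naturality of \<open>Mul G\<close> at \<open>Mul F\<close> separates them:
  each side becomes \<open>G\<close> of one side of the law for \<open>F\<close>, after one side of
  the law for \<open>G\<close>.\<close>

lemma comp_Mul_assoc:
  assumes x: "x \<in> Ob A" and y: "y \<in> Ob A" and z: "z \<in> Ob A"
  shows "Mul GF (x \<oplus>\<^bsub>A\<^esub> y, z) \<cdot>\<^bsub>C\<^esub> (Mul GF (x, y) \<boxplus>\<^bsub>C\<^esub> \<one>\<^bsub>C\<^esub> (On_ob GF z)) =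
        Mul GF (x, y \<oplus>\<^bsub>A\<^esub> z) \<cdot>\<^bsub>C\<^esub> (\<one>\<^bsub>C\<^esub> (On_ob GF x) \<boxplus>\<^bsub>C\<^esub> Mul GF (y, z))"
proof -
  let ?x = "On_ob F x" and ?y = "On_ob F y" and ?z = "On_ob F z"
  have l: "Mul G (On_ob F (x \<oplus>\<^bsub>A\<^esub> y), ?z) \<cdot>\<^bsub>C\<^esub> (On_ar G (Mul F (x, y)) \<boxplus>\<^bsub>C\<^esub> \<one>\<^bsub>C\<^esub> (On_ob G ?z)) =
      On_ar G (Mul F (x, y) \<boxplus>\<^bsub>B\<^esub> \<one>\<^bsub>B\<^esub> ?z) \<cdot>\<^bsub>C\<^esub> Mul G (?x \<oplus>\<^bsub>B\<^esub> ?y, ?z)"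
    using G.Mul_natural_ar[of "Mul F (x, y)" "\<one>\<^bsub>B\<^esub> ?z"] assms by simp
  have r: "Mul G (?x, On_ob F (y \<oplus>\<^bsub>A\<^esub> z)) \<cdot>\<^bsub>C\<^esub> (\<one>\<^bsub>C\<^esub> (On_ob G ?x) \<boxplus>\<^bsub>C\<^esub> On_ar G (Mul F (y, z))) =
      On_ar G (\<one>\<^bsub>B\<^esub> ?x \<boxplus>\<^bsub>B\<^esub> Mul F (y, z)) \<cdot>\<^bsub>C\<^esub> Mul G (?x, ?y \<oplus>\<^bsub>B\<^esub> ?z)"
    using G.Mul_natural_ar[of "\<one>\<^bsub>B\<^esub> ?x" "Mul F (y, z)"] assms by simp
  let ?L = "On_ar G (Mul F (x, y)) \<boxplus>\<^bsub>C\<^esub> \<one>\<^bsub>C\<^esub> (On_ob G ?z)"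
    and ?L' = "Mul G (?x, ?y) \<boxplus>\<^bsub>C\<^esub> \<one>\<^bsub>C\<^esub> (On_ob G ?z)"
    and ?R = "\<one>\<^bsub>C\<^esub> (On_ob G ?x) \<boxplus>\<^bsub>C\<^esub> On_ar G (Mul F (y, z))"
    and ?R' = "\<one>\<^bsub>C\<^esub> (On_ob G ?x) \<boxplus>\<^bsub>C\<^esub> Mul G (?y, ?z)"
  have "Mul GF (x \<oplus>\<^bsub>A\<^esub> y, z) \<cdot>\<^bsub>C\<^esub> (Mul GF (x, y) \<boxplus>\<^bsub>C\<^esub> \<one>\<^bsub>C\<^esub> (On_ob GF z)) =
     On_ar G (Mul F (x \<oplus>\<^bsub>A\<^esub> y, z)) \<cdot>\<^bsub>C\<^esub> ((Mul G (On_ob F (x \<oplus>\<^bsub>A\<^esub> y), ?z) \<cdot>\<^bsub>C\<^esub> ?L) \<cdot>\<^bsub>C\<^esub> ?L')"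
    using assms by (simp add: G.B.Plus_Cmp_ar)
  also have "\<dots> = On_ar G (Mul F (x \<oplus>\<^bsub>A\<^esub> y, z) \<cdot>\<^bsub>B\<^esub> (Mul F (x, y) \<boxplus>\<^bsub>B\<^esub> \<one>\<^bsub>B\<^esub> ?z)) \<cdot>\<^bsub>C\<^esub>
      (Mul G (?x \<oplus>\<^bsub>B\<^esub> ?y, ?z) \<cdot>\<^bsub>C\<^esub> ?L')"
    unfolding l using assms by (simp add: G.On_Cmp_ar)
  also have "\<dots> = On_ar G (Mul F (x, y \<oplus>\<^bsub>A\<^esub> z) \<cdot>\<^bsub>B\<^esub> (\<one>\<^bsub>B\<^esub> ?x \<boxplus>\<^bsub>B\<^esub> Mul F (y, z))) \<cdot>\<^bsub>C\<^esub>
      (Mul G (?x, ?y \<oplus>\<^bsub>B\<^esub> ?z) \<cdot>\<^bsub>C\<^esub> ?R')"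
    using assms by (simp only: F.Mul_assoc G.Mul_assoc F.On_ob)
  also have "\<dots> = On_ar G (Mul F (x, y \<oplus>\<^bsub>A\<^esub> z)) \<cdot>\<^bsub>C\<^esub>
      ((Mul G (?x, On_ob F (y \<oplus>\<^bsub>A\<^esub> z)) \<cdot>\<^bsub>C\<^esub> ?R) \<cdot>\<^bsub>C\<^esub> ?R')"
    unfolding r using assms by (simp add: G.On_Cmp_ar)
  also have "\<dots> = Mul GF (x, y \<oplus>\<^bsub>A\<^esub> z) \<cdot>\<^bsub>C\<^esub> (\<one>\<^bsub>C\<^esub> (On_ob GF x) \<boxplus>\<^bsub>C\<^esub> Mul GF (y, z))"
    using assms by (simp add: G.B.Plus_Cmp_ar)
  finally show ?thesis .
qed

text \<open>The same separation with \<open>Unt F\<close> in place of \<open>Mul F\<close>; the unit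
  law of \<open>F\<close>, under \<open>G\<close>, and the unit law of \<open>G\<close>
  remain.\<close>

lemma comp_Mul_Unt_right:
  assumes x: "x \<in> Ob A"
  shows "Mul GF (x, \<zero>\<^bsub>A\<^esub>) \<cdot>\<^bsub>C\<^esub> (\<one>\<^bsub>C\<^esub> (On_ob GF x) \<boxplus>\<^bsub>C\<^esub> Unt GF) = \<one>\<^bsub>C\<^esub> (On_ob GF x)"
proof -
  let ?x = "On_ob F x" and ?m = "Mul F (x, \<zero>\<^bsub>A\<^esub>)"
  have r: "Mul G (?x, On_ob F \<zero>\<^bsub>A\<^esub>) \<cdot>\<^bsub>C\<^esub> (\<one>\<^bsub>C\<^esub> (On_ob G ?x) \<boxplus>\<^bsub>C\<^esub> On_ar G (Unt F)) =
      On_ar G (\<one>\<^bsub>B\<^esub> ?x \<boxplus>\<^bsub>B\<^esub> Unt F) \<cdot>\<^bsub>C\<^esub> Mul G (?x, \<zero>\<^bsub>B\<^esub>)"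
    using G.Mul_natural_ar[of "\<one>\<^bsub>B\<^esub> ?x" "Unt F"] assms by simp
  have "Mul GF (x, \<zero>\<^bsub>A\<^esub>) \<cdot>\<^bsub>C\<^esub> (\<one>\<^bsub>C\<^esub> (On_ob GF x) \<boxplus>\<^bsub>C\<^esub> Unt GF) =
      On_ar G ?m \<cdot>\<^bsub>C\<^esub> ((Mul G (?x, On_ob F \<zero>\<^bsub>A\<^esub>) \<cdot>\<^bsub>C\<^esub>
        (\<one>\<^bsub>C\<^esub> (On_ob G ?x) \<boxplus>\<^bsub>C\<^esub> On_ar G (Unt F))) \<cdot>\<^bsub>C\<^esub> (\<one>\<^bsub>C\<^esub> (On_ob G ?x) \<boxplus>\<^bsub>C\<^esub> Unt G))"
    using assms by (simp add: G.B.Plus_Cmp_ar)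
  also have "\<dots> = On_ar G (?m \<cdot>\<^bsub>B\<^esub> (\<one>\<^bsub>B\<^esub> ?x \<boxplus>\<^bsub>B\<^esub> Unt F)) \<cdot>\<^bsub>C\<^esub>
      (Mul G (?x, \<zero>\<^bsub>B\<^esub>) \<cdot>\<^bsub>C\<^esub> (\<one>\<^bsub>C\<^esub> (On_ob G ?x) \<boxplus>\<^bsub>C\<^esub> Unt G))"
    unfolding r using assms by (simp add: G.On_Cmp_ar)
  also have "\<dots> = \<one>\<^bsub>C\<^esub> (On_ob GF x)"
    using assms by (simp add: F.Mul_Unt_right G.Mul_Unt_right)
  finally show ?thesis .
qed

lemma comp_Mul_Unt_left:
  assumes x: "x \<in> Ob A"
  shows "Mul GF (\<zero>\<^bsub>A\<^esub>, x) \<cdot>\<^bsub>C\<^esub> (Unt GF \<boxplus>\<^bsub>C\<^esub> \<one>\<^bsub>C\<^esub> (On_ob GF x)) = \<one>\<^bsub>C\<^esub> (On_ob GF x)"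
proof -
  let ?x = "On_ob F x" and ?m = "Mul F (\<zero>\<^bsub>A\<^esub>, x)"
  have r: "Mul G (On_ob F \<zero>\<^bsub>A\<^esub>, ?x) \<cdot>\<^bsub>C\<^esub> (On_ar G (Unt F) \<boxplus>\<^bsub>C\<^esub> \<one>\<^bsub>C\<^esub> (On_ob G ?x)) =
      On_ar G (Unt F \<boxplus>\<^bsub>B\<^esub> \<one>\<^bsub>B\<^esub> ?x) \<cdot>\<^bsub>C\<^esub> Mul G (\<zero>\<^bsub>B\<^esub>, ?x)"
    using G.Mul_natural_ar[of "Unt F" "\<one>\<^bsub>B\<^esub> ?x"] assms by simp
  have "Mul GF (\<zero>\<^bsub>A\<^esub>, x) \<cdot>\<^bsub>C\<^esub> (Unt GF \<boxplus>\<^bsub>C\<^esub> \<one>\<^bsub>C\<^esub> (On_ob GF x)) =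
      On_ar G ?m \<cdot>\<^bsub>C\<^esub> ((Mul G (On_ob F \<zero>\<^bsub>A\<^esub>, ?x) \<cdot>\<^bsub>C\<^esub>
        (On_ar G (Unt F) \<boxplus>\<^bsub>C\<^esub> \<one>\<^bsub>C\<^esub> (On_ob G ?x))) \<cdot>\<^bsub>C\<^esub> (Unt G \<boxplus>\<^bsub>C\<^esub> \<one>\<^bsub>C\<^esub> (On_ob G ?x)))"
    using assms by (simp add: G.B.Plus_Cmp_ar)
  also have "\<dots> = On_ar G (?m \<cdot>\<^bsub>B\<^esub> (Unt F \<boxplus>\<^bsub>B\<^esub> \<one>\<^bsub>B\<^esub> ?x)) \<cdot>\<^bsub>C\<^esub>
      (Mul G (\<zero>\<^bsub>B\<^esub>, ?x) \<cdot>\<^bsub>C\<^esub> (Unt G \<boxplus>\<^bsub>C\<^esub> \<one>\<^bsub>C\<^esub> (On_ob G ?x)))"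
    unfolding r using assms by (simp add: G.On_Cmp_ar)
  also have "\<dots> = \<one>\<^bsub>C\<^esub> (On_ob GF x)"
    using assms by (simp add: F.Mul_Unt_left G.Mul_Unt_left)
  finally show ?thesis .
qed

text \<open>The law of \<open>F\<close>, under \<open>G\<close>, carries the symmetry of
  \<open>A\<close> to that of \<open>B\<close>; the law of \<open>G\<close> carries it on to
  \<open>C\<close>.\<close>

lemma comp_Mul_Symm:
  assumes x: "x \<in> Ob A" and y: "y \<in> Ob A"
  shows "On_ar GF (\<beta>\<^bsub>A\<^esub> x y) \<cdot>\<^bsub>C\<^esub> Mul GF (x, y) =
    Mul GF (y, x) \<cdot>\<^bsub>C\<^esub> \<beta>\<^bsub>C\<^esub> (On_ob GF x) (On_ob GF y)"
proof -
  let ?x = "On_ob F x" and ?y = "On_ob F y"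
  have "On_ar GF (\<beta>\<^bsub>A\<^esub> x y) \<cdot>\<^bsub>C\<^esub> Mul GF (x, y) =
      On_ar G (On_ar F (\<beta>\<^bsub>A\<^esub> x y) \<cdot>\<^bsub>B\<^esub> Mul F (x, y)) \<cdot>\<^bsub>C\<^esub> Mul G (?x, ?y)"
    using assms by (simp add: G.On_Cmp_ar)
  also have "\<dots> = On_ar G (Mul F (y, x)) \<cdot>\<^bsub>C\<^esub> (On_ar G (\<beta>\<^bsub>B\<^esub> ?x ?y) \<cdot>\<^bsub>C\<^esub> Mul G (?x, ?y))"
    using assms by (simp add: G.On_Cmp_ar F.Mul_Symm)
  also have "\<dots> = Mul GF (y, x) \<cdot>\<^bsub>C\<^esub> \<beta>\<^bsub>C\<^esub> (On_ob GF x) (On_ob GF y)"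
    using assms by (simp add: G.Mul_Symm)
  finally show ?thesis .
qed

lemma comp_Mul_iso:
  assumes "x \<in> Ob A" "y \<in> Ob A"
  shows "is_iso C (Mul GF (x, y))"
proof -
  have "inverse_pair B (Mul F (x, y)) (inv_ar B (Mul F (x, y)))"
    "inverse_pair C (Mul G (On_ob F x, On_ob F y)) (inv_ar C (Mul G (On_ob F x, On_ob F y)))"
    using assms by (simp_all add: F.Mul_iso G.Mul_iso F.B.inverse_pair_inv_ar G.B.inverse_pair_inv_ar)
  from G.B.inverse_pair_Cmp[OF this(2) G.inverse_pair_On_ar[OF this(1)]] show ?thesis
    using assms by (auto simp: is_iso_def)
qed

lemma comp_Unt_iso: "is_iso C (Unt GF)"
proof -
  have "inverse_pair B (Unt F) (inv_ar B (Unt F))" "inverse_pair C (Unt G) (inv_ar C (Unt G))"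
    by (simp_all add: F.Unt_iso G.Unt_iso F.B.inverse_pair_inv_ar G.B.inverse_pair_inv_ar)
  from G.B.inverse_pair_Cmp[OF this(2) G.inverse_pair_On_ar[OF this(1)]] show ?thesis
    by (auto simp: is_iso_def)
qed

sublocale GF: symmetric_monoidal_functor A C GF
proof (rule symmetric_monoidal_functorI)
  show "permutative_category A" "permutative_category C" ..
  show "\<And>f g. \<lbrakk>f \<in> Ar A; g \<in> Ar A\<rbrakk> \<Longrightarrow> On_ar GF (f \<boxplus>\<^bsub>A\<^esub> g) \<cdot>\<^bsub>C\<^esub> Mul GF (Dom A f, Dom A g) =
    Mul GF (Cod A f, Cod A g) \<cdot>\<^bsub>C\<^esub> (On_ar GF f \<boxplus>\<^bsub>C\<^esub> On_ar GF g)"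
    by (rule comp_Mul_natural)
\<comment> \<open>\<open>Mul GF\<close> and \<open>Unt GF\<close> stay folded at first, since the
  isomorphism lemmas are stated for them; typing goals need them unfolded.\<close>
qed ((rule comp_Mul_assoc comp_Mul_Unt_right comp_Mul_Unt_left comp_Mul_Symm; assumption)
  | simp add: F.On_Cmp_ar G.On_Cmp_ar comp_ext comp_Mul_iso comp_Unt_iso del: comp_sel(5,6) | simp)+

lemma comp_smfun: "symmetric_monoidal_functor A C GF" ..

end

lemmas symmetric_monoidal_functor_comp = smfun_pair.comp_smfun[OF smfun_pair.intro]

lemma smfun_eqI:
  assumes "symmetric_monoidal_functor A B F" "symmetric_monoidal_functor A B G"
    and "\<And>x. x \<in> Ob A \<Longrightarrow> On_ob F x = On_ob G x"
    and "\<And>f. f \<in> Ar A \<Longrightarrow> On_ar F f = On_ar G f"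
    and "\<And>x y. \<lbrakk>x \<in> Ob A; y \<in> Ob A\<rbrakk> \<Longrightarrow> Mul F (x, y) = Mul G (x, y)"
    and "Unt F = Unt G"
  shows "F = G"
proof -
  interpret F: symmetric_monoidal_functor A B F by fact
  interpret G: symmetric_monoidal_functor A B G by fact
  have "On_ob F = On_ob G" "On_ar F = On_ar G" "Mul F = Mul G"
    using assms(3-5) F.On_ob_ext G.On_ob_ext F.On_ar_ext G.On_ar_ext F.Mul_ext G.Mul_ext
    by (auto intro: extensionalityI)
  then show ?thesis using assms(6) F.Src G.Src F.Trg G.Trg by simp
qed

lemma smfun_idI:
  assumes "symmetric_monoidal_functor A A F"
    and "\<And>x. x \<in> Ob A \<Longrightarrow> On_ob F x = x"
    and "\<And>f. f \<in> Ar A \<Longrightarrow> On_ar F f = f"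
    and "\<And>x y. \<lbrakk>x \<in> Ob A; y \<in> Ob A\<rbrakk> \<Longrightarrow> Mul F (x, y) = \<one>\<^bsub>A\<^esub> (x \<oplus>\<^bsub>A\<^esub> y)"
    and "Unt F = \<one>\<^bsub>A\<^esub> \<zero>\<^bsub>A\<^esub>"
  shows "F = id_smfun A"
proof -
  interpret symmetric_monoidal_functor A A F by fact
  show ?thesis
    by (rule smfun_eqI[OF assms(1) symmetric_monoidal_functor_id])
      (use assms in \<open>auto simp: id_smfun_def A.permutative_category_axioms\<close>)
qed

section \<open>Monoidal transformations and their two compositions\<close>

context monoidal_transformation
begin

lemma Component_ar [simp]:
  assumes "x \<in> Ob A"
  shows "Component \<phi> x \<in> Ar B" "Dom B (Component \<phi> x) = On_ob F x" "Cod B (Component \<phi> x) = On_ob G x"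
  using Component_Hom[OF assms] by (auto simp: Hom_iff)

lemma Component_natural_ar:
  "f \<in> Ar A \<Longrightarrow> Component \<phi> (Cod A f) \<cdot>\<^bsub>B\<^esub> On_ar F f = On_ar G f \<cdot>\<^bsub>B\<^esub> Component \<phi> (Dom A f)"
  using Component_natural[of f "Dom A f" "Cod A f"] by (auto simp: Hom_iff)

end

lemma monoidal_transformationI:
  assumes "symmetric_monoidal_functor A B F" "symmetric_monoidal_functor A B G"
    and "Src_fun \<phi> = F" "Trg_fun \<phi> = G"
    and "Component \<phi> \<in> extensional (Ob A)"
    and "\<And>x. x \<in> Ob A \<Longrightarrow> Component \<phi> x \<in> Ar B"
      "\<And>x. x \<in> Ob A \<Longrightarrow> Dom B (Component \<phi> x) = On_ob F x"
      "\<And>x. x \<in> Ob A \<Longrightarrow> Cod B (Component \<phi> x) = On_ob G x"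
    and "\<And>f. f \<in> Ar A \<Longrightarrow>
        Component \<phi> (Cod A f) \<cdot>\<^bsub>B\<^esub> On_ar F f = On_ar G f \<cdot>\<^bsub>B\<^esub> Component \<phi> (Dom A f)"
    and "\<And>x y. \<lbrakk>x \<in> Ob A; y \<in> Ob A\<rbrakk> \<Longrightarrow>
        Component \<phi> (x \<oplus>\<^bsub>A\<^esub> y) \<cdot>\<^bsub>B\<^esub> Mul F (x, y) =
        Mul G (x, y) \<cdot>\<^bsub>B\<^esub> (Component \<phi> x \<boxplus>\<^bsub>B\<^esub> Component \<phi> y)"
    and "Component \<phi> \<zero>\<^bsub>A\<^esub> \<cdot>\<^bsub>B\<^esub> Unt F = Unt G"
  shows "monoidal_transformation A B F G \<phi>"
proof -
  interpret F: symmetric_monoidal_functor A B F by fact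
  interpret G: symmetric_monoidal_functor A B G by fact
  show ?thesis
  proof unfold_locales
    fix f x y assume "f \<in> Hom A x y"
    then show "Component \<phi> y \<cdot>\<^bsub>B\<^esub> On_ar F f = On_ar G f \<cdot>\<^bsub>B\<^esub> Component \<phi> x"
      using assms(9)[of f] by (auto simp: Hom_iff)
  qed (use assms in \<open>simp_all add: Hom_iff\<close>)
qed

lemma mtrans_eqI:
  assumes "monoidal_transformation A B F G \<phi>" "monoidal_transformation A B F G \<psi>"
    and "\<And>x. x \<in> Ob A \<Longrightarrow> Component \<phi> x = Component \<psi> x"
  shows "\<phi> = \<psi>"
proof -
  interpret \<phi>: monoidal_transformation A B F G \<phi> by fact
  interpret \<psi>: monoidal_transformation A B F G \<psi> by fact
  have "Component \<phi> = Component \<psi>"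
    using assms(3) \<phi>.Component_ext \<psi>.Component_ext by (auto intro: extensionalityI)
  then show ?thesis using \<phi>.Src_fun \<psi>.Src_fun \<phi>.Trg_fun \<psi>.Trg_fun by simp
qed

context symmetric_monoidal_functor
begin

lemma id_mtrans_sel [simp]:
  "Src_fun (id_mtrans F) = F" "Trg_fun (id_mtrans F) = F"
  "x \<in> Ob A \<Longrightarrow> Component (id_mtrans F) x = \<one>\<^bsub>B\<^esub> (On_ob F x)"
  by (simp_all add: id_mtrans_def Src Trg)

lemma id_mtrans: "monoidal_transformation A B F F (id_mtrans F)"
proof (rule monoidal_transformationI)
  show "symmetric_monoidal_functor A B F" "symmetric_monoidal_functor A B F" ..
  show "Component (id_mtrans F) \<in> extensional (Ob A)" by (simp add: id_mtrans_def Src)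
qed simp_all

end

locale mtrans_vpair =
  \<phi>: monoidal_transformation A B F G \<phi> + \<psi>: monoidal_transformation A B G H \<psi>
  for A :: "('o, 'm) permcat" and B :: "('p, 'n) permcat" and F G H \<phi> \<psi>
begin

lemma vcomp_sel [simp]:
  "Src_fun (vcomp_mtrans \<psi> \<phi>) = F" "Trg_fun (vcomp_mtrans \<psi> \<phi>) = H"
  "x \<in> Ob A \<Longrightarrow> Component (vcomp_mtrans \<psi> \<phi>) x = Component \<psi> x \<cdot>\<^bsub>B\<^esub> Component \<phi> x"
  by (simp_all add: vcomp_mtrans_def \<phi>.Src_fun \<psi>.Trg_fun \<phi>.F.Src \<phi>.F.Trg)

lemma vcomp_Component_natural:
  assumes f: "f \<in> Ar A"
  shows "(Component \<psi> (Cod A f) \<cdot>\<^bsub>B\<^esub> Component \<phi> (Cod A f)) \<cdot>\<^bsub>B\<^esub> On_ar F f =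
    On_ar H f \<cdot>\<^bsub>B\<^esub> (Component \<psi> (Dom A f) \<cdot>\<^bsub>B\<^esub> Component \<phi> (Dom A f))"
proof -
  have "(Component \<psi> (Cod A f) \<cdot>\<^bsub>B\<^esub> Component \<phi> (Cod A f)) \<cdot>\<^bsub>B\<^esub> On_ar F f =
      (Component \<psi> (Cod A f) \<cdot>\<^bsub>B\<^esub> On_ar G f) \<cdot>\<^bsub>B\<^esub> Component \<phi> (Dom A f)"
    using f by (simp add: \<phi>.Component_natural_ar)
  also have "\<dots> = On_ar H f \<cdot>\<^bsub>B\<^esub> (Component \<psi> (Dom A f) \<cdot>\<^bsub>B\<^esub> Component \<phi> (Dom A f))"
    unfolding \<psi>.Component_natural_ar[OF f] using f by simp
  finally show ?thesis .
qed

lemma vcomp_Component_Mul: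
  assumes "x \<in> Ob A" "y \<in> Ob A"
  shows "(Component \<psi> (x \<oplus>\<^bsub>A\<^esub> y) \<cdot>\<^bsub>B\<^esub> Component \<phi> (x \<oplus>\<^bsub>A\<^esub> y)) \<cdot>\<^bsub>B\<^esub> Mul F (x, y) =
    Mul H (x, y) \<cdot>\<^bsub>B\<^esub> ((Component \<psi> x \<cdot>\<^bsub>B\<^esub> Component \<phi> x) \<boxplus>\<^bsub>B\<^esub> (Component \<psi> y \<cdot>\<^bsub>B\<^esub> Component \<phi> y))"
proof -
  have "(Component \<psi> (x \<oplus>\<^bsub>A\<^esub> y) \<cdot>\<^bsub>B\<^esub> Component \<phi> (x \<oplus>\<^bsub>A\<^esub> y)) \<cdot>\<^bsub>B\<^esub> Mul F (x, y) =
      (Component \<psi> (x \<oplus>\<^bsub>A\<^esub> y) \<cdot>\<^bsub>B\<^esub> Mul G (x, y)) \<cdot>\<^bsub>B\<^esub> (Component \<phi> x \<boxplus>\<^bsub>B\<^esub> Component \<phi> y)"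
    using assms by (simp add: \<phi>.Component_Mul)
  also have "\<dots> = Mul H (x, y) \<cdot>\<^bsub>B\<^esub>
      ((Component \<psi> x \<boxplus>\<^bsub>B\<^esub> Component \<psi> y) \<cdot>\<^bsub>B\<^esub> (Component \<phi> x \<boxplus>\<^bsub>B\<^esub> Component \<phi> y))"
    unfolding \<psi>.Component_Mul[OF assms] using assms by simp
  finally show ?thesis using assms by (simp add: \<phi>.F.B.Plus_Cmp_ar)
qed

lemma vcomp_mtrans: "monoidal_transformation A B F H (vcomp_mtrans \<psi> \<phi>)"
proof (rule monoidal_transformationI)
  show "symmetric_monoidal_functor A B F" "symmetric_monoidal_functor A B H" ..
  show "Component (vcomp_mtrans \<psi> \<phi>) \<in> extensional (Ob A)"
    by (simp add: vcomp_mtrans_def \<phi>.Src_fun \<phi>.F.Src)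
\<comment> \<open>Associativity is switched off so that the left-nested composites of the prepared
  equations still match.\<close>
qed ((simp add: vcomp_Component_natural vcomp_Component_Mul \<phi>.Component_Unt \<psi>.Component_Unt
    del: \<phi>.F.B.Cmp_assoc_ar | simp add: \<phi>.Component_Unt \<psi>.Component_Unt)+)

end

locale mtrans_hpair =
  \<phi>: monoidal_transformation A B F F' \<phi> + \<psi>: monoidal_transformation B C G G' \<psi>
  for A :: "('o, 'm) permcat" and B :: "('p, 'n) permcat" and C :: "('q, 'k) permcat"
    and F F' G G' \<phi> \<psi>
begin

sublocale S: smfun_pair A B C F G ..
sublocale T: smfun_pair A B C F' G' ..

lemma hcomp_sel [simp]:
  "Src_fun (hcomp_mtrans \<psi> \<phi>) = comp_smfun G F" "Trg_fun (hcomp_mtrans \<psi> \<phi>) = comp_smfun G' F'"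
  "x \<in> Ob A \<Longrightarrow> Component (hcomp_mtrans \<psi> \<phi>) x =
    Component \<psi> (On_ob F' x) \<cdot>\<^bsub>C\<^esub> On_ar G (Component \<phi> x)"
  by (simp_all add: hcomp_mtrans_def \<phi>.Src_fun \<psi>.Src_fun \<phi>.Trg_fun \<psi>.Trg_fun \<phi>.F.Src \<psi>.F.Trg)

text \<open>\<open>G\<close> carries the square of \<phi> at \<open>f\<close> to \<open>C\<close>;
  beside it stands the square of \<psi> at the arrow \<open>On_ar F' f\<close>.\<close>

lemma hcomp_Component_natural:
  assumes f: "f \<in> Ar A"
  shows "(Component \<psi> (On_ob F' (Cod A f)) \<cdot>\<^bsub>C\<^esub> On_ar G (Component \<phi> (Cod A f))) \<cdot>\<^bsub>C\<^esub>
      On_ar G (On_ar F f) =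
    On_ar G' (On_ar F' f) \<cdot>\<^bsub>C\<^esub> (Component \<psi> (On_ob F' (Dom A f)) \<cdot>\<^bsub>C\<^esub> On_ar G (Component \<phi> (Dom A f)))"
proof -
  have "(Component \<psi> (On_ob F' (Cod A f)) \<cdot>\<^bsub>C\<^esub> On_ar G (Component \<phi> (Cod A f))) \<cdot>\<^bsub>C\<^esub>
      On_ar G (On_ar F f) =
      Component \<psi> (On_ob F' (Cod A f)) \<cdot>\<^bsub>C\<^esub> On_ar G (Component \<phi> (Cod A f) \<cdot>\<^bsub>B\<^esub> On_ar F f)"
    using f by (simp add: \<psi>.F.On_Cmp_ar)
  also have "\<dots> = (Component \<psi> (On_ob F' (Cod A f)) \<cdot>\<^bsub>C\<^esub> On_ar G (On_ar F' f)) \<cdot>\<^bsub>C\<^esub>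
      On_ar G (Component \<phi> (Dom A f))"
    unfolding \<phi>.Component_natural_ar[OF f] using f by (simp add: \<psi>.F.On_Cmp_ar)
  also have "\<dots> = On_ar G' (On_ar F' f) \<cdot>\<^bsub>C\<^esub>
      (Component \<psi> (On_ob F' (Dom A f)) \<cdot>\<^bsub>C\<^esub> On_ar G (Component \<phi> (Dom A f)))"
    using \<psi>.Component_natural_ar[of "On_ar F' f"] f by simp
  finally show ?thesis .
qed

text \<open>Naturality of \<psi> at \<open>Mul F'\<close> and of \<open>Mul G\<close> at the
  components of \<phi> sort the composite, so that monoidality of \<phi>, under \<open>G\<close>,
  and monoidality of \<psi> apply separately.\<close>

lemma hcomp_Component_Mul:
  assumes [simp]: "x \<in> Ob A" "y \<in> Ob A"
  shows "(Component \<psi> (On_ob F' (x \<oplus>\<^bsub>A\<^esub> y)) \<cdot>\<^bsub>C\<^esub> On_ar G (Component \<phi> (x \<oplus>\<^bsub>A\<^esub> y))) \<cdot>\<^bsub>C\<^esub>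
      (On_ar G (Mul F (x, y)) \<cdot>\<^bsub>C\<^esub> Mul G (On_ob F x, On_ob F y)) =
    (On_ar G' (Mul F' (x, y)) \<cdot>\<^bsub>C\<^esub> Mul G' (On_ob F' x, On_ob F' y)) \<cdot>\<^bsub>C\<^esub>
      ((Component \<psi> (On_ob F' x) \<cdot>\<^bsub>C\<^esub> On_ar G (Component \<phi> x)) \<boxplus>\<^bsub>C\<^esub>
       (Component \<psi> (On_ob F' y) \<cdot>\<^bsub>C\<^esub> On_ar G (Component \<phi> y)))"
proof -
  let ?m = "Mul G (On_ob F x, On_ob F y)" and ?n = "Mul G (On_ob F' x, On_ob F' y)"
    and ?G = "\<lambda>x. On_ar G (Component \<phi> x)" and ?\<psi> = "\<lambda>x. Component \<psi> (On_ob F' x)"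
  have "(?\<psi> (x \<oplus>\<^bsub>A\<^esub> y) \<cdot>\<^bsub>C\<^esub> ?G (x \<oplus>\<^bsub>A\<^esub> y)) \<cdot>\<^bsub>C\<^esub> (On_ar G (Mul F (x, y)) \<cdot>\<^bsub>C\<^esub> ?m) =
      ?\<psi> (x \<oplus>\<^bsub>A\<^esub> y) \<cdot>\<^bsub>C\<^esub> (On_ar G (Component \<phi> (x \<oplus>\<^bsub>A\<^esub> y) \<cdot>\<^bsub>B\<^esub> Mul F (x, y)) \<cdot>\<^bsub>C\<^esub> ?m)"
    by (simp add: \<psi>.F.On_Cmp_ar)
  also have "\<dots> = (?\<psi> (x \<oplus>\<^bsub>A\<^esub> y) \<cdot>\<^bsub>C\<^esub> On_ar G (Mul F' (x, y))) \<cdot>\<^bsub>C\<^esub>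
      (On_ar G (Component \<phi> x \<boxplus>\<^bsub>B\<^esub> Component \<phi> y) \<cdot>\<^bsub>C\<^esub> ?m)"
    unfolding \<phi>.Component_Mul[OF assms] by (simp add: \<psi>.F.On_Cmp_ar)
  also have "\<dots> = On_ar G' (Mul F' (x, y)) \<cdot>\<^bsub>C\<^esub>
      ((Component \<psi> (On_ob F' x \<oplus>\<^bsub>B\<^esub> On_ob F' y) \<cdot>\<^bsub>C\<^esub> ?n) \<cdot>\<^bsub>C\<^esub> (?G x \<boxplus>\<^bsub>C\<^esub> ?G y))"
    using \<psi>.Component_natural_ar[of "Mul F' (x, y)"]
      \<psi>.F.Mul_natural_ar[of "Component \<phi> x" "Component \<phi> y"] by simp
  also have "\<dots> = On_ar G' (Mul F' (x, y)) \<cdot>\<^bsub>C\<^esub>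
      ((Mul G' (On_ob F' x, On_ob F' y) \<cdot>\<^bsub>C\<^esub> (?\<psi> x \<boxplus>\<^bsub>C\<^esub> ?\<psi> y)) \<cdot>\<^bsub>C\<^esub> (?G x \<boxplus>\<^bsub>C\<^esub> ?G y))"
    by (simp only: \<psi>.Component_Mul \<phi>.G.On_simps(1) assms)
  also have "\<dots> = (On_ar G' (Mul F' (x, y)) \<cdot>\<^bsub>C\<^esub> Mul G' (On_ob F' x, On_ob F' y)) \<cdot>\<^bsub>C\<^esub>
      ((?\<psi> x \<cdot>\<^bsub>C\<^esub> ?G x) \<boxplus>\<^bsub>C\<^esub> (?\<psi> y \<cdot>\<^bsub>C\<^esub> ?G y))"
    by (simp add: \<psi>.F.B.Plus_Cmp_ar)
  finally show ?thesis .
qed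

lemma hcomp_Component_Unt:
  "(Component \<psi> (On_ob F' \<zero>\<^bsub>A\<^esub>) \<cdot>\<^bsub>C\<^esub> On_ar G (Component \<phi> \<zero>\<^bsub>A\<^esub>)) \<cdot>\<^bsub>C\<^esub> (On_ar G (Unt F) \<cdot>\<^bsub>C\<^esub> Unt G) =
    On_ar G' (Unt F') \<cdot>\<^bsub>C\<^esub> Unt G'"
proof -
  have "(Component \<psi> (On_ob F' \<zero>\<^bsub>A\<^esub>) \<cdot>\<^bsub>C\<^esub> On_ar G (Component \<phi> \<zero>\<^bsub>A\<^esub>)) \<cdot>\<^bsub>C\<^esub> (On_ar G (Unt F) \<cdot>\<^bsub>C\<^esub> Unt G) =
      Component \<psi> (On_ob F' \<zero>\<^bsub>A\<^esub>) \<cdot>\<^bsub>C\<^esub> (On_ar G (Component \<phi> \<zero>\<^bsub>A\<^esub> \<cdot>\<^bsub>B\<^esub> Unt F) \<cdot>\<^bsub>C\<^esub> Unt G)"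
    by (simp add: \<psi>.F.On_Cmp_ar)
  also have "\<dots> = (Component \<psi> (On_ob F' \<zero>\<^bsub>A\<^esub>) \<cdot>\<^bsub>C\<^esub> On_ar G (Unt F')) \<cdot>\<^bsub>C\<^esub> Unt G"
    unfolding \<phi>.Component_Unt by simp
  also have "\<dots> = On_ar G' (Unt F') \<cdot>\<^bsub>C\<^esub> (Component \<psi> \<zero>\<^bsub>B\<^esub> \<cdot>\<^bsub>C\<^esub> Unt G)"
    using \<psi>.Component_natural_ar[of "Unt F'"] by simp
  finally show ?thesis unfolding \<psi>.Component_Unt .
qed

lemma hcomp_mtrans:
  "monoidal_transformation A C (comp_smfun G F) (comp_smfun G' F') (hcomp_mtrans \<psi> \<phi>)"
proof (rule monoidal_transformationI)
  show "symmetric_monoidal_functor A C (comp_smfun G F)"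
    "symmetric_monoidal_functor A C (comp_smfun G' F')" ..
  show "Component (hcomp_mtrans \<psi> \<phi>) \<in> extensional (Ob A)"
    by (simp add: hcomp_mtrans_def \<phi>.Src_fun \<phi>.F.Src)
qed ((simp add: hcomp_Component_natural hcomp_Component_Mul hcomp_Component_Unt
    del: \<psi>.F.B.Cmp_assoc_ar; fail) | simp)+

end

section \<open>The 2-category laws of \<open>PermCat\<close>\<close>

lemma PermCat_sel [simp]:
  "Cell0 PermCat = {A. permutative_category A}"
  "F \<in> Cell1 PermCat \<longleftrightarrow> symmetric_monoidal_functor (Src F) (Trg F) F"
  "\<phi> \<in> Cell2 PermCat \<longleftrightarrow> monoidal_transformation (Src (Src_fun \<phi>)) (Trg (Src_fun \<phi>))
     (Src_fun \<phi>) (Trg_fun \<phi>) \<phi>"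
  "Src1 PermCat = Src" "Trg1 PermCat = Trg" "Src2 PermCat = Src_fun" "Trg2 PermCat = Trg_fun"
  "Id1 PermCat = id_smfun" "Comp1 PermCat = comp_smfun" "Id2 PermCat = id_mtrans"
  "VComp PermCat = vcomp_mtrans" "HComp PermCat = hcomp_mtrans"
  by (simp_all add: PermCat_def)

text \<open>Cells of \<open>PermCat\<close> are bare records, so the categories and functors of a
  2-cell are read off from its own fields; these agree with the locale parameters.\<close>

lemma mtrans_Src_Trg:
  assumes "monoidal_transformation A B F G \<phi>"
  shows "monoidal_transformation (Src (Src_fun \<phi>)) (Trg (Src_fun \<phi>)) (Src_fun \<phi>) (Trg_fun \<phi>) \<phi>"
proof -
  interpret monoidal_transformation A B F G \<phi> by fact
  show ?thesis
    using assms by (simp add: Src_fun Trg_fun F.Src F.Trg)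
qed

lemma id_smfun_sel [simp]:
  "Src (id_smfun A) = A" "Trg (id_smfun A) = A"
  "x \<in> Ob A \<Longrightarrow> On_ob (id_smfun A) x = x" "f \<in> Ar A \<Longrightarrow> On_ar (id_smfun A) f = f"
  "\<lbrakk>x \<in> Ob A; y \<in> Ob A\<rbrakk> \<Longrightarrow> Mul (id_smfun A) (x, y) = \<one>\<^bsub>A\<^esub> (x \<oplus>\<^bsub>A\<^esub> y)"
  "Unt (id_smfun A) = \<one>\<^bsub>A\<^esub> \<zero>\<^bsub>A\<^esub>"
  by (simp_all add: id_smfun_def)

lemma comp_id_right:
  assumes "symmetric_monoidal_functor A B F"
  shows "comp_smfun F (id_smfun A) = F"
proof -
  interpret F: symmetric_monoidal_functor A B F by fact
  interpret I: symmetric_monoidal_functor A A "id_smfun A"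
    by (rule symmetric_monoidal_functor_id) unfold_locales
  interpret smfun_pair A A B "id_smfun A" F ..
  show ?thesis
    by (rule smfun_eqI[OF comp_smfun assms]) auto
qed

lemma comp_id_left:
  assumes "symmetric_monoidal_functor A B F"
  shows "comp_smfun (id_smfun B) F = F"
proof -
  interpret F: symmetric_monoidal_functor A B F by fact
  interpret I: symmetric_monoidal_functor B B "id_smfun B"
    by (rule symmetric_monoidal_functor_id) unfold_locales
  interpret smfun_pair A B B F "id_smfun B" ..
  show ?thesis
    by (rule smfun_eqI[OF comp_smfun assms]) auto
qed

locale smfun_triple =
  FG: smfun_pair A B C F G + GH: smfun_pair B C D G H
  for A :: "('o, 'm) permcat" and B :: "('p, 'n) permcat" and C :: "('q, 'k) permcat"
    and D :: "('r, 'l) permcat" and F G H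
begin

sublocale L: smfun_pair A B D F "comp_smfun H G" ..
sublocale R: smfun_pair A C D "comp_smfun G F" H ..

text \<open>Only the constraints carry content: expanding both bracketings of \<open>Mul\<close> and
  \<open>Unt\<close> gives the same composite by functoriality of \<open>H\<close>.\<close>

lemma comp_assoc: "comp_smfun (comp_smfun H G) F = comp_smfun H (comp_smfun G F)"
  by (rule smfun_eqI[OF L.comp_smfun R.comp_smfun]) (auto simp: GH.G.On_Cmp_ar)

end

lemma comp_smfun_Src_Trg [simp]: "Src (comp_smfun G F) = Src F" "Trg (comp_smfun G F) = Trg G"
  by (simp_all add: comp_smfun_def)

lemma mtrans_cell_parallel:
  assumes "monoidal_transformation A B F G \<phi>"
  shows "Src F = A" "Trg F = B" "Src G = A" "Trg G = B" "Src_fun \<phi> = F" "Trg_fun \<phi> = G"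
proof -
  interpret monoidal_transformation A B F G \<phi> by fact
  show "Src F = A" "Trg F = B" "Src G = A" "Trg G = B" "Src_fun \<phi> = F" "Trg_fun \<phi> = G"
    by (simp_all add: Src_fun Trg_fun F.Src F.Trg G.Src G.Trg)
qed

lemma mtrans_cell_functors:
  assumes "monoidal_transformation A B F G \<phi>"
  shows "symmetric_monoidal_functor A B F" "symmetric_monoidal_functor A B G"
  using assms by (simp_all add: monoidal_transformation_def)

lemma mtrans_cellE:
  assumes "\<phi> \<in> Cell2 PermCat"
  obtains A B F G where "monoidal_transformation A B F G \<phi>" "Src F = A" "Trg F = B"
    "Src G = A" "Trg G = B" "Src_fun \<phi> = F" "Trg_fun \<phi> = G"
proof -
  have "monoidal_transformation (Src (Src_fun \<phi>)) (Trg (Src_fun \<phi>)) (Src_fun \<phi>) (Trg_fun \<phi>) \<phi>"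
    using assms by simp
  with mtrans_cell_parallel[OF this] show thesis by (intro that) auto
qed

lemma vcomp_id:
  assumes "monoidal_transformation A B F G \<phi>"
  shows "vcomp_mtrans \<phi> (id_mtrans F) = \<phi>" "vcomp_mtrans (id_mtrans G) \<phi> = \<phi>"
proof -
  interpret monoidal_transformation A B F G \<phi> by fact
  interpret R: mtrans_vpair A B F F G "id_mtrans F" \<phi>
    by (intro mtrans_vpair.intro F.id_mtrans assms)
  interpret L: mtrans_vpair A B F G G \<phi> "id_mtrans G"
    by (intro mtrans_vpair.intro G.id_mtrans assms)
  show "vcomp_mtrans \<phi> (id_mtrans F) = \<phi>"
    by (rule mtrans_eqI[OF R.vcomp_mtrans assms]) simp
  show "vcomp_mtrans (id_mtrans G) \<phi> = \<phi>"
    by (rule mtrans_eqI[OF L.vcomp_mtrans assms]) simp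
qed

lemma vcomp_assoc:
  assumes "monoidal_transformation A B F G \<phi>" "monoidal_transformation A B G H \<psi>"
    "monoidal_transformation A B H K \<chi>"
  shows "vcomp_mtrans (vcomp_mtrans \<chi> \<psi>) \<phi> = vcomp_mtrans \<chi> (vcomp_mtrans \<psi> \<phi>)"
proof -
  interpret a: mtrans_vpair A B F G H \<phi> \<psi> by (intro mtrans_vpair.intro assms)
  interpret b: mtrans_vpair A B G H K \<psi> \<chi> by (intro mtrans_vpair.intro assms)
  interpret l: mtrans_vpair A B F G K \<phi> "vcomp_mtrans \<chi> \<psi>"
    by (intro mtrans_vpair.intro assms b.vcomp_mtrans)
  interpret r: mtrans_vpair A B F H K "vcomp_mtrans \<psi> \<phi>" \<chi>
    by (intro mtrans_vpair.intro assms a.vcomp_mtrans)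
  show ?thesis
    by (rule mtrans_eqI[OF l.vcomp_mtrans r.vcomp_mtrans]) simp
qed

text \<open>A horizontal composite runs between composite functors, so the two sides are parallel
  only after \<open>comp_id_right\<close> and \<open>comp_id_left\<close> identify these with
  \<open>F\<close> and \<open>G\<close>.\<close>

lemma hcomp_id:
  assumes "monoidal_transformation A B F G \<phi>"
  shows "hcomp_mtrans \<phi> (id_mtrans (id_smfun A)) = \<phi>" "hcomp_mtrans (id_mtrans (id_smfun B)) \<phi> = \<phi>"
proof -
  interpret monoidal_transformation A B F G \<phi> by fact
  interpret IA: symmetric_monoidal_functor A A "id_smfun A"
    by (rule symmetric_monoidal_functor_id) unfold_locales
  interpret IB: symmetric_monoidal_functor B B "id_smfun B"
    by (rule symmetric_monoidal_functor_id) unfold_locales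
  interpret R: mtrans_hpair A A B "id_smfun A" "id_smfun A" F G "id_mtrans (id_smfun A)" \<phi>
    by (intro mtrans_hpair.intro IA.id_mtrans assms)
  interpret L: mtrans_hpair A B B F G "id_smfun B" "id_smfun B" \<phi> "id_mtrans (id_smfun B)"
    by (intro mtrans_hpair.intro IB.id_mtrans assms)
  show "hcomp_mtrans \<phi> (id_mtrans (id_smfun A)) = \<phi>"
    using R.hcomp_mtrans
    by (intro mtrans_eqI[OF _ assms]) (auto simp: comp_id_right[OF F.symmetric_monoidal_functor_axioms]
      comp_id_right[OF G.symmetric_monoidal_functor_axioms])
  show "hcomp_mtrans (id_mtrans (id_smfun B)) \<phi> = \<phi>"
    using L.hcomp_mtrans
    by (intro mtrans_eqI[OF _ assms]) (auto simp: comp_id_left[OF F.symmetric_monoidal_functor_axioms]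
      comp_id_left[OF G.symmetric_monoidal_functor_axioms])
qed

text \<open>The two sides are parallel by associativity for 1-cells, taken from
  \<open>smfun_triple\<close>; on components, functoriality of \<open>H\<close> finishes.\<close>

lemma hcomp_assoc:
  assumes "monoidal_transformation A B F F' \<phi>" "monoidal_transformation B C G G' \<psi>"
    "monoidal_transformation C D H H' \<chi>"
  shows "hcomp_mtrans (hcomp_mtrans \<chi> \<psi>) \<phi> = hcomp_mtrans \<chi> (hcomp_mtrans \<psi> \<phi>)"
proof -
  interpret a: mtrans_hpair A B C F F' G G' \<phi> \<psi> by (intro mtrans_hpair.intro assms)
  interpret b: mtrans_hpair B C D G G' H H' \<psi> \<chi> by (intro mtrans_hpair.intro assms)
  interpret l: mtrans_hpair A B D F F' "comp_smfun H G" "comp_smfun H' G'" \<phi> "hcomp_mtrans \<chi> \<psi>"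
    by (intro mtrans_hpair.intro assms b.hcomp_mtrans)
  interpret r: mtrans_hpair A C D "comp_smfun G F" "comp_smfun G' F'" H H' "hcomp_mtrans \<psi> \<phi>" \<chi>
    by (intro mtrans_hpair.intro assms a.hcomp_mtrans)
  interpret s: smfun_triple A B C D F G H ..
  interpret t: smfun_triple A B C D F' G' H' ..
  show ?thesis
    using l.hcomp_mtrans
    by (intro mtrans_eqI[OF _ r.hcomp_mtrans]) (auto simp: s.comp_assoc t.comp_assoc b.\<psi>.F.On_Cmp_ar)
qed

lemma hcomp_id_mtrans:
  assumes "symmetric_monoidal_functor A B F" "symmetric_monoidal_functor B C G"
  shows "hcomp_mtrans (id_mtrans G) (id_mtrans F) = id_mtrans (comp_smfun G F)"
proof -
  interpret smfun_pair A B C F G by (intro smfun_pair.intro assms)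
  interpret h: mtrans_hpair A B C F F G G "id_mtrans F" "id_mtrans G"
    by (intro mtrans_hpair.intro F.id_mtrans G.id_mtrans)
  show ?thesis
    by (intro mtrans_eqI[OF h.hcomp_mtrans GF.id_mtrans]) simp
qed

lemma hcomp_vcomp:
  assumes "monoidal_transformation A B F F' \<phi>" "monoidal_transformation A B F' F'' \<phi>'"
    "monoidal_transformation B C G G' \<psi>" "monoidal_transformation B C G' G'' \<psi>'"
  shows "hcomp_mtrans (vcomp_mtrans \<psi>' \<psi>) (vcomp_mtrans \<phi>' \<phi>) =
    vcomp_mtrans (hcomp_mtrans \<psi>' \<phi>') (hcomp_mtrans \<psi> \<phi>)"
proof -
  interpret v: mtrans_vpair A B F F' F'' \<phi> \<phi>' by (intro mtrans_vpair.intro assms)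
  interpret w: mtrans_vpair B C G G' G'' \<psi> \<psi>' by (intro mtrans_vpair.intro assms)
  interpret h: mtrans_hpair A B C F F' G G' \<phi> \<psi> by (intro mtrans_hpair.intro assms)
  interpret h': mtrans_hpair A B C F' F'' G' G'' \<phi>' \<psi>' by (intro mtrans_hpair.intro assms)
  interpret l: mtrans_hpair A B C F F'' G G'' "vcomp_mtrans \<phi>' \<phi>" "vcomp_mtrans \<psi>' \<psi>"
    by (intro mtrans_hpair.intro v.vcomp_mtrans w.vcomp_mtrans)
  interpret r: mtrans_vpair A C "comp_smfun G F" "comp_smfun G' F'" "comp_smfun G'' F''"
    "hcomp_mtrans \<psi> \<phi>" "hcomp_mtrans \<psi>' \<phi>'"
    by (intro mtrans_vpair.intro h.hcomp_mtrans h'.hcomp_mtrans)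
  show ?thesis
  proof (rule mtrans_eqI[OF l.hcomp_mtrans r.vcomp_mtrans])
    fix x assume [simp]: "x \<in> Ob A"
    let ?x' = "On_ob F' x" and ?x'' = "On_ob F'' x"
    let ?a = "On_ar G (Component \<phi> x)" and ?b = "On_ar G (Component \<phi>' x)"
    have "Component (hcomp_mtrans (vcomp_mtrans \<psi>' \<psi>) (vcomp_mtrans \<phi>' \<phi>)) x =
        Component \<psi>' ?x'' \<cdot>\<^bsub>C\<^esub> ((Component \<psi> ?x'' \<cdot>\<^bsub>C\<^esub> ?b) \<cdot>\<^bsub>C\<^esub> ?a)"
      by (simp add: w.\<phi>.F.On_Cmp_ar)
    \<comment> \<open>The one step beyond functoriality of \<open>G\<close> and associativity:
      \<psi> is natural at the component of \<open>\<phi>'\<close>.\<close>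
    also have "Component \<psi> ?x'' \<cdot>\<^bsub>C\<^esub> ?b = On_ar G' (Component \<phi>' x) \<cdot>\<^bsub>C\<^esub> Component \<psi> ?x'"
      using w.\<phi>.Component_natural_ar[of "Component \<phi>' x"] by simp
    finally show "Component (hcomp_mtrans (vcomp_mtrans \<psi>' \<psi>) (vcomp_mtrans \<phi>' \<phi>)) x =
        Component (vcomp_mtrans (hcomp_mtrans \<psi>' \<phi>') (hcomp_mtrans \<psi> \<phi>)) x"
      by simp
  qed
qed

text \<open>The laws are grouped by the cells over which they quantify. The type parameters stay
  free because the tensor product relates instances of \<open>PermCat\<close> at different
  types.\<close>

lemma two_category_PermCat: "two_category PermCat"
proof
  fix \<phi> :: "('a, 'b, 'a, 'b) mtrans"
  assume "\<phi> \<in> Cell2 PermCat"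
  then obtain A B F G where c: "monoidal_transformation A B F G \<phi>" "Src F = A" "Trg F = B"
    "Src G = A" "Trg G = B" "Src_fun \<phi> = F" "Trg_fun \<phi> = G"
    by (rule mtrans_cellE)
  note f = mtrans_cell_functors[OF c(1)]
  show "Src2 PermCat \<phi> \<in> Cell1 PermCat" "Trg2 PermCat \<phi> \<in> Cell1 PermCat"
    "Src1 PermCat (Src2 PermCat \<phi>) = Src1 PermCat (Trg2 PermCat \<phi>)"
    "Trg1 PermCat (Src2 PermCat \<phi>) = Trg1 PermCat (Trg2 PermCat \<phi>)"
    "VComp PermCat \<phi> (Id2 PermCat (Src2 PermCat \<phi>)) = \<phi>"
    "VComp PermCat (Id2 PermCat (Trg2 PermCat \<phi>)) \<phi> = \<phi>"
    "HComp PermCat \<phi> (Id2 PermCat (Id1 PermCat (Src1 PermCat (Src2 PermCat \<phi>)))) = \<phi>"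
    "HComp PermCat (Id2 PermCat (Id1 PermCat (Trg1 PermCat (Src2 PermCat \<phi>)))) \<phi> = \<phi>"
    using f c(2-) vcomp_id[OF c(1)] hcomp_id[OF c(1)] by simp_all
next
  fix \<phi> \<psi> :: "('a, 'b, 'a, 'b) mtrans"
  assume p: "\<phi> \<in> Cell2 PermCat" "\<psi> \<in> Cell2 PermCat" "Src2 PermCat \<psi> = Trg2 PermCat \<phi>"
  from p(1) obtain A B F G where c: "monoidal_transformation A B F G \<phi>" "Src F = A" "Trg F = B"
    "Src G = A" "Trg G = B" "Src_fun \<phi> = F" "Trg_fun \<phi> = G"
    by (rule mtrans_cellE)
  with p have "monoidal_transformation A B G (Trg_fun \<psi>) \<psi>" by simp
  then interpret mtrans_vpair A B F G "Trg_fun \<psi>" \<phi> \<psi> by (intro mtrans_vpair.intro c)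
  show "VComp PermCat \<psi> \<phi> \<in> Cell2 PermCat \<and> Src2 PermCat (VComp PermCat \<psi> \<phi>) = Src2 PermCat \<phi>
      \<and> Trg2 PermCat (VComp PermCat \<psi> \<phi>) = Trg2 PermCat \<psi>"
    using vcomp_mtrans c by (simp add: mtrans_Src_Trg)
next
  fix \<phi> \<psi> \<chi> :: "('a, 'b, 'a, 'b) mtrans"
  assume p: "\<phi> \<in> Cell2 PermCat" "\<psi> \<in> Cell2 PermCat" "\<chi> \<in> Cell2 PermCat"
    "Src2 PermCat \<psi> = Trg2 PermCat \<phi>" "Src2 PermCat \<chi> = Trg2 PermCat \<psi>"
  from p(1) obtain A B F G where c: "monoidal_transformation A B F G \<phi>" "Src F = A" "Trg F = B"
    "Src G = A" "Trg G = B" "Src_fun \<phi> = F" "Trg_fun \<phi> = G"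
    by (rule mtrans_cellE)
  with p have d: "monoidal_transformation A B G (Trg_fun \<psi>) \<psi>" by simp
  with p mtrans_cell_parallel[OF d] have e: "monoidal_transformation A B (Trg_fun \<psi>) (Trg_fun \<chi>) \<chi>"
    by simp
  show "VComp PermCat (VComp PermCat \<chi> \<psi>) \<phi> = VComp PermCat \<chi> (VComp PermCat \<psi> \<phi>)"
    using vcomp_assoc[OF c(1) d e] by simp
next
  fix \<phi> \<psi> :: "('a, 'b, 'a, 'b) mtrans"
  assume p: "\<phi> \<in> Cell2 PermCat" "\<psi> \<in> Cell2 PermCat"
    "Src1 PermCat (Src2 PermCat \<psi>) = Trg1 PermCat (Src2 PermCat \<phi>)"
  from p(1) obtain A B F G where c: "monoidal_transformation A B F G \<phi>" "Src F = A" "Trg F = B"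
    "Src G = A" "Trg G = B" "Src_fun \<phi> = F" "Trg_fun \<phi> = G"
    by (rule mtrans_cellE)
  with p have "monoidal_transformation B (Trg (Src_fun \<psi>)) (Src_fun \<psi>) (Trg_fun \<psi>) \<psi>" by simp
  then interpret mtrans_hpair A B "Trg (Src_fun \<psi>)" F G "Src_fun \<psi>" "Trg_fun \<psi>" \<phi> \<psi>
    by (intro mtrans_hpair.intro c)
  show "HComp PermCat \<psi> \<phi> \<in> Cell2 PermCat
      \<and> Src2 PermCat (HComp PermCat \<psi> \<phi>) = Comp1 PermCat (Src2 PermCat \<psi>) (Src2 PermCat \<phi>)
      \<and> Trg2 PermCat (HComp PermCat \<psi> \<phi>) = Comp1 PermCat (Trg2 PermCat \<psi>) (Trg2 PermCat \<phi>)"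
    using mtrans_Src_Trg[OF hcomp_mtrans] c by simp
next
  fix \<phi> \<psi> \<chi> :: "('a, 'b, 'a, 'b) mtrans"
  assume p: "\<phi> \<in> Cell2 PermCat" "\<psi> \<in> Cell2 PermCat" "\<chi> \<in> Cell2 PermCat"
    "Src1 PermCat (Src2 PermCat \<psi>) = Trg1 PermCat (Src2 PermCat \<phi>)"
    "Src1 PermCat (Src2 PermCat \<chi>) = Trg1 PermCat (Src2 PermCat \<psi>)"
  then show "HComp PermCat (HComp PermCat \<chi> \<psi>) \<phi> = HComp PermCat \<chi> (HComp PermCat \<psi> \<phi>)"
    using hcomp_assoc[of "Src (Src_fun \<phi>)" "Trg (Src_fun \<phi>)" "Src_fun \<phi>" "Trg_fun \<phi>" \<phi>
      "Trg (Src_fun \<psi>)" "Src_fun \<psi>" "Trg_fun \<psi>" \<psi> "Trg (Src_fun \<chi>)" "Src_fun \<chi>" "Trg_fun \<chi>" \<chi>]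
    by simp
next
  fix \<phi> \<phi>' \<psi> \<psi>' :: "('a, 'b, 'a, 'b) mtrans"
  assume p: "\<phi> \<in> Cell2 PermCat" "\<phi>' \<in> Cell2 PermCat" "\<psi> \<in> Cell2 PermCat" "\<psi>' \<in> Cell2 PermCat"
    "Src2 PermCat \<phi>' = Trg2 PermCat \<phi>" "Src2 PermCat \<psi>' = Trg2 PermCat \<psi>"
    "Src1 PermCat (Src2 PermCat \<psi>) = Trg1 PermCat (Src2 PermCat \<phi>)"
  from p(1) obtain A B F G where c: "monoidal_transformation A B F G \<phi>" "Src F = A" "Trg F = B"
    "Src G = A" "Trg G = B" "Src_fun \<phi> = F" "Trg_fun \<phi> = G"
    by (rule mtrans_cellE)
  from p(3) obtain A' B' F' G' where c': "monoidal_transformation A' B' F' G' \<psi>" "Src F' = A'"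
    "Trg F' = B'" "Src G' = A'" "Trg G' = B'" "Src_fun \<psi> = F'" "Trg_fun \<psi> = G'"
    by (rule mtrans_cellE)
  have "monoidal_transformation A B G (Trg_fun \<phi>') \<phi>'" "monoidal_transformation A' B' G' (Trg_fun \<psi>') \<psi>'"
    using p c c' by auto
  moreover have "A' = B" using p c c' by simp
  ultimately show "HComp PermCat (VComp PermCat \<psi>' \<psi>) (VComp PermCat \<phi>' \<phi>) =
      VComp PermCat (HComp PermCat \<psi>' \<phi>') (HComp PermCat \<psi> \<phi>)"
    using hcomp_vcomp[OF c(1) _ _] c' by simp
next
  fix F :: "('a, 'b, 'a, 'b) smfun"
  assume "F \<in> Cell1 PermCat"
  then have f: "symmetric_monoidal_functor (Src F) (Trg F) F" by simp
  then interpret symmetric_monoidal_functor "Src F" "Trg F" F .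
  show "Src1 PermCat F \<in> Cell0 PermCat" "Trg1 PermCat F \<in> Cell0 PermCat"
    by (simp_all add: A.permutative_category_axioms B.permutative_category_axioms)
  show "Comp1 PermCat F (Id1 PermCat (Src1 PermCat F)) = F"
    "Comp1 PermCat (Id1 PermCat (Trg1 PermCat F)) F = F"
    using comp_id_left[OF f] comp_id_right[OF f] by simp_all
  show "Id2 PermCat F \<in> Cell2 PermCat \<and> Src2 PermCat (Id2 PermCat F) = F
      \<and> Trg2 PermCat (Id2 PermCat F) = F"
    using id_mtrans by simp
next
  fix F G :: "('a, 'b, 'a, 'b) smfun"
  assume p: "F \<in> Cell1 PermCat" "G \<in> Cell1 PermCat" "Src1 PermCat G = Trg1 PermCat F"
  then show "HComp PermCat (Id2 PermCat G) (Id2 PermCat F) = Id2 PermCat (Comp1 PermCat G F)"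
    using hcomp_id_mtrans[of "Src F" "Trg F" F "Trg G" G] by simp
  show "Comp1 PermCat G F \<in> Cell1 PermCat \<and> Src1 PermCat (Comp1 PermCat G F) = Src1 PermCat F
      \<and> Trg1 PermCat (Comp1 PermCat G F) = Trg1 PermCat G"
    using symmetric_monoidal_functor_comp[of "Src F" "Trg F" F "Trg G" G] p by simp
next
  fix F G H :: "('a, 'b, 'a, 'b) smfun"
  assume p: "F \<in> Cell1 PermCat" "G \<in> Cell1 PermCat" "H \<in> Cell1 PermCat"
    "Src1 PermCat G = Trg1 PermCat F" "Src1 PermCat H = Trg1 PermCat G"
  then interpret smfun_triple "Src F" "Trg F" "Trg G" "Trg H" F G H
    by (intro smfun_triple.intro smfun_pair.intro) auto
  show "Comp1 PermCat (Comp1 PermCat H G) F = Comp1 PermCat H (Comp1 PermCat G F)"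
    by (simp add: comp_assoc)
qed (simp_all add: symmetric_monoidal_functor_id)

lemma two_category_prod:
  assumes "two_category K" "two_category L"
  shows "two_category (K \<times>\<^sub>2 L)"
proof -
  interpret K: two_category K by fact
  interpret L: two_category L by fact
  show ?thesis
    \<comment> \<open>Globularity is oriented from \<open>Trg2\<close> to \<open>Src2\<close>, since
      the composability hypotheses are phrased with \<open>Src2\<close>.\<close>
    by unfold_locales
      (auto simp: prod_two_cat_def K.Src1_cell K.Trg1_cell K.Src2_cell K.Trg2_cell
        K.Id1_cell K.Comp1_cell K.Comp1_Id1_right K.Comp1_Id1_left K.Comp1_assoc
        K.Id2_cell K.VComp_cell K.VComp_Id2_right K.VComp_Id2_left K.VComp_assoc K.HComp_cell
        K.HComp_Id_right K.HComp_Id_left K.HComp_assoc K.HComp_Id2 K.interchange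
        L.Src1_cell L.Trg1_cell L.Src2_cell L.Trg2_cell
        L.Id1_cell L.Comp1_cell L.Comp1_Id1_right L.Comp1_Id1_left L.Comp1_assoc
        L.Id2_cell L.VComp_cell L.VComp_Id2_right L.VComp_Id2_left L.VComp_assoc L.HComp_cell
        L.HComp_Id_right L.HComp_Id_left L.HComp_assoc L.HComp_Id2 L.interchange
        simp flip: K.globular_src L.globular_src K.globular_trg L.globular_trg)
qed

section \<open>The tensor product of permutative categories\<close>

lemma tensor_ob_simps [simp]:
  "[] \<in> tensor_ob A B"
  "p # x \<in> tensor_ob A B \<longleftrightarrow> fst p \<in> Ob A \<and> snd p \<in> Ob B \<and> x \<in> tensor_ob A B"
  "x @ y \<in> tensor_ob A B \<longleftrightarrow> x \<in> tensor_ob A B \<and> y \<in> tensor_ob A B"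
  by (auto simp: tensor_ob_def mem_Times_iff)

lemma id_word_simps [simp]:
  "wdom A B (id_word A B x) = map (map_prod (Dom A \<circ> \<one>\<^bsub>A\<^esub>) (Dom B \<circ> \<one>\<^bsub>B\<^esub>)) x"
  "wcod A B (id_word A B x) = map (map_prod (Cod A \<circ> \<one>\<^bsub>A\<^esub>) (Cod B \<circ> \<one>\<^bsub>B\<^esub>)) x"
  by (auto simp: id_word_def map_prod_def)

section \<open>Words, their classes, and the permutative category they form\<close>

locale tensor_pair = A: permutative_category A + B: permutative_category B
  for A :: "('a, 'm) permcat" and B :: "('b, 'n) permcat"
begin

abbreviation "T \<equiv> A \<otimes>\<^sub>0 B"
abbreviation "wfw \<equiv> wf_word A B"
abbreviation "dm \<equiv> wdom A B"
abbreviation "cd \<equiv> wcod A B"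
abbreviation "idw \<equiv> id_word A B"
abbreviation "symw \<equiv> symm_word A B"
abbreviation "obs \<equiv> tensor_ob A B"
abbreviation eqv (infix "\<approx>" 50) where "w \<approx> v \<equiv> word_eq A B w v"
abbreviation "cls \<equiv> word_class A B"

lemma idw_wf [simp]:
  assumes "x \<in> obs" shows "wfw (idw x)" "dm (idw x) = x" "cd (idw x) = x"
  using assms by (induction x) (auto simp: id_word_def)

declare id_word_simps [simp del]

lemma gen_ob:
  "gen_ok A B i \<Longrightarrow> gen_dom A B i \<in> obs \<and> gen_cod A B i \<in> obs"
  by (cases i) auto

lemma wf_ob [simp]: "wfw w \<Longrightarrow> dm w \<in> obs" "wfw w \<Longrightarrow> cd w \<in> obs"
proof (induction w)
  case (Base fs)
  { case 1 then show ?case by (induction fs) auto }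
  { case 2 then show ?case by (induction fs) auto }
qed (auto simp: gen_ob)

lemma symm_word1_wf:
  assumes "fst p \<in> Ob A" "snd p \<in> Ob B" "y \<in> obs"
  shows "wfw (symm_word1 A B p y) \<and> dm (symm_word1 A B p y) = p # y \<and> cd (symm_word1 A B p y) = y @ [p]"
  using assms(3) by (induction y) (use assms in auto)

lemma symw_wf [simp]:
  assumes "x \<in> obs" "y \<in> obs"
  shows "wfw (symw x y)" "dm (symw x y) = x @ y" "cd (symw x y) = y @ x"
  using assms(1) by (induction x) (use assms symm_word1_wf in auto)

lemma Hom_simps [simp]:
  "f \<in> Hom A x y \<longleftrightarrow> f \<in> Ar A \<and> Dom A f = x \<and> Cod A f = y"
  "g \<in> Hom B z w \<longleftrightarrow> g \<in> Ar B \<and> Dom B g = z \<and> Cod B g = w"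
  by (auto simp: Hom_iff)

lemma Base_Then_wf:
  assumes "wfw (Base fs' \<bullet> Base fs)"
  defines "c \<equiv> map2 (\<lambda>(f', g') (f, g). (f' \<cdot>\<^bsub>A\<^esub> f, g' \<cdot>\<^bsub>B\<^esub> g)) fs' fs"
  shows "wfw (Base c) \<and> dm (Base c) = dm (Base fs) \<and> cd (Base c) = cd (Base fs')"
proof -
  \<comment> \<open>\<open>map2\<close> truncates to the shorter list; composability excludes
    this.\<close>
  have "length fs' = length fs" using assms(1) by (auto dest: map_eq_imp_length_eq)
  then show ?thesis using assms(1) unfolding c_def
    by (induction fs' fs rule: list_induct2) auto
qed

text \<open>\<open>Dom\<close> and \<open>Cod\<close> of a class are taken with
  \<open>the_elem\<close>, which is meaningful because related words are parallel.\<close>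

lemma word_eq_wf:
  assumes "w \<approx> v" shows "wfw w \<and> wfw v \<and> dm w = dm v \<and> cd w = cd v"
  using assms
proof (induction rule: word_eq.induct)
  case (Base_Then fs' fs)
  then show ?case using Base_Then_wf[of fs' fs] by simp
qed (auto simp: gen_ob)

lemma mem_cls: "v \<in> cls w \<longleftrightarrow> w \<approx> v"
  by (simp add: word_class_def word_rel_def)

lemma cls_eqI:
  assumes "w \<approx> v" shows "cls w = cls v"
proof -
  have "u \<in> cls w \<longleftrightarrow> u \<in> cls v" for u
    unfolding mem_cls
    using word_eq.trans[OF assms, of u] word_eq.trans[OF word_eq.sym[OF assms], of u] by iprover
  then show ?thesis by blast
qed

lemma tensor_sel [simp]:
  "Ob T = obs" "Plus_ob T = (@)" "Zero T = []" "Idt T x = cls (idw x)" "Symm T x y = cls (symw x y)"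
  by (simp_all add: tensor_def)

lemma Ar_T: "X \<in> Ar T \<longleftrightarrow> (\<exists>w. wfw w \<and> X = cls w)"
  by (auto simp: tensor_def quotient_def word_class_def)

lemma cls_Ar [simp]: "wfw w \<Longrightarrow> cls w \<in> Ar T"
  by (auto simp: Ar_T)

lemma the_elem_cls:
  assumes "wfw w" "\<And>v. w \<approx> v \<Longrightarrow> f v = f w"
  shows "the_elem (f ` cls w) = f w"
proof -
  have "w \<in> cls w" using word_eq.refl[OF assms(1)] by (simp only: mem_cls)
  moreover have "f v = f w" if "v \<in> cls w" for v using that assms(2) by (simp only: mem_cls)
  ultimately have "f ` cls w = {f w}" by blast
  then show ?thesis by simp
qed

lemma cls_Dom_Cod [simp]:
  assumes "wfw w" shows "Dom T (cls w) = dm w" "Cod T (cls w) = cd w"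
proof -
  have "the_elem (dm ` cls w) = dm w"
    by (rule the_elem_cls[OF assms]) (drule word_eq_wf, simp)
  then show "Dom T (cls w) = dm w" by (simp add: tensor_def)
  have "the_elem (cd ` cls w) = cd w"
    by (rule the_elem_cls[OF assms]) (drule word_eq_wf, simp)
  then show "Cod T (cls w) = cd w" by (simp add: tensor_def)
qed

text \<open>Composition and sum of classes, and the tensor product of functors on arrows, are
  defined through all representatives at once. This collapses such a union to the class of one of
  them.\<close>

lemma Image_cls:
  assumes "w \<in> X" "\<And>v. v \<in> X \<Longrightarrow> w \<approx> v"
  shows "word_rel A B `` X = cls w"
proof (intro equalityI subsetI)
  fix u assume "u \<in> word_rel A B `` X"
  then obtain v where "v \<in> X" "v \<approx> u" by (auto simp: word_rel_def)
  then show "u \<in> cls w" using assms(2)[of v] by (auto simp: mem_cls intro: word_eq.trans)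
next
  fix u assume "u \<in> cls w"
  then show "u \<in> word_rel A B `` X" using assms(1) by (auto simp: word_rel_def mem_cls)
qed

lemma Cmp_cls:
  assumes "wfw (w \<bullet> v)" shows "cls w \<cdot>\<^bsub>T\<^esub> cls v = cls (w \<bullet> v)"
proof -
  have "word_rel A B `` {w' \<bullet> v' |w' v'. w' \<in> cls w \<and> v' \<in> cls v} = cls (w \<bullet> v)"
    using assms by (intro Image_cls) (auto simp: mem_cls intro: word_eq.refl word_eq.cong_Then)
  then show ?thesis by (simp add: tensor_def)
qed

lemma Plus_cls:
  assumes "wfw w" "wfw v" shows "cls w \<boxplus>\<^bsub>T\<^esub> cls v = cls (w \<uplus> v)"
proof -
  have "word_rel A B `` {w' \<uplus> v' |w' v'. w' \<in> cls w \<and> v' \<in> cls v} = cls (w \<uplus> v)"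
    using assms by (intro Image_cls) (auto simp: mem_cls intro: word_eq.refl word_eq.cong_Sum)
  then show ?thesis by (simp add: tensor_def)
qed

lemma Hom_T: "X \<in> Hom T x y \<longleftrightarrow> (\<exists>w. wfw w \<and> dm w = x \<and> cd w = y \<and> X = cls w)"
  by (auto simp: Hom_iff Ar_T)

text \<open>Once representatives are chosen, each axiom is a rule of \<open>word_eq\<close> or a
  typing condition on words.\<close>

lemma permutative_tensor: "permutative_category T"
proof unfold_locales
  fix x y z assume "x \<in> Ob T" "y \<in> Ob T" "z \<in> Ob T"
  then show "\<beta>\<^bsub>T\<^esub> x (y \<oplus>\<^bsub>T\<^esub> z) = \<one>\<^bsub>T\<^esub> y \<boxplus>\<^bsub>T\<^esub> \<beta>\<^bsub>T\<^esub> x z \<cdot>\<^bsub>T\<^esub> \<beta>\<^bsub>T\<^esub> x y \<boxplus>\<^bsub>T\<^esub> \<one>\<^bsub>T\<^esub> z"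
    by (simp add: Plus_cls Cmp_cls) (intro cls_eqI word_eq.symm_Sum)
next
  fix f g x x' y y' assume "f \<in> Hom T x x'" "g \<in> Hom T y y'"
  then obtain w v where w [simp]: "wfw w" "wfw v"
    and [simp]: "x = dm w" "x' = cd w" "f = cls w" "y = dm v" "y' = cd v" "g = cls v"
    by (auto simp: Hom_T)
  show "\<beta>\<^bsub>T\<^esub> x' y' \<cdot>\<^bsub>T\<^esub> f \<boxplus>\<^bsub>T\<^esub> g = g \<boxplus>\<^bsub>T\<^esub> f \<cdot>\<^bsub>T\<^esub> \<beta>\<^bsub>T\<^esub> x y"
    using cls_eqI[OF word_eq.symm_natural[OF w]] by (simp add: Plus_cls Cmp_cls)
next
  fix f g h x y z w assume "f \<in> Hom T x y" "g \<in> Hom T y z" "h \<in> Hom T z w"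
  then obtain u v r where "wfw u" "wfw v" "wfw r" "cd u = dm v" "cd v = dm r"
    "f = cls u" "g = cls v" "h = cls r"
    by (auto simp: Hom_T)
  then show "(h \<cdot>\<^bsub>T\<^esub> g) \<cdot>\<^bsub>T\<^esub> f = h \<cdot>\<^bsub>T\<^esub> g \<cdot>\<^bsub>T\<^esub> f"
    using cls_eqI[OF word_eq.Then_assoc[of A B r v u]] by (simp add: Cmp_cls)
next
  fix f f' g g' x x' x'' y y' y''
  assume "f \<in> Hom T x x'" "f' \<in> Hom T x' x''" "g \<in> Hom T y y'" "g' \<in> Hom T y' y''"
  then obtain u u' v v' where "wfw u" "wfw u'" "wfw v" "wfw v'" "cd u = dm u'" "cd v = dm v'"
    "f = cls u" "f' = cls u'" "g = cls v" "g' = cls v'"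
    by (auto simp: Hom_T)
  then show "(f' \<cdot>\<^bsub>T\<^esub> f) \<boxplus>\<^bsub>T\<^esub> (g' \<cdot>\<^bsub>T\<^esub> g) = f' \<boxplus>\<^bsub>T\<^esub> g' \<cdot>\<^bsub>T\<^esub> f \<boxplus>\<^bsub>T\<^esub> g"
    using cls_eqI[OF word_eq.interchange[of A B u' u v' v]] by (simp add: Cmp_cls Plus_cls)
next
  fix f g x x' y y' assume "f \<in> Hom T x x'" "g \<in> Hom T y y'"
  then obtain w v where "wfw w" "wfw v" "x = dm w" "x' = cd w" "f = cls w" "y = dm v" "y' = cd v" "g = cls v"
    by (auto simp: Hom_T)
  then show "f \<boxplus>\<^bsub>T\<^esub> g \<in> Hom T (x \<oplus>\<^bsub>T\<^esub> y) (x' \<oplus>\<^bsub>T\<^esub> y')"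
    by (simp add: Hom_iff Plus_cls)
next
  fix f g x y z assume "f \<in> Hom T x y" "g \<in> Hom T y z"
  then obtain w v where "wfw w" "wfw v" "dm v = cd w" "x = dm w" "z = cd v" "f = cls w" "g = cls v"
    by (auto simp: Hom_T)
  then show "g \<cdot>\<^bsub>T\<^esub> f \<in> Hom T x z"
    by (simp add: Hom_iff Cmp_cls)
next
  \<comment> \<open>Identity words lie in the image of \<open>Base\<close>, so
    \<open>Base_Sum\<close> computes their sum.\<close>
  fix x y assume "x \<in> Ob T" "y \<in> Ob T"
  then show "\<one>\<^bsub>T\<^esub> x \<boxplus>\<^bsub>T\<^esub> \<one>\<^bsub>T\<^esub> y = \<one>\<^bsub>T\<^esub> (x \<oplus>\<^bsub>T\<^esub> y)"
    using word_eq.Base_Sum[of A B "map (map_prod \<one>\<^bsub>A\<^esub> \<one>\<^bsub>B\<^esub>) x" "map (map_prod \<one>\<^bsub>A\<^esub> \<one>\<^bsub>B\<^esub>) y"]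
      idw_wf(1)[of x] idw_wf(1)[of y]
    by (simp add: Plus_cls cls_eqI id_word_def)
next
  fix f assume "f \<in> Ar T"
  then obtain w where "wfw w" "f = cls w" by (auto simp: Ar_T)
  then show "\<one>\<^bsub>T\<^esub> \<zero>\<^bsub>T\<^esub> \<boxplus>\<^bsub>T\<^esub> f = f" "f \<boxplus>\<^bsub>T\<^esub> \<one>\<^bsub>T\<^esub> \<zero>\<^bsub>T\<^esub> = f"
    using cls_eqI[OF word_eq.Sum_id_left[of A B w]] cls_eqI[OF word_eq.Sum_id_right[of A B w]]
    by (simp_all add: Plus_cls)
next
  fix f x y assume "f \<in> Hom T x y"
  then obtain w where "wfw w" "x = dm w" "y = cd w" "f = cls w" by (auto simp: Hom_T)
  then show "f \<cdot>\<^bsub>T\<^esub> \<one>\<^bsub>T\<^esub> x = f" "\<one>\<^bsub>T\<^esub> y \<cdot>\<^bsub>T\<^esub> f = f"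
    using cls_eqI[OF word_eq.Then_id_left[of A B w]] cls_eqI[OF word_eq.Then_id_right[of A B w]]
    by (simp_all add: Cmp_cls)
next
  fix f g h assume "f \<in> Ar T" "g \<in> Ar T" "h \<in> Ar T"
  then obtain u v w where "wfw u" "wfw v" "wfw w" "f = cls u" "g = cls v" "h = cls w"
    by (auto simp: Ar_T)
  then show "(f \<boxplus>\<^bsub>T\<^esub> g) \<boxplus>\<^bsub>T\<^esub> h = f \<boxplus>\<^bsub>T\<^esub> g \<boxplus>\<^bsub>T\<^esub> h"
    using cls_eqI[OF word_eq.Sum_assoc[of A B u v w]] by (simp add: Plus_cls)
next
  fix x y assume "x \<in> Ob T" "y \<in> Ob T"
  then show "\<beta>\<^bsub>T\<^esub> y x \<cdot>\<^bsub>T\<^esub> \<beta>\<^bsub>T\<^esub> x y = \<one>\<^bsub>T\<^esub> (x \<oplus>\<^bsub>T\<^esub> y)"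
    using cls_eqI[OF word_eq.symm_symm[of x A B y]] by (simp add: Cmp_cls)
qed (auto simp: Hom_iff, auto simp: Ar_T)

sublocale T: permutative_category T
  by (rule permutative_tensor)

text \<open>From here on identities and symmetries are displayed as \<open>Idt\<close> and
  \<open>Symm\<close> of \<open>T\<close> and not as classes of words, so that the laws of a
  permutative category apply to them.\<close>

declare tensor_sel(4,5) [simp del]
lemmas cls_idw_symw [simp] = tensor_sel(4,5)[symmetric]

text \<open>The zero object is rewritten to the empty list, a form that the general unit laws do not
  match.\<close>

lemma Plus_ar_Idt_Nil [simp]: "X \<in> Ar T \<Longrightarrow> \<one>\<^bsub>T\<^esub> [] \<boxplus>\<^bsub>T\<^esub> X = X" "X \<in> Ar T \<Longrightarrow> X \<boxplus>\<^bsub>T\<^esub> \<one>\<^bsub>T\<^esub> [] = X"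
  using T.Zero_ar_left[of X] T.Zero_ar_right[of X] by simp_all

section \<open>The relations as equations between arrows\<close>

lemma cls_Then: "wfw (w \<bullet> v) \<Longrightarrow> cls (w \<bullet> v) = cls w \<cdot>\<^bsub>T\<^esub> cls v"
  by (simp only: Cmp_cls)

lemma cls_Sum: "wfw w \<Longrightarrow> wfw v \<Longrightarrow> cls (w \<uplus> v) = cls w \<boxplus>\<^bsub>T\<^esub> cls v"
  by (simp only: Plus_cls)

lemma cls_dot_id: "cls (\<one>\<^bsub>A\<^esub> a \<odot> \<one>\<^bsub>B\<^esub> b) = \<one>\<^bsub>T\<^esub> [(a, b)]"
  by (simp add: tensor_sel(4) id_word_def del: cls_idw_symw)

text \<open>\<open>Base_Then\<close> at lists of length one. Filling slots with identities gives the
  exchange of \<open>f.1\<close> and \<open>1.g\<close> on which all later sliding rests.\<close>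

lemma cls_dot_Cmp:
  assumes "f \<in> Ar A" "f' \<in> Ar A" "Cod A f = Dom A f'" "g \<in> Ar B" "g' \<in> Ar B" "Cod B g = Dom B g'"
  shows "cls (f' \<odot> g') \<cdot>\<^bsub>T\<^esub> cls (f \<odot> g) = cls ((f' \<cdot>\<^bsub>A\<^esub> f) \<odot> (g' \<cdot>\<^bsub>B\<^esub> g))"
  using cls_eqI[OF word_eq.Base_Then[of A B "[(f', g')]" "[(f, g)]"]] assms by (simp add: cls_Then)

lemma cls_Base_Cons:
  assumes "f \<in> Ar A" "g \<in> Ar B" "set fs \<subseteq> Ar A \<times> Ar B"
  shows "cls (Base ((f, g) # fs)) = cls (f \<odot> g) \<boxplus>\<^bsub>T\<^esub> cls (Base fs)"
  using cls_eqI[OF word_eq.Base_Sum[of A B "[(f, g)]" fs]] assms by (simp add: cls_Sum)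

lemma cls_Base_append:
  assumes "set fs \<subseteq> Ar A \<times> Ar B" "set gs \<subseteq> Ar A \<times> Ar B"
  shows "cls (Base (fs @ gs)) = cls (Base fs) \<boxplus>\<^bsub>T\<^esub> cls (Base gs)"
  using cls_eqI[OF word_eq.Base_Sum[of A B fs gs]] assms by (simp add: cls_Sum)

lemma inverse_pair_Gen:
  assumes "gen_ok A B i" shows "inverse_pair T (cls (Gen i)) (cls (GenInv i))"
  using assms gen_ob[OF assms] cls_eqI[OF word_eq.GenInv_Gen[OF assms]]
    cls_eqI[OF word_eq.Gen_GenInv[OF assms]]
  by (intro T.inverse_pairI) (simp_all add: cls_Then)

lemma inverse_pair_dot:
  assumes "inverse_pair A f f'" "inverse_pair B g g'"
  shows "inverse_pair T (cls (f \<odot> g)) (cls (f' \<odot> g'))"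
  using A.inverse_pairD[OF assms(1)] B.inverse_pairD[OF assms(2)]
  by (intro T.inverse_pairI) (simp_all add: cls_dot_Cmp cls_dot_id)

text \<open>This and the following lemmas move the relations from words to arrows of
  \<open>T\<close>. End points are written with \<open>Dom\<close> and \<open>Cod\<close>, so an
  instance is fixed by its arrows alone.\<close>

lemma DL_natural:
  assumes "f \<in> Ar A" "g \<in> Ar B" "g' \<in> Ar B"
  shows "cls (Gen (DL (Cod A f) (Cod B g) (Cod B g'))) \<cdot>\<^bsub>T\<^esub> (cls (f \<odot> g) \<boxplus>\<^bsub>T\<^esub> cls (f \<odot> g')) =
    cls (f \<odot> (g \<boxplus>\<^bsub>B\<^esub> g')) \<cdot>\<^bsub>T\<^esub> cls (Gen (DL (Dom A f) (Dom B g) (Dom B g')))"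
  using cls_eqI[OF word_eq.DL_natural[of f A "Dom A f" "Cod A f" g B "Dom B g" "Cod B g" g' "Dom B g'" "Cod B g'"]]
    assms by (simp add: cls_Then cls_Sum)

lemma DR_natural:
  assumes "g \<in> Ar B" "f \<in> Ar A" "f' \<in> Ar A"
  shows "cls (Gen (DR (Cod B g) (Cod A f) (Cod A f'))) \<cdot>\<^bsub>T\<^esub> (cls (f \<odot> g) \<boxplus>\<^bsub>T\<^esub> cls (f' \<odot> g)) =
    cls ((f \<boxplus>\<^bsub>A\<^esub> f') \<odot> g) \<cdot>\<^bsub>T\<^esub> cls (Gen (DR (Dom B g) (Dom A f) (Dom A f')))"
  using cls_eqI[OF word_eq.DR_natural[of g B "Dom B g" "Cod B g" f A "Dom A f" "Cod A f" f' "Dom A f'" "Cod A f'"]]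
    assms by (simp add: cls_Then cls_Sum)

lemma BB_natural:
  assumes "f \<in> Ar A" "g \<in> Ar B" "f' \<in> Ar A" "g' \<in> Ar B"
  shows "cls (Gen (BB (Cod A f) (Cod B g) (Cod A f') (Cod B g'))) \<cdot>\<^bsub>T\<^esub>
      (cls (f \<odot> g) \<boxplus>\<^bsub>T\<^esub> cls (f' \<odot> g')) =
    (cls (f' \<odot> g') \<boxplus>\<^bsub>T\<^esub> cls (f \<odot> g)) \<cdot>\<^bsub>T\<^esub> cls (Gen (BB (Dom A f) (Dom B g) (Dom A f') (Dom B g')))"
  using cls_eqI[OF word_eq.BB_natural[of f A "Dom A f" "Cod A f" g B "Dom B g" "Cod B g"
      f' "Dom A f'" "Cod A f'" g' "Dom B g'" "Cod B g'"]] assms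
  by (simp add: cls_Then cls_Sum)

lemma ZL_natural:
  "f \<in> Ar A \<Longrightarrow> cls (f \<odot> \<one>\<^bsub>B\<^esub> \<zero>\<^bsub>B\<^esub>) \<cdot>\<^bsub>T\<^esub> cls (Gen (ZL (Dom A f))) = cls (Gen (ZL (Cod A f)))"
  using cls_eqI[OF word_eq.ZL_natural[of f A "Dom A f" "Cod A f" B]] by (simp add: cls_Then)

lemma ZR_natural:
  "g \<in> Ar B \<Longrightarrow> cls (\<one>\<^bsub>A\<^esub> \<zero>\<^bsub>A\<^esub> \<odot> g) \<cdot>\<^bsub>T\<^esub> cls (Gen (ZR (Dom B g))) = cls (Gen (ZR (Cod B g)))"
  using cls_eqI[OF word_eq.ZR_natural[of g B "Dom B g" "Cod B g" A]] by (simp add: cls_Then)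

lemma DL_DR:
  assumes "a \<in> Ob A" "a' \<in> Ob A" "b \<in> Ob B" "b' \<in> Ob B"
  shows "cls (Gen (DL (a \<oplus>\<^bsub>A\<^esub> a') b b')) \<cdot>\<^bsub>T\<^esub> (cls (Gen (DR b a a')) \<boxplus>\<^bsub>T\<^esub> cls (Gen (DR b' a a'))) =
    cls (Gen (DR (b \<oplus>\<^bsub>B\<^esub> b') a a')) \<cdot>\<^bsub>T\<^esub> ((cls (Gen (DL a b b')) \<boxplus>\<^bsub>T\<^esub> cls (Gen (DL a' b b'))) \<cdot>\<^bsub>T\<^esub>
      (\<one>\<^bsub>T\<^esub> [(a, b)] \<boxplus>\<^bsub>T\<^esub> cls (Gen (BB a' b a b')) \<boxplus>\<^bsub>T\<^esub> \<one>\<^bsub>T\<^esub> [(a', b')]))"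
  using cls_eqI[OF word_eq.DL_DR[of a A a' b B b']] assms by (simp add: cls_Then cls_Sum)

lemma ZL_ZR: "cls (Gen (ZL \<zero>\<^bsub>A\<^esub>)) = cls (Gen (ZR \<zero>\<^bsub>B\<^esub>))"
  by (rule cls_eqI[OF word_eq.ZL_ZR])

lemma DR_ZL:
  assumes "a \<in> Ob A" "a' \<in> Ob A"
  shows "cls (Gen (DR \<zero>\<^bsub>B\<^esub> a a')) \<cdot>\<^bsub>T\<^esub> (cls (Gen (ZL a)) \<boxplus>\<^bsub>T\<^esub> cls (Gen (ZL a'))) =
    cls (Gen (ZL (a \<oplus>\<^bsub>A\<^esub> a')))"
  using cls_eqI[OF word_eq.DR_ZL[of a A a' B]] assms by (simp add: cls_Then cls_Sum)

lemma DL_ZR: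
  assumes "b \<in> Ob B" "b' \<in> Ob B"
  shows "cls (Gen (DL \<zero>\<^bsub>A\<^esub> b b')) \<cdot>\<^bsub>T\<^esub> (cls (Gen (ZR b)) \<boxplus>\<^bsub>T\<^esub> cls (Gen (ZR b'))) =
    cls (Gen (ZR (b \<oplus>\<^bsub>B\<^esub> b')))"
  using cls_eqI[OF word_eq.DL_ZR[of b B b' A]] assms by (simp add: cls_Then cls_Sum)

text \<open>On single summands the recursion in \<open>symm_word\<close> produces \<open>BB\<close>
  padded with identities and with sums by the empty word, all of which vanish in the
  quotient.\<close>

lemma Symm_singletons:
  assumes "a \<in> Ob A" "b \<in> Ob B" "a' \<in> Ob A" "b' \<in> Ob B"
  shows "\<beta>\<^bsub>T\<^esub> [(a, b)] [(a', b')] = cls (Gen (BB a b a' b'))"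
  using assms by (simp add: tensor_sel(5) cls_Then cls_Sum del: cls_idw_symw(2))

section \<open>The symmetric monoidal functors \<open>a.(-)\<close> and \<open>(-).b\<close>\<close>

definition left_smfun :: "'a \<Rightarrow> ('b, 'n, ('a \<times> 'b) list, ('a, 'm, 'b, 'n) word set) smfun" where
  "left_smfun a = \<lparr>
     Src = B, Trg = T,
     On_ob = restrict (\<lambda>b. [(a, b)]) (Ob B),
     On_ar = restrict (\<lambda>g. cls (\<one>\<^bsub>A\<^esub> a \<odot> g)) (Ar B),
     Mul = restrict (\<lambda>(b, b'). cls (Gen (DL a b b'))) (Ob B \<times> Ob B),
     Unt = cls (Gen (ZL a)) \<rparr>"

definition right_smfun :: "'b \<Rightarrow> ('a, 'm, ('a \<times> 'b) list, ('a, 'm, 'b, 'n) word set) smfun" where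
  "right_smfun b = \<lparr>
     Src = A, Trg = T,
     On_ob = restrict (\<lambda>a. [(a, b)]) (Ob A),
     On_ar = restrict (\<lambda>f. cls (f \<odot> \<one>\<^bsub>B\<^esub> b)) (Ar A),
     Mul = restrict (\<lambda>(a, a'). cls (Gen (DR b a a'))) (Ob A \<times> Ob A),
     Unt = cls (Gen (ZR b)) \<rparr>"

lemma left_smfun_sel [simp]:
  "b \<in> Ob B \<Longrightarrow> On_ob (left_smfun a) b = [(a, b)]"
  "g \<in> Ar B \<Longrightarrow> On_ar (left_smfun a) g = cls (\<one>\<^bsub>A\<^esub> a \<odot> g)"
  "\<lbrakk>b \<in> Ob B; b' \<in> Ob B\<rbrakk> \<Longrightarrow> Mul (left_smfun a) (b, b') = cls (Gen (DL a b b'))"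
  "Unt (left_smfun a) = cls (Gen (ZL a))"
  by (simp_all add: left_smfun_def)

lemma right_smfun_sel [simp]:
  "a \<in> Ob A \<Longrightarrow> On_ob (right_smfun b) a = [(a, b)]"
  "f \<in> Ar A \<Longrightarrow> On_ar (right_smfun b) f = cls (f \<odot> \<one>\<^bsub>B\<^esub> b)"
  "\<lbrakk>a \<in> Ob A; a' \<in> Ob A\<rbrakk> \<Longrightarrow> Mul (right_smfun b) (a, a') = cls (Gen (DR b a a'))"
  "Unt (right_smfun b) = cls (Gen (ZR b))"
  by (simp_all add: right_smfun_def)

lemma is_iso_Gen: "gen_ok A B i \<Longrightarrow> is_iso T (cls (Gen i))"
  using inverse_pair_Gen by (auto simp: is_iso_def)

text \<open>With the identity of \<open>a\<close> in the first slot, \<open>cls_dot_Cmp\<close>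
  gives functoriality and \<open>DL_natural\<close> gives naturality of the constraint. The
  coherence laws are \<open>DL_assoc\<close>, \<open>DL_unit_right\<close>,
  \<open>DL_unit_left\<close> and \<open>DL_symm\<close>.\<close>

lemma left_smfun:
  assumes [simp]: "a \<in> Ob A" shows "symmetric_monoidal_functor B T (left_smfun a)"
proof (rule symmetric_monoidal_functorI)
  show "permutative_category B" "permutative_category T" ..
  show "Src (left_smfun a) = B" "Trg (left_smfun a) = T"
    "On_ob (left_smfun a) \<in> extensional (Ob B)" "On_ar (left_smfun a) \<in> extensional (Ar B)"
    "Mul (left_smfun a) \<in> extensional (Ob B \<times> Ob B)"
    by (simp_all add: left_smfun_def)
next
  fix f g assume "f \<in> Ar B" "g \<in> Ar B" "Cod B f = Dom B g"
  then show "On_ar (left_smfun a) (g \<cdot>\<^bsub>B\<^esub> f) = On_ar (left_smfun a) g \<cdot>\<^bsub>T\<^esub> On_ar (left_smfun a) f"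
    by (simp add: cls_dot_Cmp)
next
  fix f g assume "f \<in> Ar B" "g \<in> Ar B"
  then show "On_ar (left_smfun a) (f \<boxplus>\<^bsub>B\<^esub> g) \<cdot>\<^bsub>T\<^esub> Mul (left_smfun a) (Dom B f, Dom B g) =
      Mul (left_smfun a) (Cod B f, Cod B g) \<cdot>\<^bsub>T\<^esub> (On_ar (left_smfun a) f \<boxplus>\<^bsub>T\<^esub> On_ar (left_smfun a) g)"
    using DL_natural[of "\<one>\<^bsub>A\<^esub> a" f g] by simp
next
  fix x y z assume "x \<in> Ob B" "y \<in> Ob B" "z \<in> Ob B"
  then show "Mul (left_smfun a) (x \<oplus>\<^bsub>B\<^esub> y, z) \<cdot>\<^bsub>T\<^esub>
        (Mul (left_smfun a) (x, y) \<boxplus>\<^bsub>T\<^esub> \<one>\<^bsub>T\<^esub> (On_ob (left_smfun a) z)) =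
      Mul (left_smfun a) (x, y \<oplus>\<^bsub>B\<^esub> z) \<cdot>\<^bsub>T\<^esub>
        (\<one>\<^bsub>T\<^esub> (On_ob (left_smfun a) x) \<boxplus>\<^bsub>T\<^esub> Mul (left_smfun a) (y, z))"
    using cls_eqI[OF word_eq.DL_assoc[of a A x B y z]] by (simp add: cls_Then cls_Sum)
next
  fix x assume "x \<in> Ob B"
  then show "Mul (left_smfun a) (x, \<zero>\<^bsub>B\<^esub>) \<cdot>\<^bsub>T\<^esub>
        (\<one>\<^bsub>T\<^esub> (On_ob (left_smfun a) x) \<boxplus>\<^bsub>T\<^esub> Unt (left_smfun a)) = \<one>\<^bsub>T\<^esub> (On_ob (left_smfun a) x)"
    "Mul (left_smfun a) (\<zero>\<^bsub>B\<^esub>, x) \<cdot>\<^bsub>T\<^esub>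
        (Unt (left_smfun a) \<boxplus>\<^bsub>T\<^esub> \<one>\<^bsub>T\<^esub> (On_ob (left_smfun a) x)) = \<one>\<^bsub>T\<^esub> (On_ob (left_smfun a) x)"
    using cls_eqI[OF word_eq.DL_unit_right[of a A x B]] cls_eqI[OF word_eq.DL_unit_left[of a A x B]]
    by (simp_all add: cls_Then cls_Sum)
next
  fix x y assume "x \<in> Ob B" "y \<in> Ob B"
  then show "On_ar (left_smfun a) (\<beta>\<^bsub>B\<^esub> x y) \<cdot>\<^bsub>T\<^esub> Mul (left_smfun a) (x, y) =
      Mul (left_smfun a) (y, x) \<cdot>\<^bsub>T\<^esub> \<beta>\<^bsub>T\<^esub> (On_ob (left_smfun a) x) (On_ob (left_smfun a) y)"
    using cls_eqI[OF word_eq.DL_symm[of a A x B y]]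
    by (simp add: cls_Then cls_Sum Symm_singletons)
qed (simp_all add: is_iso_Gen cls_dot_id)

lemma right_smfun:
  assumes [simp]: "b \<in> Ob B" shows "symmetric_monoidal_functor A T (right_smfun b)"
proof (rule symmetric_monoidal_functorI)
  show "permutative_category A" "permutative_category T" ..
  show "Src (right_smfun b) = A" "Trg (right_smfun b) = T"
    "On_ob (right_smfun b) \<in> extensional (Ob A)" "On_ar (right_smfun b) \<in> extensional (Ar A)"
    "Mul (right_smfun b) \<in> extensional (Ob A \<times> Ob A)"
    by (simp_all add: right_smfun_def)
next
  fix f g assume "f \<in> Ar A" "g \<in> Ar A" "Cod A f = Dom A g"
  then show "On_ar (right_smfun b) (g \<cdot>\<^bsub>A\<^esub> f) = On_ar (right_smfun b) g \<cdot>\<^bsub>T\<^esub> On_ar (right_smfun b) f"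
    by (simp add: cls_dot_Cmp)
next
  fix f g assume "f \<in> Ar A" "g \<in> Ar A"
  then show "On_ar (right_smfun b) (f \<boxplus>\<^bsub>A\<^esub> g) \<cdot>\<^bsub>T\<^esub> Mul (right_smfun b) (Dom A f, Dom A g) =
      Mul (right_smfun b) (Cod A f, Cod A g) \<cdot>\<^bsub>T\<^esub> (On_ar (right_smfun b) f \<boxplus>\<^bsub>T\<^esub> On_ar (right_smfun b) g)"
    using DR_natural[of "\<one>\<^bsub>B\<^esub> b" f g] by simp
next
  fix x y z assume "x \<in> Ob A" "y \<in> Ob A" "z \<in> Ob A"
  then show "Mul (right_smfun b) (x \<oplus>\<^bsub>A\<^esub> y, z) \<cdot>\<^bsub>T\<^esub>
        (Mul (right_smfun b) (x, y) \<boxplus>\<^bsub>T\<^esub> \<one>\<^bsub>T\<^esub> (On_ob (right_smfun b) z)) =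
      Mul (right_smfun b) (x, y \<oplus>\<^bsub>A\<^esub> z) \<cdot>\<^bsub>T\<^esub>
        (\<one>\<^bsub>T\<^esub> (On_ob (right_smfun b) x) \<boxplus>\<^bsub>T\<^esub> Mul (right_smfun b) (y, z))"
    using cls_eqI[OF word_eq.DR_assoc[of b B x A y z]] by (simp add: cls_Then cls_Sum)
next
  fix x assume "x \<in> Ob A"
  then show "Mul (right_smfun b) (x, \<zero>\<^bsub>A\<^esub>) \<cdot>\<^bsub>T\<^esub>
        (\<one>\<^bsub>T\<^esub> (On_ob (right_smfun b) x) \<boxplus>\<^bsub>T\<^esub> Unt (right_smfun b)) = \<one>\<^bsub>T\<^esub> (On_ob (right_smfun b) x)"
    "Mul (right_smfun b) (\<zero>\<^bsub>A\<^esub>, x) \<cdot>\<^bsub>T\<^esub>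
        (Unt (right_smfun b) \<boxplus>\<^bsub>T\<^esub> \<one>\<^bsub>T\<^esub> (On_ob (right_smfun b) x)) = \<one>\<^bsub>T\<^esub> (On_ob (right_smfun b) x)"
    using cls_eqI[OF word_eq.DR_unit_right[of b B x A]] cls_eqI[OF word_eq.DR_unit_left[of b B x A]]
    by (simp_all add: cls_Then cls_Sum)
next
  fix x y assume "x \<in> Ob A" "y \<in> Ob A"
  then show "On_ar (right_smfun b) (\<beta>\<^bsub>A\<^esub> x y) \<cdot>\<^bsub>T\<^esub> Mul (right_smfun b) (x, y) =
      Mul (right_smfun b) (y, x) \<cdot>\<^bsub>T\<^esub> \<beta>\<^bsub>T\<^esub> (On_ob (right_smfun b) x) (On_ob (right_smfun b) y)"
    using cls_eqI[OF word_eq.DR_symm[of b B x A y]]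
    by (simp add: cls_Then cls_Sum Symm_singletons)
qed (simp_all add: is_iso_Gen cls_dot_id)

end

section \<open>Sliding arrows of the factors past \<delta> and \<zeta>\<close>

context tensor_pair
begin

text \<open>Naturality of \<delta> pushes \<open>p\<close>, \<open>q\<close> and \<open>q'\<close>
  to its other side, which leaves the square \<open>eq\<close> in the second slot. With constraints
  for \<open>m\<close> and \<open>m'\<close> this gives naturality in the arrows or along a
  transformation; with identities for \<open>q\<close>, \<open>q'\<close> and \<open>m\<close> it
  merges a constraint of each factor into one dot.\<close>

lemma DL_square:
  assumes p: "p \<in> Ar A" and ar: "q \<in> Ar B" "q' \<in> Ar B" "r \<in> Ar B" "m \<in> Ar B" "m' \<in> Ar B"
    and eq: "m' \<cdot>\<^bsub>B\<^esub> (q \<boxplus>\<^bsub>B\<^esub> q') = r \<cdot>\<^bsub>B\<^esub> m"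
    and dc: "Dom B m = Dom B q \<oplus>\<^bsub>B\<^esub> Dom B q'" "Dom B m' = Cod B q \<oplus>\<^bsub>B\<^esub> Cod B q'" "Cod B m = Dom B r"
  shows "(cls (\<one>\<^bsub>A\<^esub> (Cod A p) \<odot> m') \<cdot>\<^bsub>T\<^esub> cls (Gen (DL (Cod A p) (Cod B q) (Cod B q')))) \<cdot>\<^bsub>T\<^esub>
      (cls (p \<odot> q) \<boxplus>\<^bsub>T\<^esub> cls (p \<odot> q')) =
    cls (p \<odot> r) \<cdot>\<^bsub>T\<^esub> (cls (\<one>\<^bsub>A\<^esub> (Dom A p) \<odot> m) \<cdot>\<^bsub>T\<^esub> cls (Gen (DL (Dom A p) (Dom B q) (Dom B q'))))"
    (is "(?m' \<cdot>\<^bsub>T\<^esub> ?D') \<cdot>\<^bsub>T\<^esub> ?q = ?r \<cdot>\<^bsub>T\<^esub> (?m \<cdot>\<^bsub>T\<^esub> ?D)")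
proof -
  have "(?m' \<cdot>\<^bsub>T\<^esub> ?D') \<cdot>\<^bsub>T\<^esub> ?q = ?m' \<cdot>\<^bsub>T\<^esub> (?D' \<cdot>\<^bsub>T\<^esub> ?q)"
    using p ar dc by simp
  also have "\<dots> = (?m' \<cdot>\<^bsub>T\<^esub> cls (p \<odot> (q \<boxplus>\<^bsub>B\<^esub> q'))) \<cdot>\<^bsub>T\<^esub> ?D"
    unfolding DL_natural[OF p ar(1,2)] using p ar dc by simp
  \<comment> \<open>Each side merges into a single dot; \<open>p\<close> absorbs the identities in
    the first slot and \<open>eq\<close> equates the second slots.\<close>
  also have "?m' \<cdot>\<^bsub>T\<^esub> cls (p \<odot> (q \<boxplus>\<^bsub>B\<^esub> q')) = ?r \<cdot>\<^bsub>T\<^esub> ?m"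
    using p ar dc eq by (simp add: cls_dot_Cmp)
  finally show ?thesis using p ar dc by simp
qed

lemma DR_square:
  assumes p: "p \<in> Ar B" and ar: "q \<in> Ar A" "q' \<in> Ar A" "r \<in> Ar A" "m \<in> Ar A" "m' \<in> Ar A"
    and eq: "m' \<cdot>\<^bsub>A\<^esub> (q \<boxplus>\<^bsub>A\<^esub> q') = r \<cdot>\<^bsub>A\<^esub> m"
    and dc: "Dom A m = Dom A q \<oplus>\<^bsub>A\<^esub> Dom A q'" "Dom A m' = Cod A q \<oplus>\<^bsub>A\<^esub> Cod A q'" "Cod A m = Dom A r"
  shows "(cls (m' \<odot> \<one>\<^bsub>B\<^esub> (Cod B p)) \<cdot>\<^bsub>T\<^esub> cls (Gen (DR (Cod B p) (Cod A q) (Cod A q')))) \<cdot>\<^bsub>T\<^esub>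
      (cls (q \<odot> p) \<boxplus>\<^bsub>T\<^esub> cls (q' \<odot> p)) =
    cls (r \<odot> p) \<cdot>\<^bsub>T\<^esub> (cls (m \<odot> \<one>\<^bsub>B\<^esub> (Dom B p)) \<cdot>\<^bsub>T\<^esub> cls (Gen (DR (Dom B p) (Dom A q) (Dom A q'))))"
    (is "(?m' \<cdot>\<^bsub>T\<^esub> ?D') \<cdot>\<^bsub>T\<^esub> ?q = ?r \<cdot>\<^bsub>T\<^esub> (?m \<cdot>\<^bsub>T\<^esub> ?D)")
proof -
  have "(?m' \<cdot>\<^bsub>T\<^esub> ?D') \<cdot>\<^bsub>T\<^esub> ?q = ?m' \<cdot>\<^bsub>T\<^esub> (?D' \<cdot>\<^bsub>T\<^esub> ?q)"
    using p ar dc by simp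
  also have "\<dots> = (?m' \<cdot>\<^bsub>T\<^esub> cls ((q \<boxplus>\<^bsub>A\<^esub> q') \<odot> p)) \<cdot>\<^bsub>T\<^esub> ?D"
    unfolding DR_natural[OF p ar(1,2)] using p ar dc by simp
  also have "?m' \<cdot>\<^bsub>T\<^esub> cls ((q \<boxplus>\<^bsub>A\<^esub> q') \<odot> p) = ?r \<cdot>\<^bsub>T\<^esub> ?m"
    using p ar dc eq by (simp add: cls_dot_Cmp)
  finally show ?thesis using p ar dc by simp
qed

text \<open>Inserting the identity of the zero object writes \<open>p.(r m)\<close> as
  \<open>1.(r m)\<close> after \<open>p.1\<close>, and naturality of \<zeta> absorbs
  \<open>p.1\<close>.\<close>

lemma ZL_square:
  assumes "p \<in> Ar A" "r \<in> Ar B" "m \<in> Ar B" "Dom B m = \<zero>\<^bsub>B\<^esub>" "Cod B m = Dom B r"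
  shows "cls (\<one>\<^bsub>A\<^esub> (Cod A p) \<odot> (r \<cdot>\<^bsub>B\<^esub> m)) \<cdot>\<^bsub>T\<^esub> cls (Gen (ZL (Cod A p))) =
    cls (p \<odot> r) \<cdot>\<^bsub>T\<^esub> (cls (\<one>\<^bsub>A\<^esub> (Dom A p) \<odot> m) \<cdot>\<^bsub>T\<^esub> cls (Gen (ZL (Dom A p))))"
proof -
  have "cls (p \<odot> r) \<cdot>\<^bsub>T\<^esub> (cls (\<one>\<^bsub>A\<^esub> (Dom A p) \<odot> m) \<cdot>\<^bsub>T\<^esub> cls (Gen (ZL (Dom A p)))) =
      (cls (p \<odot> r) \<cdot>\<^bsub>T\<^esub> cls (\<one>\<^bsub>A\<^esub> (Dom A p) \<odot> m)) \<cdot>\<^bsub>T\<^esub> cls (Gen (ZL (Dom A p)))"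
    using assms by simp
  also have "cls (p \<odot> r) \<cdot>\<^bsub>T\<^esub> cls (\<one>\<^bsub>A\<^esub> (Dom A p) \<odot> m) =
      cls (\<one>\<^bsub>A\<^esub> (Cod A p) \<odot> (r \<cdot>\<^bsub>B\<^esub> m)) \<cdot>\<^bsub>T\<^esub> cls (p \<odot> \<one>\<^bsub>B\<^esub> \<zero>\<^bsub>B\<^esub>)"
    using assms by (simp add: cls_dot_Cmp)
  finally show ?thesis using assms by (simp add: ZL_natural)
qed

lemma ZR_square:
  assumes "p \<in> Ar B" "r \<in> Ar A" "m \<in> Ar A" "Dom A m = \<zero>\<^bsub>A\<^esub>" "Cod A m = Dom A r"
  shows "cls ((r \<cdot>\<^bsub>A\<^esub> m) \<odot> \<one>\<^bsub>B\<^esub> (Cod B p)) \<cdot>\<^bsub>T\<^esub> cls (Gen (ZR (Cod B p))) =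
    cls (r \<odot> p) \<cdot>\<^bsub>T\<^esub> (cls (m \<odot> \<one>\<^bsub>B\<^esub> (Dom B p)) \<cdot>\<^bsub>T\<^esub> cls (Gen (ZR (Dom B p))))"
proof -
  have "cls (r \<odot> p) \<cdot>\<^bsub>T\<^esub> (cls (m \<odot> \<one>\<^bsub>B\<^esub> (Dom B p)) \<cdot>\<^bsub>T\<^esub> cls (Gen (ZR (Dom B p)))) =
      (cls (r \<odot> p) \<cdot>\<^bsub>T\<^esub> cls (m \<odot> \<one>\<^bsub>B\<^esub> (Dom B p))) \<cdot>\<^bsub>T\<^esub> cls (Gen (ZR (Dom B p)))"
    using assms by simp
  also have "cls (r \<odot> p) \<cdot>\<^bsub>T\<^esub> cls (m \<odot> \<one>\<^bsub>B\<^esub> (Dom B p)) =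
      cls ((r \<cdot>\<^bsub>A\<^esub> m) \<odot> \<one>\<^bsub>B\<^esub> (Cod B p)) \<cdot>\<^bsub>T\<^esub> cls (\<one>\<^bsub>A\<^esub> \<zero>\<^bsub>A\<^esub> \<odot> p)"
    using assms by (simp add: cls_dot_Cmp)
  finally show ?thesis using assms by (simp add: ZR_natural)
qed

end

context symmetric_monoidal_functor
begin

lemma inverse_pair_Mul:
  "\<lbrakk>x \<in> Ob A; y \<in> Ob A\<rbrakk> \<Longrightarrow> inverse_pair B (Mul F (x, y)) (inv_ar B (Mul F (x, y)))"
  by (simp add: Mul_iso B.inverse_pair_inv_ar)

lemma inverse_pair_Unt: "inverse_pair B (Unt F) (inv_ar B (Unt F))"
  by (simp add: Unt_iso B.inverse_pair_inv_ar)

lemma inv_ar_simps [simp]: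
  "\<lbrakk>x \<in> Ob A; y \<in> Ob A\<rbrakk> \<Longrightarrow> inv_ar B (Mul F (x, y)) \<in> Ar B"
  "\<lbrakk>x \<in> Ob A; y \<in> Ob A\<rbrakk> \<Longrightarrow> Dom B (inv_ar B (Mul F (x, y))) = On_ob F (x \<oplus>\<^bsub>A\<^esub> y)"
  "\<lbrakk>x \<in> Ob A; y \<in> Ob A\<rbrakk> \<Longrightarrow> Cod B (inv_ar B (Mul F (x, y))) = On_ob F x \<oplus>\<^bsub>B\<^esub> On_ob F y"
  "inv_ar B (Unt F) \<in> Ar B" "Dom B (inv_ar B (Unt F)) = On_ob F \<zero>\<^bsub>A\<^esub>"
  "Cod B (inv_ar B (Unt F)) = \<zero>\<^bsub>B\<^esub>"
  using B.inverse_pairD[OF inverse_pair_Mul[of x y]] B.inverse_pairD[OF inverse_pair_Unt] by simp_all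

end

section \<open>The tensor product of symmetric monoidal functors\<close>

locale tensor_functors =
  F: symmetric_monoidal_functor A A' F + G: symmetric_monoidal_functor B B' G
  for A :: "('a, 'm) permcat" and A' :: "('c, 'k) permcat"
    and B :: "('b, 'n) permcat" and B' :: "('d, 'l) permcat" and F G
begin

sublocale S: tensor_pair A B ..
sublocale T: tensor_pair A' B' ..

abbreviation "P \<equiv> A' \<otimes>\<^sub>0 B'"
abbreviation "h \<equiv> map (map_prod (On_ob F) (On_ob G))"
abbreviation "wm \<equiv> word_map F G"
abbreviation "E w \<equiv> T.cls (wm w)"

lemma h_obs [simp]: "x \<in> S.obs \<Longrightarrow> h x \<in> T.obs"
  by (induction x) auto

lemma gen_map_wf:
  "gen_ok A B i \<Longrightarrow> T.wfw (gen_map F G i) \<and> T.dm (gen_map F G i) = h (gen_dom A B i) \<and>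
    T.cd (gen_map F G i) = h (gen_cod A B i)"
  by (cases i) (simp_all add: F.Trg G.Trg)

lemma gen_map_inv_wf:
  "gen_ok A B i \<Longrightarrow> T.wfw (gen_map_inv F G i) \<and> T.dm (gen_map_inv F G i) = h (gen_cod A B i) \<and>
    T.cd (gen_map_inv F G i) = h (gen_dom A B i)"
  by (cases i) (simp_all add: F.Trg G.Trg)

lemma wm_wf [simp]:
  assumes "S.wfw w"
  shows "T.wfw (wm w)" "T.dm (wm w) = h (S.dm w)" "T.cd (wm w) = h (S.cd w)"
proof -
  have "T.wfw (wm w) \<and> T.dm (wm w) = h (S.dm w) \<and> T.cd (wm w) = h (S.cd w)"
    using assms
  proof (induction w)
    case (Base fs)
    then show ?case by (induction fs) auto
  qed (auto simp: gen_map_wf gen_map_inv_wf)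
  then show "T.wfw (wm w)" "T.dm (wm w) = h (S.dm w)" "T.cd (wm w) = h (S.cd w)" by auto
qed

lemma E_Then: "S.wfw (w \<bullet> v) \<Longrightarrow> E (w \<bullet> v) = E w \<cdot>\<^bsub>P\<^esub> E v"
  by (simp add: T.cls_Then)

lemma E_Sum: "S.wfw w \<Longrightarrow> S.wfw v \<Longrightarrow> E (w \<uplus> v) = E w \<boxplus>\<^bsub>P\<^esub> E v"
  by (simp add: T.cls_Sum)

lemma wm_idw [simp]:
  assumes "x \<in> S.obs" shows "wm (S.idw x) = T.idw (h x)"
  using assms unfolding id_word_def by (induction x) auto

text \<open>This is an equality of words, not only of classes: \<open>symm_word\<close> is built
  from \<open>BB\<close> and identities, and \<open>BB\<close> goes to \<open>BB\<close> without a
  constraint. The symmetry relations thus become those of the target.\<close>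

lemma wm_symw [simp]:
  assumes "x \<in> S.obs" "y \<in> S.obs" shows "wm (S.symw x y) = T.symw (h x) (h y)"
proof -
  have 1: "wm (symm_word1 A B p y) = symm_word1 A' B' (map_prod (On_ob F) (On_ob G) p) (h y)"
    if "fst p \<in> Ob A" "snd p \<in> Ob B" for p
    using assms(2) that by (induction y) auto
  show ?thesis using assms(1) by (induction x) (use assms(2) 1 in auto)
qed

lemma E_Gen:
  "\<lbrakk>a \<in> Ob A; b \<in> Ob B; b' \<in> Ob B\<rbrakk> \<Longrightarrow> E (Gen (DL a b b')) =
    T.cls (\<one>\<^bsub>A'\<^esub> (On_ob F a) \<odot> Mul G (b, b')) \<cdot>\<^bsub>P\<^esub>
    T.cls (Gen (DL (On_ob F a) (On_ob G b) (On_ob G b')))"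
  "\<lbrakk>b \<in> Ob B; a \<in> Ob A; a' \<in> Ob A\<rbrakk> \<Longrightarrow> E (Gen (DR b a a')) =
    T.cls (Mul F (a, a') \<odot> \<one>\<^bsub>B'\<^esub> (On_ob G b)) \<cdot>\<^bsub>P\<^esub>
    T.cls (Gen (DR (On_ob G b) (On_ob F a) (On_ob F a')))"
  "E (Gen (BB a b a' b')) = T.cls (Gen (BB (On_ob F a) (On_ob G b) (On_ob F a') (On_ob G b')))"
  "a \<in> Ob A \<Longrightarrow> E (Gen (ZL a)) =
    T.cls (\<one>\<^bsub>A'\<^esub> (On_ob F a) \<odot> Unt G) \<cdot>\<^bsub>P\<^esub> T.cls (Gen (ZL (On_ob F a)))"
  "b \<in> Ob B \<Longrightarrow> E (Gen (ZR b)) =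
    T.cls (Unt F \<odot> \<one>\<^bsub>B'\<^esub> (On_ob G b)) \<cdot>\<^bsub>P\<^esub> T.cls (Gen (ZR (On_ob G b)))"
  by (simp_all add: T.cls_Then F.Trg G.Trg)

text \<open>\<open>gen_map_inv\<close> reverses the composite in \<open>gen_map\<close> and inverts
  each factor: the generator by its formal inverse, the constraint by \<open>inv_ar\<close>.\<close>

lemma inverse_pair_E:
  assumes "gen_ok A B i" shows "inverse_pair P (E (Gen i)) (E (GenInv i))"
proof (cases i)
  case (DL a b b')
  then show ?thesis using assms
    by (auto simp: F.Trg G.Trg T.cls_Then intro!: T.T.inverse_pair_Cmp T.inverse_pair_Gen
      T.inverse_pair_dot G.inverse_pair_Mul)
next
  case (DR b a a')
  then show ?thesis using assms
    by (auto simp: F.Trg G.Trg T.cls_Then intro!: T.T.inverse_pair_Cmp T.inverse_pair_Gen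
      T.inverse_pair_dot F.inverse_pair_Mul)
next
  case (BB a b a' b')
  then show ?thesis using assms by (auto intro!: T.inverse_pair_Gen)
next
  case (ZL a)
  then show ?thesis using assms
    by (auto simp: F.Trg G.Trg T.cls_Then intro!: T.T.inverse_pair_Cmp T.inverse_pair_Gen
      T.inverse_pair_dot G.inverse_pair_Unt)
next
  case (ZR b)
  then show ?thesis using assms
    by (auto simp: F.Trg G.Trg T.cls_Then intro!: T.T.inverse_pair_Cmp T.inverse_pair_Gen
      T.inverse_pair_dot F.inverse_pair_Unt)
qed

lemma E_dot [simp]: "E (f \<odot> g) = T.cls (On_ar F f \<odot> On_ar G g)"
  by simp

lemma E_Base_Then:
  assumes "S.wfw (Base fs' \<bullet> Base fs)"
  shows "E (Base fs' \<bullet> Base fs) = E (Base (map2 (\<lambda>(f', g') (f, g). (f' \<cdot>\<^bsub>A\<^esub> f, g' \<cdot>\<^bsub>B\<^esub> g)) fs' fs))"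
proof -
  have "length fs' = length fs" using assms by (auto dest: map_eq_imp_length_eq)
  then have "map (map_prod (On_ar F) (On_ar G)) (map2 (\<lambda>(f', g') (f, g). (f' \<cdot>\<^bsub>A\<^esub> f, g' \<cdot>\<^bsub>B\<^esub> g)) fs' fs) =
      map2 (\<lambda>(f', g') (f, g). (f' \<cdot>\<^bsub>A'\<^esub> f, g' \<cdot>\<^bsub>B'\<^esub> g))
        (map (map_prod (On_ar F) (On_ar G)) fs') (map (map_prod (On_ar F) (On_ar G)) fs)"
    using assms by (induction fs' fs rule: list_induct2) (auto simp: F.On_Cmp_ar G.On_Cmp_ar)
  then show ?thesis
    using T.cls_eqI[OF word_eq.Base_Then, of "map (map_prod (On_ar F) (On_ar G)) fs'"
      "map (map_prod (On_ar F) (On_ar G)) fs"] wm_wf(1)[OF assms] by simp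
qed

section \<open>Images of the naturality of \<delta> and of the mixed relations\<close>

lemma E_DL_natural:
  assumes "f \<in> Ar A" "g \<in> Ar B" "g' \<in> Ar B"
  shows "E (Gen (DL (Cod A f) (Cod B g) (Cod B g'))) \<cdot>\<^bsub>P\<^esub> (E (f \<odot> g) \<boxplus>\<^bsub>P\<^esub> E (f \<odot> g')) =
    E (f \<odot> (g \<boxplus>\<^bsub>B\<^esub> g')) \<cdot>\<^bsub>P\<^esub> E (Gen (DL (Dom A f) (Dom B g) (Dom B g')))"
  using T.DL_square[of "On_ar F f" "On_ar G g" "On_ar G g'" "On_ar G (g \<boxplus>\<^bsub>B\<^esub> g')"
      "Mul G (Dom B g, Dom B g')" "Mul G (Cod B g, Cod B g')"] assms
  by (simp add: E_Gen G.Mul_natural_ar del: word_map.simps(2) T.T.Cmp_assoc_ar)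

lemma E_DR_natural:
  assumes "g \<in> Ar B" "f \<in> Ar A" "f' \<in> Ar A"
  shows "E (Gen (DR (Cod B g) (Cod A f) (Cod A f'))) \<cdot>\<^bsub>P\<^esub> (E (f \<odot> g) \<boxplus>\<^bsub>P\<^esub> E (f' \<odot> g)) =
    E ((f \<boxplus>\<^bsub>A\<^esub> f') \<odot> g) \<cdot>\<^bsub>P\<^esub> E (Gen (DR (Dom B g) (Dom A f) (Dom A f')))"
  using T.DR_square[of "On_ar G g" "On_ar F f" "On_ar F f'" "On_ar F (f \<boxplus>\<^bsub>A\<^esub> f')"
      "Mul F (Dom A f, Dom A f')" "Mul F (Cod A f, Cod A f')"] assms
  by (simp add: E_Gen F.Mul_natural_ar del: word_map.simps(2) T.T.Cmp_assoc_ar)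

text \<open>Sliding \<open>Mul F\<close> past the left distributor and \<open>Mul G\<close> past the
  right one brings both sides to the form \<open>?m \<odot> ?n\<close> after a composite of
  generators. What remains is the same relation in the target.\<close>

lemma E_DL_DR:
  assumes [simp]: "a \<in> Ob A" "a' \<in> Ob A" "b \<in> Ob B" "b' \<in> Ob B"
  shows "E (Gen (DL (a \<oplus>\<^bsub>A\<^esub> a') b b')) \<cdot>\<^bsub>P\<^esub> (E (Gen (DR b a a')) \<boxplus>\<^bsub>P\<^esub> E (Gen (DR b' a a'))) =
    E (Gen (DR (b \<oplus>\<^bsub>B\<^esub> b') a a')) \<cdot>\<^bsub>P\<^esub> ((E (Gen (DL a b b')) \<boxplus>\<^bsub>P\<^esub> E (Gen (DL a' b b'))) \<cdot>\<^bsub>P\<^esub>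
      (E (S.idw [(a, b)]) \<boxplus>\<^bsub>P\<^esub> E (Gen (BB a' b a b')) \<boxplus>\<^bsub>P\<^esub> E (S.idw [(a', b')])))"
proof -
  let ?a = "On_ob F a" and ?a' = "On_ob F a'" and ?b = "On_ob G b" and ?b' = "On_ob G b'"
  let ?m = "Mul F (a, a')" and ?n = "Mul G (b, b')"
  let ?D = "T.cls (Gen (DL (?a \<oplus>\<^bsub>A'\<^esub> ?a') ?b ?b'))"
    and ?R = "T.cls (Gen (DR ?b ?a ?a')) \<boxplus>\<^bsub>P\<^esub> T.cls (Gen (DR ?b' ?a ?a'))"
    and ?D' = "T.cls (Gen (DR (?b \<oplus>\<^bsub>B'\<^esub> ?b') ?a ?a'))"
    and ?L = "T.cls (Gen (DL ?a ?b ?b')) \<boxplus>\<^bsub>P\<^esub> T.cls (Gen (DL ?a' ?b ?b'))"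
    and ?\<beta> = "\<one>\<^bsub>P\<^esub> [(?a, ?b)] \<boxplus>\<^bsub>P\<^esub> T.cls (Gen (BB ?a' ?b ?a ?b')) \<boxplus>\<^bsub>P\<^esub> \<one>\<^bsub>P\<^esub> [(?a', ?b')]"
  \<comment> \<open>A degenerate square: with identities for \<open>q\<close>, \<open>q'\<close> and
    \<open>m\<close>, the constraints of the two functors meet in the single arrow
    \<open>?m \<odot> ?n\<close>. The fact \<open>r\<close> does the same on the other side.\<close>
  have l: "(T.cls (\<one>\<^bsub>A'\<^esub> (On_ob F (a \<oplus>\<^bsub>A\<^esub> a')) \<odot> ?n) \<cdot>\<^bsub>P\<^esub> T.cls (Gen (DL (On_ob F (a \<oplus>\<^bsub>A\<^esub> a')) ?b ?b'))) \<cdot>\<^bsub>P\<^esub>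
        (T.cls (?m \<odot> \<one>\<^bsub>B'\<^esub> ?b) \<boxplus>\<^bsub>P\<^esub> T.cls (?m \<odot> \<one>\<^bsub>B'\<^esub> ?b')) =
      T.cls (?m \<odot> ?n) \<cdot>\<^bsub>P\<^esub> ?D"
    using T.DL_square[of ?m "\<one>\<^bsub>B'\<^esub> ?b" "\<one>\<^bsub>B'\<^esub> ?b'" ?n "\<one>\<^bsub>B'\<^esub> (?b \<oplus>\<^bsub>B'\<^esub> ?b')" ?n]
    by (simp add: T.cls_dot_id del: T.T.Cmp_assoc_ar)
  have r: "(T.cls (?m \<odot> \<one>\<^bsub>B'\<^esub> (On_ob G (b \<oplus>\<^bsub>B\<^esub> b'))) \<cdot>\<^bsub>P\<^esub> T.cls (Gen (DR (On_ob G (b \<oplus>\<^bsub>B\<^esub> b')) ?a ?a'))) \<cdot>\<^bsub>P\<^esub>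
        (T.cls (\<one>\<^bsub>A'\<^esub> ?a \<odot> ?n) \<boxplus>\<^bsub>P\<^esub> T.cls (\<one>\<^bsub>A'\<^esub> ?a' \<odot> ?n)) =
      T.cls (?m \<odot> ?n) \<cdot>\<^bsub>P\<^esub> ?D'"
    using T.DR_square[of ?n "\<one>\<^bsub>A'\<^esub> ?a" "\<one>\<^bsub>A'\<^esub> ?a'" ?m "\<one>\<^bsub>A'\<^esub> (?a \<oplus>\<^bsub>A'\<^esub> ?a')" ?m]
    by (simp add: T.cls_dot_id del: T.T.Cmp_assoc_ar)
  have "E (Gen (DL (a \<oplus>\<^bsub>A\<^esub> a') b b')) \<cdot>\<^bsub>P\<^esub> (E (Gen (DR b a a')) \<boxplus>\<^bsub>P\<^esub> E (Gen (DR b' a a'))) =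
      ((T.cls (\<one>\<^bsub>A'\<^esub> (On_ob F (a \<oplus>\<^bsub>A\<^esub> a')) \<odot> ?n) \<cdot>\<^bsub>P\<^esub> T.cls (Gen (DL (On_ob F (a \<oplus>\<^bsub>A\<^esub> a')) ?b ?b'))) \<cdot>\<^bsub>P\<^esub>
        (T.cls (?m \<odot> \<one>\<^bsub>B'\<^esub> ?b) \<boxplus>\<^bsub>P\<^esub> T.cls (?m \<odot> \<one>\<^bsub>B'\<^esub> ?b'))) \<cdot>\<^bsub>P\<^esub> ?R"
    by (simp add: E_Gen T.T.Plus_Cmp_ar del: word_map.simps(2))
  also have "\<dots> = T.cls (?m \<odot> ?n) \<cdot>\<^bsub>P\<^esub> (?D \<cdot>\<^bsub>P\<^esub> ?R)"
    unfolding l by simp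
  \<comment> \<open>The relation of the target, at the images of the four objects.\<close>
  also have "\<dots> = T.cls (?m \<odot> ?n) \<cdot>\<^bsub>P\<^esub> (?D' \<cdot>\<^bsub>P\<^esub> (?L \<cdot>\<^bsub>P\<^esub> ?\<beta>))"
    by (simp only: T.DL_DR F.On_simps(1) G.On_simps(1) assms)
  also have "\<dots> = (T.cls (?m \<odot> ?n) \<cdot>\<^bsub>P\<^esub> ?D') \<cdot>\<^bsub>P\<^esub> (?L \<cdot>\<^bsub>P\<^esub> ?\<beta>)"
    by simp
  also have "\<dots> = (T.cls (?m \<odot> \<one>\<^bsub>B'\<^esub> (On_ob G (b \<oplus>\<^bsub>B\<^esub> b'))) \<cdot>\<^bsub>P\<^esub> T.cls (Gen (DR (On_ob G (b \<oplus>\<^bsub>B\<^esub> b')) ?a ?a'))) \<cdot>\<^bsub>P\<^esub>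
        (((T.cls (\<one>\<^bsub>A'\<^esub> ?a \<odot> ?n) \<boxplus>\<^bsub>P\<^esub> T.cls (\<one>\<^bsub>A'\<^esub> ?a' \<odot> ?n)) \<cdot>\<^bsub>P\<^esub> ?L) \<cdot>\<^bsub>P\<^esub> ?\<beta>)"
    unfolding r[symmetric] by simp
  also have "\<dots> = E (Gen (DR (b \<oplus>\<^bsub>B\<^esub> b') a a')) \<cdot>\<^bsub>P\<^esub> ((E (Gen (DL a b b')) \<boxplus>\<^bsub>P\<^esub> E (Gen (DL a' b b'))) \<cdot>\<^bsub>P\<^esub>
      (E (S.idw [(a, b)]) \<boxplus>\<^bsub>P\<^esub> E (Gen (BB a' b a b')) \<boxplus>\<^bsub>P\<^esub> E (S.idw [(a', b')])))"
    by (simp add: E_Gen T.T.Plus_Cmp_ar del: word_map.simps(2))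
  finally show ?thesis .
qed

text \<open>Both sides equal \<open>Unt F \<odot> Unt G\<close> after the common arrow \<zeta> at
  the two zero objects of the target factors.\<close>

lemma E_ZL_ZR: "E (Gen (ZL \<zero>\<^bsub>A\<^esub>)) = E (Gen (ZR \<zero>\<^bsub>B\<^esub>))"
proof -
  have "E (Gen (ZL \<zero>\<^bsub>A\<^esub>)) = T.cls (Unt F \<odot> Unt G) \<cdot>\<^bsub>P\<^esub> T.cls (Gen (ZL \<zero>\<^bsub>A'\<^esub>))"
    using T.ZL_square[of "Unt F" "Unt G" "\<one>\<^bsub>B'\<^esub> \<zero>\<^bsub>B'\<^esub>"]
    by (simp add: E_Gen T.cls_dot_id del: word_map.simps(2))
  also have "\<dots> = E (Gen (ZR \<zero>\<^bsub>B\<^esub>))"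
    using T.ZR_square[of "Unt G" "Unt F" "\<one>\<^bsub>A'\<^esub> \<zero>\<^bsub>A'\<^esub>"]
    by (simp add: E_Gen T.cls_dot_id T.ZL_ZR del: word_map.simps(2))
  finally show ?thesis .
qed

text \<open>\<open>Unt G\<close> slides past \<delta>, the relation of the target joins the two
  arrows \<zeta>, and \<open>Mul F\<close> then slides past the result.\<close>

lemma E_DR_ZL:
  assumes [simp]: "a \<in> Ob A" "a' \<in> Ob A"
  shows "E (Gen (DR \<zero>\<^bsub>B\<^esub> a a')) \<cdot>\<^bsub>P\<^esub> (E (Gen (ZL a)) \<boxplus>\<^bsub>P\<^esub> E (Gen (ZL a'))) = E (Gen (ZL (a \<oplus>\<^bsub>A\<^esub> a')))"
proof -
  let ?a = "On_ob F a" and ?a' = "On_ob F a'" and ?m = "Mul F (a, a')"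
  have r: "(T.cls (?m \<odot> \<one>\<^bsub>B'\<^esub> (On_ob G \<zero>\<^bsub>B\<^esub>)) \<cdot>\<^bsub>P\<^esub> T.cls (Gen (DR (On_ob G \<zero>\<^bsub>B\<^esub>) ?a ?a'))) \<cdot>\<^bsub>P\<^esub>
        (T.cls (\<one>\<^bsub>A'\<^esub> ?a \<odot> Unt G) \<boxplus>\<^bsub>P\<^esub> T.cls (\<one>\<^bsub>A'\<^esub> ?a' \<odot> Unt G)) =
      T.cls (?m \<odot> Unt G) \<cdot>\<^bsub>P\<^esub> T.cls (Gen (DR \<zero>\<^bsub>B'\<^esub> ?a ?a'))"
    using T.DR_square[of "Unt G" "\<one>\<^bsub>A'\<^esub> ?a" "\<one>\<^bsub>A'\<^esub> ?a'" ?m "\<one>\<^bsub>A'\<^esub> (?a \<oplus>\<^bsub>A'\<^esub> ?a')" ?m]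
    by (simp add: T.cls_dot_id del: T.T.Cmp_assoc_ar)
  have "E (Gen (DR \<zero>\<^bsub>B\<^esub> a a')) \<cdot>\<^bsub>P\<^esub> (E (Gen (ZL a)) \<boxplus>\<^bsub>P\<^esub> E (Gen (ZL a'))) =
      ((T.cls (?m \<odot> \<one>\<^bsub>B'\<^esub> (On_ob G \<zero>\<^bsub>B\<^esub>)) \<cdot>\<^bsub>P\<^esub> T.cls (Gen (DR (On_ob G \<zero>\<^bsub>B\<^esub>) ?a ?a'))) \<cdot>\<^bsub>P\<^esub>
        (T.cls (\<one>\<^bsub>A'\<^esub> ?a \<odot> Unt G) \<boxplus>\<^bsub>P\<^esub> T.cls (\<one>\<^bsub>A'\<^esub> ?a' \<odot> Unt G))) \<cdot>\<^bsub>P\<^esub>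
      (T.cls (Gen (ZL ?a)) \<boxplus>\<^bsub>P\<^esub> T.cls (Gen (ZL ?a')))"
    by (simp add: E_Gen T.T.Plus_Cmp_ar del: word_map.simps(2))
  also have "\<dots> = T.cls (?m \<odot> Unt G) \<cdot>\<^bsub>P\<^esub> T.cls (Gen (ZL (?a \<oplus>\<^bsub>A'\<^esub> ?a')))"
    unfolding r by (simp add: T.DR_ZL)
  also have "\<dots> = E (Gen (ZL (a \<oplus>\<^bsub>A\<^esub> a')))"
    using T.ZL_square[of ?m "Unt G" "\<one>\<^bsub>B'\<^esub> \<zero>\<^bsub>B'\<^esub>"]
    by (simp add: E_Gen T.cls_dot_id del: word_map.simps(2))
  finally show ?thesis .
qed

lemma E_DL_ZR:
  assumes [simp]: "b \<in> Ob B" "b' \<in> Ob B"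
  shows "E (Gen (DL \<zero>\<^bsub>A\<^esub> b b')) \<cdot>\<^bsub>P\<^esub> (E (Gen (ZR b)) \<boxplus>\<^bsub>P\<^esub> E (Gen (ZR b'))) = E (Gen (ZR (b \<oplus>\<^bsub>B\<^esub> b')))"
proof -
  let ?b = "On_ob G b" and ?b' = "On_ob G b'" and ?m = "Mul G (b, b')"
  have l: "(T.cls (\<one>\<^bsub>A'\<^esub> (On_ob F \<zero>\<^bsub>A\<^esub>) \<odot> ?m) \<cdot>\<^bsub>P\<^esub> T.cls (Gen (DL (On_ob F \<zero>\<^bsub>A\<^esub>) ?b ?b'))) \<cdot>\<^bsub>P\<^esub>
        (T.cls (Unt F \<odot> \<one>\<^bsub>B'\<^esub> ?b) \<boxplus>\<^bsub>P\<^esub> T.cls (Unt F \<odot> \<one>\<^bsub>B'\<^esub> ?b')) =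
      T.cls (Unt F \<odot> ?m) \<cdot>\<^bsub>P\<^esub> T.cls (Gen (DL \<zero>\<^bsub>A'\<^esub> ?b ?b'))"
    using T.DL_square[of "Unt F" "\<one>\<^bsub>B'\<^esub> ?b" "\<one>\<^bsub>B'\<^esub> ?b'" ?m "\<one>\<^bsub>B'\<^esub> (?b \<oplus>\<^bsub>B'\<^esub> ?b')" ?m]
    by (simp add: T.cls_dot_id del: T.T.Cmp_assoc_ar)
  have "E (Gen (DL \<zero>\<^bsub>A\<^esub> b b')) \<cdot>\<^bsub>P\<^esub> (E (Gen (ZR b)) \<boxplus>\<^bsub>P\<^esub> E (Gen (ZR b'))) =
      ((T.cls (\<one>\<^bsub>A'\<^esub> (On_ob F \<zero>\<^bsub>A\<^esub>) \<odot> ?m) \<cdot>\<^bsub>P\<^esub> T.cls (Gen (DL (On_ob F \<zero>\<^bsub>A\<^esub>) ?b ?b'))) \<cdot>\<^bsub>P\<^esub>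
        (T.cls (Unt F \<odot> \<one>\<^bsub>B'\<^esub> ?b) \<boxplus>\<^bsub>P\<^esub> T.cls (Unt F \<odot> \<one>\<^bsub>B'\<^esub> ?b'))) \<cdot>\<^bsub>P\<^esub>
      (T.cls (Gen (ZR ?b)) \<boxplus>\<^bsub>P\<^esub> T.cls (Gen (ZR ?b')))"
    by (simp add: E_Gen T.T.Plus_Cmp_ar del: word_map.simps(2))
  also have "\<dots> = T.cls (Unt F \<odot> ?m) \<cdot>\<^bsub>P\<^esub> T.cls (Gen (ZR (?b \<oplus>\<^bsub>B'\<^esub> ?b')))"
    unfolding l by (simp add: T.DL_ZR)
  also have "\<dots> = E (Gen (ZR (b \<oplus>\<^bsub>B\<^esub> b')))"
    using T.ZR_square[of ?m "Unt F" "\<one>\<^bsub>A'\<^esub> \<zero>\<^bsub>A'\<^esub>"]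
    by (simp add: E_Gen T.cls_dot_id del: word_map.simps(2))
  finally show ?thesis .
qed

end

section \<open>The assignment on generators respects the relations\<close>

context tensor_functors
begin

text \<open>\<open>Mul\<close> and \<open>Unt\<close> of this composite unfold to the right-hand
  sides of \<open>E_Gen\<close>, so its coherence laws become the equations required of the images
  of \<open>DL\<close> and \<open>ZL\<close>.\<close>

lemma left_comp:
  assumes [simp]: "a \<in> Ob A"
  shows "smfun_pair B B' P G (T.left_smfun (On_ob F a))"
  using T.left_smfun[of "On_ob F a"] G.symmetric_monoidal_functor_axioms
  by (intro smfun_pair.intro) simp_all

lemma right_comp:
  assumes [simp]: "b \<in> Ob B"
  shows "smfun_pair A A' P F (T.right_smfun (On_ob G b))"
  using T.right_smfun[of "On_ob G b"] F.symmetric_monoidal_functor_axioms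
  by (intro smfun_pair.intro) simp_all

text \<open>The universal property of generators and relations, in the instance at hand. Structural
  rules hold because the target is a permutative category.\<close>

lemma word_eq_E: "word_eq A B w v \<Longrightarrow> E w = E v"
proof (induction rule: word_eq.induct)
  case (trans u v w)
  then show ?case by simp
next
  case (cong_Then w w' v v')
  then show ?case using S.word_eq_wf[of w w'] S.word_eq_wf[of v v']
    by (simp add: E_Then del: word_map.simps)
next
  case (cong_Sum w w' v v')
  then show ?case using S.word_eq_wf[of w w'] S.word_eq_wf[of v v']
    by (simp add: E_Sum del: word_map.simps)
next
  case (Then_assoc u v w)
  then show ?case by (simp add: T.cls_Then)
next
  case (Then_id_right w)
  then show ?case by (simp add: T.cls_Then)
next
  case (Then_id_left w)
  then show ?case by (simp add: T.cls_Then)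
next
  case (Sum_assoc u v w)
  then show ?case by (simp add: T.cls_Sum)
next
  case (Sum_id_right w)
  then show ?case by (simp add: T.cls_Sum)
next
  case (Sum_id_left w)
  then show ?case by (simp add: T.cls_Sum)
next
  case (interchange w' w v' v)
  then show ?case by (simp add: T.cls_Sum T.cls_Then T.T.Plus_Cmp_ar)
next
  case (Base_Then fs' fs)
  then show ?case by (rule E_Base_Then)
next
  case (Base_Sum fs gs)
  then show ?case
    using wm_wf(1)[of "Base fs"] wm_wf(1)[of "Base gs"] by (simp add: T.cls_Sum T.cls_Base_append)
next
  case (GenInv_Gen i)
  then show ?case
    using T.T.inverse_pairD(5)[OF inverse_pair_E[of i]] S.gen_ob[of i] wm_wf[of "Gen i"]
    by (simp add: T.cls_Then del: word_map.simps(2,3))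
next
  case (Gen_GenInv i)
  then show ?case
    using T.T.inverse_pairD(6)[OF inverse_pair_E[of i]] S.gen_ob[of i] wm_wf[of "Gen i"]
    by (simp add: T.cls_Then del: word_map.simps(2,3))
next
  case (DL_natural f a c g b d g' b' d')
  then show ?case
    using E_DL_natural[of f g g'] by (auto simp: E_Then E_Sum simp del: word_map.simps)
next
  case (DR_natural g b d f a c f' a' c')
  then show ?case
    using E_DR_natural[of g f f'] by (auto simp: E_Then E_Sum simp del: word_map.simps)
next
  case (BB_natural f a c g b d f' a' c' g' b' d')
  then show ?case
    using T.BB_natural[of "On_ar F f" "On_ar G g" "On_ar F f'" "On_ar G g'"]
    by (auto simp: T.cls_Then T.cls_Sum)
next
  \<comment> \<open>With an identity for \<open>r\<close>, \<open>Unt G\<close> stays in place while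
    \<open>On_ar F f\<close> passes \<zeta>.\<close>
  case (ZL_natural f a c)
  then show ?case
    using T.ZL_square[of "On_ar F f" "\<one>\<^bsub>B'\<^esub> (On_ob G \<zero>\<^bsub>B\<^esub>)" "Unt G"]
    by (auto simp: T.cls_Then E_Gen simp del: word_map.simps(2))
next
  case (ZR_natural g b d)
  then show ?case
    using T.ZR_square[of "On_ar G g" "\<one>\<^bsub>A'\<^esub> (On_ob F \<zero>\<^bsub>A\<^esub>)" "Unt F"]
    by (auto simp: T.cls_Then E_Gen simp del: word_map.simps(2))
next
  case (symm_natural w v)
  then show ?case
    using T.T.Symm_natural_ar[of "E w" "E v"] by (simp add: T.cls_Then T.cls_Sum)
next
  case (symm_symm x y)
  then show ?case using T.T.Symm_Symm[of "h x" "h y"] by (simp add: T.cls_Then)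
next
  case (symm_Sum x y z)
  then show ?case using T.T.Symm_Plus[of "h x" "h y" "h z"] by (simp add: T.cls_Then T.cls_Sum)
next
  case (DL_assoc a b b' b'')
  then interpret L: smfun_pair B B' P G "T.left_smfun (On_ob F a)" by (intro left_comp)
  show ?case using L.GF.Mul_assoc[of b b' b''] DL_assoc
    by (simp add: T.cls_Then T.cls_Sum E_Gen del: word_map.simps(2))
next
  case (DL_unit_right a b)
  then interpret L: smfun_pair B B' P G "T.left_smfun (On_ob F a)" by (intro left_comp)
  show ?case using L.GF.Mul_Unt_right[of b] DL_unit_right
    by (simp add: T.cls_Then T.cls_Sum E_Gen del: word_map.simps(2))
next
  case (DL_unit_left a b)
  then interpret L: smfun_pair B B' P G "T.left_smfun (On_ob F a)" by (intro left_comp)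
  show ?case using L.GF.Mul_Unt_left[of b] DL_unit_left
    by (simp add: T.cls_Then T.cls_Sum E_Gen del: word_map.simps(2))
next
  case (DL_symm a b b')
  then interpret L: smfun_pair B B' P G "T.left_smfun (On_ob F a)" by (intro left_comp)
  show ?case using L.GF.Mul_Symm[of b b'] DL_symm
    by (simp add: T.cls_Then E_Gen T.Symm_singletons del: word_map.simps(2))
next
  case (DR_assoc b a a' a'')
  then interpret R: smfun_pair A A' P F "T.right_smfun (On_ob G b)" by (intro right_comp)
  show ?case using R.GF.Mul_assoc[of a a' a''] DR_assoc
    by (simp add: T.cls_Then T.cls_Sum E_Gen del: word_map.simps(2))
next
  case (DR_unit_right b a)
  then interpret R: smfun_pair A A' P F "T.right_smfun (On_ob G b)" by (intro right_comp)
  show ?case using R.GF.Mul_Unt_right[of a] DR_unit_right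
    by (simp add: T.cls_Then T.cls_Sum E_Gen del: word_map.simps(2))
next
  case (DR_unit_left b a)
  then interpret R: smfun_pair A A' P F "T.right_smfun (On_ob G b)" by (intro right_comp)
  show ?case using R.GF.Mul_Unt_left[of a] DR_unit_left
    by (simp add: T.cls_Then T.cls_Sum E_Gen del: word_map.simps(2))
next
  case (DR_symm b a a')
  then interpret R: smfun_pair A A' P F "T.right_smfun (On_ob G b)" by (intro right_comp)
  show ?case using R.GF.Mul_Symm[of a a'] DR_symm
    by (simp add: T.cls_Then E_Gen T.Symm_singletons del: word_map.simps(2))
next
  case (DL_DR a a' b b')
  then show ?case using E_DL_DR[of a a' b b']
    by (simp add: E_Then E_Sum del: word_map.simps)
next
  case ZL_ZR
  show ?case by (rule E_ZL_ZR)
next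
  case (DR_ZL a a')
  then show ?case using E_DR_ZL[of a a'] by (simp add: E_Then E_Sum del: word_map.simps)
next
  case (DL_ZR b b')
  then show ?case using E_DL_ZR[of b b'] by (simp add: E_Then E_Sum del: word_map.simps)
qed simp_all

text \<open>The return from arrows to words: \<open>wm v\<close> lies in its own class, which is
  also the class of \<open>wm w\<close>.\<close>

lemma word_eq_wm: "word_eq A B w v \<Longrightarrow> word_eq A' B' (wm w) (wm v)"
  using word_eq_E[of w v] S.word_eq_wf[of w v] word_eq.refl[of A' B' "wm v"] wm_wf(1)[of v]
  by (simp flip: T.mem_cls)

lemma tensor_smfun_sel [simp]:
  "Src (F \<otimes>\<^sub>1 G) = A \<otimes>\<^sub>0 B" "Trg (F \<otimes>\<^sub>1 G) = P"
  "x \<in> S.obs \<Longrightarrow> On_ob (F \<otimes>\<^sub>1 G) x = h x"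
  "\<lbrakk>x \<in> S.obs; y \<in> S.obs\<rbrakk> \<Longrightarrow> Mul (F \<otimes>\<^sub>1 G) (x, y) = \<one>\<^bsub>P\<^esub> (h x @ h y)"
  "Unt (F \<otimes>\<^sub>1 G) = \<one>\<^bsub>P\<^esub> []"
  by (simp_all add: tensor_smfun_def Let_def F.Src F.Trg G.Src G.Trg)

text \<open>By \<open>word_eq_wm\<close> the images of all representatives are related to
  \<open>wm w\<close>, so \<open>Image_cls\<close> applies to their union.\<close>

lemma tensor_smfun_cls [simp]:
  assumes "S.wfw w" shows "On_ar (F \<otimes>\<^sub>1 G) (S.cls w) = E w"
proof -
  have "word_rel A' B' `` (wm ` S.cls w) = E w"
    by (rule T.Image_cls) (use word_eq.refl[OF assms] in \<open>auto simp: S.mem_cls intro: word_eq_wm\<close>)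
  then show ?thesis using assms by (simp add: tensor_smfun_def Let_def F.Src F.Trg G.Src G.Trg)
qed

text \<open>With identities as constraints, naturality of \<open>Mul\<close> is additivity
  \<open>E_Sum\<close>, the symmetry law is \<open>wm_symw\<close>, and the remaining coherence laws
  are identity laws.\<close>

lemma tensor_smfun: "symmetric_monoidal_functor (A \<otimes>\<^sub>0 B) P (F \<otimes>\<^sub>1 G)"
proof (rule symmetric_monoidal_functorI)
  show "permutative_category (A \<otimes>\<^sub>0 B)" "permutative_category P" ..
  show "On_ob (F \<otimes>\<^sub>1 G) \<in> extensional (Ob (A \<otimes>\<^sub>0 B))" "On_ar (F \<otimes>\<^sub>1 G) \<in> extensional (Ar (A \<otimes>\<^sub>0 B))"
    "Mul (F \<otimes>\<^sub>1 G) \<in> extensional (Ob (A \<otimes>\<^sub>0 B) \<times> Ob (A \<otimes>\<^sub>0 B))"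
    by (simp_all add: tensor_smfun_def Let_def F.Src G.Src)
next
  fix f assume "f \<in> Ar (A \<otimes>\<^sub>0 B)"
  then show "On_ar (F \<otimes>\<^sub>1 G) f \<in> Ar P"
    "Dom P (On_ar (F \<otimes>\<^sub>1 G) f) = On_ob (F \<otimes>\<^sub>1 G) (Dom (A \<otimes>\<^sub>0 B) f)"
    "Cod P (On_ar (F \<otimes>\<^sub>1 G) f) = On_ob (F \<otimes>\<^sub>1 G) (Cod (A \<otimes>\<^sub>0 B) f)"
    by (auto simp: S.Ar_T)
next
  fix x assume "x \<in> Ob (A \<otimes>\<^sub>0 B)"
  then show "On_ar (F \<otimes>\<^sub>1 G) (\<one>\<^bsub>A \<otimes>\<^sub>0 B\<^esub> x) = \<one>\<^bsub>P\<^esub> (On_ob (F \<otimes>\<^sub>1 G) x)"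
    using tensor_smfun_cls[of "S.idw x"] by simp
next
  fix f g assume "f \<in> Ar (A \<otimes>\<^sub>0 B)" "g \<in> Ar (A \<otimes>\<^sub>0 B)" "Cod (A \<otimes>\<^sub>0 B) f = Dom (A \<otimes>\<^sub>0 B) g"
  then obtain w v where "S.wfw w" "S.wfw v" "S.cd w = S.dm v" "f = S.cls w" "g = S.cls v"
    by (auto simp: S.Ar_T)
  then show "On_ar (F \<otimes>\<^sub>1 G) (g \<cdot>\<^bsub>A \<otimes>\<^sub>0 B\<^esub> f) = On_ar (F \<otimes>\<^sub>1 G) g \<cdot>\<^bsub>P\<^esub> On_ar (F \<otimes>\<^sub>1 G) f"
    by (simp add: S.Cmp_cls E_Then del: word_map.simps)
next
  fix f g assume "f \<in> Ar (A \<otimes>\<^sub>0 B)" "g \<in> Ar (A \<otimes>\<^sub>0 B)"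
  then obtain w v where "S.wfw w" "S.wfw v" "f = S.cls w" "g = S.cls v"
    by (auto simp: S.Ar_T)
  then show "On_ar (F \<otimes>\<^sub>1 G) (f \<boxplus>\<^bsub>A \<otimes>\<^sub>0 B\<^esub> g) \<cdot>\<^bsub>P\<^esub> Mul (F \<otimes>\<^sub>1 G) (Dom (A \<otimes>\<^sub>0 B) f, Dom (A \<otimes>\<^sub>0 B) g) =
      Mul (F \<otimes>\<^sub>1 G) (Cod (A \<otimes>\<^sub>0 B) f, Cod (A \<otimes>\<^sub>0 B) g) \<cdot>\<^bsub>P\<^esub> (On_ar (F \<otimes>\<^sub>1 G) f \<boxplus>\<^bsub>P\<^esub> On_ar (F \<otimes>\<^sub>1 G) g)"
    by (simp add: S.Plus_cls E_Sum del: word_map.simps)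
next
  fix x y assume "x \<in> Ob (A \<otimes>\<^sub>0 B)" "y \<in> Ob (A \<otimes>\<^sub>0 B)"
  then show "On_ar (F \<otimes>\<^sub>1 G) (\<beta>\<^bsub>A \<otimes>\<^sub>0 B\<^esub> x y) \<cdot>\<^bsub>P\<^esub> Mul (F \<otimes>\<^sub>1 G) (x, y) =
      Mul (F \<otimes>\<^sub>1 G) (y, x) \<cdot>\<^bsub>P\<^esub> \<beta>\<^bsub>P\<^esub> (On_ob (F \<otimes>\<^sub>1 G) x) (On_ob (F \<otimes>\<^sub>1 G) y)"
    using tensor_smfun_cls[of "S.symw x y"] by simp
qed (auto simp: is_iso_def intro!: exI T.T.inverse_pair_Idt)

sublocale FG: symmetric_monoidal_functor "A \<otimes>\<^sub>0 B" P "F \<otimes>\<^sub>1 G"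
  by (rule tensor_smfun)

end

text \<open>Strictness on arrows, without a detour through \<open>Mul\<close>. It evaluates a tensor
  product of functors on a component, which is a sum.\<close>

lemma (in tensor_functors) tensor_smfun_Plus:
  assumes "f \<in> Ar (A \<otimes>\<^sub>0 B)" "g \<in> Ar (A \<otimes>\<^sub>0 B)"
  shows "On_ar (F \<otimes>\<^sub>1 G) (f \<boxplus>\<^bsub>A \<otimes>\<^sub>0 B\<^esub> g) = On_ar (F \<otimes>\<^sub>1 G) f \<boxplus>\<^bsub>P\<^esub> On_ar (F \<otimes>\<^sub>1 G) g"
proof -
  obtain w v where "S.wfw w" "S.wfw v" "f = S.cls w" "g = S.cls v"
    using assms by (auto simp: S.Ar_T)
  then show ?thesis by (simp add: S.Plus_cls E_Sum del: word_map.simps)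
qed

section \<open>Identities and composites of 1-cells\<close>

text \<open>On words the identities do not induce the identity: \<delta> and \<zeta> acquire a dot
  of identity arrows. These dots vanish only in the quotient, which is why classes are
  compared.\<close>

lemma tensor_smfun_id:
  assumes "permutative_category A" "permutative_category B"
  shows "id_smfun A \<otimes>\<^sub>1 id_smfun B = id_smfun (A \<otimes>\<^sub>0 B)"
proof -
  interpret tensor_functors A A B B "id_smfun A" "id_smfun B"
    by (intro tensor_functors.intro symmetric_monoidal_functor_id assms)
  have h: "h x = x" if "x \<in> S.obs" for x
    using that by (induction x) auto
  have E: "E w = S.cls w" if "S.wfw w" for w
    using that
  proof (induction w)
    case (Base fs)
    then have "map (map_prod (On_ar (id_smfun A)) (On_ar (id_smfun B))) fs = fs"
      by (induction fs) auto
    then show ?case by simp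
  next
    case (Gen i)
    then show ?case by (cases i) (simp_all add: E_Gen S.cls_dot_id del: word_map.simps(2))
  next
    case (GenInv i)
    have "E (Gen i) = S.cls (Gen i)"
      using GenInv by (cases i) (simp_all add: E_Gen S.cls_dot_id del: word_map.simps(2))
    then show ?case
      using inverse_pair_E[of i] S.inverse_pair_Gen[of i] GenInv S.T.inverse_pair_unique by auto
  qed (simp_all add: E_Then E_Sum S.cls_Then S.cls_Sum del: word_map.simps)
  show ?thesis
    by (rule smfun_idI[OF tensor_smfun]) (auto simp: h E S.Ar_T)
qed

locale tensor_functors_pair =
  FG: tensor_functors A A' B B' F G + HK: tensor_functors A' A'' B' B'' H K
  for A :: "('a, 'm) permcat" and A' :: "('c, 'k) permcat" and A'' :: "('e, 'i) permcat"
    and B :: "('b, 'n) permcat" and B' :: "('d, 'l) permcat" and B'' :: "('f, 'j) permcat"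
    and F G H K
begin

sublocale L: smfun_pair A A' A'' F H ..
sublocale R: smfun_pair B B' B'' G K ..
sublocale C: tensor_functors A A'' B B'' "comp_smfun H F" "comp_smfun K G" ..
sublocale T: smfun_pair "A \<otimes>\<^sub>0 B" "A' \<otimes>\<^sub>0 B'" "A'' \<otimes>\<^sub>0 B''" "F \<otimes>\<^sub>1 G" "H \<otimes>\<^sub>1 K" ..

lemma h_comp: "x \<in> FG.S.obs \<Longrightarrow> HK.h (FG.h x) = C.h x"
  by (induction x) auto

text \<open>For \<open>DL\<close>, the image under both functors is \<delta>, then
  \<open>1.K_2\<close>, then \<open>1.K(G_2)\<close>. The two dots merge into the constraint of
  \<open>comp_smfun K G\<close>; the other generators with constraints are alike.\<close>

lemma E_comp_Gen:
  assumes "gen_ok A B i" shows "HK.E (FG.wm (Gen i)) = C.E (Gen i)"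
proof (cases i)
  case (DL a b b')
  then show ?thesis using assms
    \<comment> \<open>Nesting to the left makes the two dots adjacent, so that
      \<open>cls_dot_Cmp\<close> merges them.\<close>
    by (simp add: HK.T.cls_Then FG.F.Trg FG.G.Trg HK.F.Trg HK.G.Trg HK.T.cls_dot_Cmp
      flip: HK.T.T.Cmp_assoc_ar)
next
  case (DR b a a')
  then show ?thesis using assms
    by (simp add: HK.T.cls_Then FG.F.Trg FG.G.Trg HK.F.Trg HK.G.Trg HK.T.cls_dot_Cmp
      flip: HK.T.T.Cmp_assoc_ar)
next
  case (ZL a)
  then show ?thesis using assms
    by (simp add: HK.T.cls_Then FG.F.Trg FG.G.Trg HK.F.Trg HK.G.Trg HK.T.cls_dot_Cmp
      flip: HK.T.T.Cmp_assoc_ar)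
next
  case (ZR b)
  then show ?thesis using assms
    by (simp add: HK.T.cls_Then FG.F.Trg FG.G.Trg HK.F.Trg HK.G.Trg HK.T.cls_dot_Cmp
      flip: HK.T.T.Cmp_assoc_ar)
qed (use assms in simp)

lemma E_comp: "FG.S.wfw w \<Longrightarrow> HK.E (FG.wm w) = C.E w"
proof (induction w)
  case (Base fs)
  then have "map (map_prod (On_ar H) (On_ar K)) (map (map_prod (On_ar F) (On_ar G)) fs) =
      map (map_prod (On_ar (comp_smfun H F)) (On_ar (comp_smfun K G))) fs"
    by (induction fs) auto
  then show ?case by (simp only: word_map.simps)
next
  case (Gen i)
  then show ?case using E_comp_Gen by simp
next
  case (GenInv i)
  then have i: "gen_ok A B i" by simp
  \<comment> \<open>\<open>H \<otimes>\<^sub>1 K\<close> is already a functor and carries inverse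
    pairs along, so the inverse constraint of a composite never has to be computed.\<close>
  have "inverse_pair (A'' \<otimes>\<^sub>0 B'') (HK.E (FG.wm (Gen i))) (HK.E (FG.wm (GenInv i)))"
    using HK.FG.inverse_pair_On_ar[OF FG.inverse_pair_E[OF i]] i FG.wm_wf(1)[of "Gen i"]
      FG.wm_wf(1)[of "GenInv i"] HK.tensor_smfun_cls[of "FG.wm (Gen i)"]
      HK.tensor_smfun_cls[of "FG.wm (GenInv i)"] by (simp del: word_map.simps)
  then show ?case
    unfolding E_comp_Gen[OF i] using C.inverse_pair_E[OF i] by (rule HK.T.T.inverse_pair_unique)
next
  case (Then w v)
  then show ?case
    using HK.E_Then[of "FG.wm w" "FG.wm v"] C.E_Then[of w v] by simp
next
  case (Sum w v)
  then show ?case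
    using HK.E_Sum[of "FG.wm w" "FG.wm v"] C.E_Sum[of w v] by simp
qed

lemma tensor_smfun_comp: "comp_smfun H F \<otimes>\<^sub>1 comp_smfun K G = comp_smfun (H \<otimes>\<^sub>1 K) (F \<otimes>\<^sub>1 G)"
proof (rule smfun_eqI[OF C.tensor_smfun T.comp_smfun])
  fix x y assume "x \<in> Ob (A \<otimes>\<^sub>0 B)" "y \<in> Ob (A \<otimes>\<^sub>0 B)"
  then show "Mul (comp_smfun H F \<otimes>\<^sub>1 comp_smfun K G) (x, y) = Mul (comp_smfun (H \<otimes>\<^sub>1 K) (F \<otimes>\<^sub>1 G)) (x, y)"
    by (simp add: h_comp del: map_map)
qed (auto simp: h_comp E_comp FG.S.Ar_T simp del: map_map)

end

section \<open>The tensor product of monoidal transformations\<close>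

locale tensor_mtranses =
  \<phi>: monoidal_transformation A A' F F' \<phi> + \<psi>: monoidal_transformation B B' G G' \<psi>
  for A :: "('a, 'm) permcat" and A' :: "('c, 'k) permcat"
    and B :: "('b, 'n) permcat" and B' :: "('d, 'l) permcat" and F F' G G' \<phi> \<psi>
begin

sublocale S: tensor_functors A A' B B' F G ..
sublocale T: tensor_functors A A' B B' F' G' ..

abbreviation "t x \<equiv> S.T.cls (Base (map (map_prod (Component \<phi>) (Component \<psi>)) x))"

lemma Component_Ar: "x \<in> S.S.obs \<Longrightarrow>
  set (map (map_prod (Component \<phi>) (Component \<psi>)) x) \<subseteq> Ar A' \<times> Ar B'"
  by (induction x) auto

lemma t_Nil: "t [] = \<one>\<^bsub>S.P\<^esub> []"
  by (simp add: S.T.tensor_sel(4) id_word_def del: S.T.cls_idw_symw)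

lemma t_Cons:
  "\<lbrakk>a \<in> Ob A; b \<in> Ob B; x \<in> S.S.obs\<rbrakk> \<Longrightarrow>
    t ((a, b) # x) = S.T.cls (Component \<phi> a \<odot> Component \<psi> b) \<boxplus>\<^bsub>S.P\<^esub> t x"
  using S.T.cls_Base_Cons[of "Component \<phi> a" "Component \<psi> b"
    "map (map_prod (Component \<phi>) (Component \<psi>)) x"] Component_Ar[of x] by simp

lemma t_append:
  "\<lbrakk>x \<in> S.S.obs; y \<in> S.S.obs\<rbrakk> \<Longrightarrow> t (x @ y) = t x \<boxplus>\<^bsub>S.P\<^esub> t y"
  using Component_Ar[of x] Component_Ar[of y] by (simp add: S.T.cls_Base_append del: set_map)

lemma t_ar [simp]:
  assumes "x \<in> S.S.obs"
  shows "t x \<in> Ar S.P" "Dom S.P (t x) = S.h x" "Cod S.P (t x) = T.h x"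
proof -
  have "S.T.wfw (Base (map (map_prod (Component \<phi>) (Component \<psi>)) x)) \<and>
      S.T.dm (Base (map (map_prod (Component \<phi>) (Component \<psi>)) x)) = S.h x \<and>
      S.T.cd (Base (map (map_prod (Component \<phi>) (Component \<psi>)) x)) = T.h x"
    using assms by (induction x) auto
  then show "t x \<in> Ar S.P" "Dom S.P (t x) = S.h x" "Cod S.P (t x) = T.h x"
    by (simp_all del: wf_word.simps wdom.simps wcod.simps)
qed

text \<open>For \<delta> the square lemmas apply with \<open>m\<close> and \<open>m'\<close> the
  constraints of the source and the target functor; the square in the factor is monoidality of
  \<psi> or \<phi>. For \<zeta> its place is taken by \<open>Component_Unt\<close>, and for \<beta>
  naturality suffices.\<close>

lemma t_natural_Gen:
  assumes "gen_ok A B i"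
  shows "t (gen_cod A B i) \<cdot>\<^bsub>S.P\<^esub> S.E (Gen i) = T.E (Gen i) \<cdot>\<^bsub>S.P\<^esub> t (gen_dom A B i)"
proof (cases i)
  case (DL a b b')
  then show ?thesis
    using assms S.T.DL_square[of "Component \<phi> a" "Component \<psi> b" "Component \<psi> b'"
      "Component \<psi> (b \<oplus>\<^bsub>B\<^esub> b')" "Mul G (b, b')" "Mul G' (b, b')"]
    by (simp add: t_Cons t_Nil S.E_Gen T.E_Gen \<psi>.Component_Mul del: word_map.simps list.map S.T.T.Cmp_assoc_ar)
next
  case (DR b a a')
  then show ?thesis
    using assms S.T.DR_square[of "Component \<psi> b" "Component \<phi> a" "Component \<phi> a'"
      "Component \<phi> (a \<oplus>\<^bsub>A\<^esub> a')" "Mul F (a, a')" "Mul F' (a, a')"]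
    by (simp add: t_Cons t_Nil S.E_Gen T.E_Gen \<phi>.Component_Mul del: word_map.simps list.map S.T.T.Cmp_assoc_ar)
next
  case (BB a b a' b')
  then show ?thesis
    using assms S.T.BB_natural[of "Component \<phi> a" "Component \<psi> b" "Component \<phi> a'" "Component \<psi> b'"]
    by (simp add: t_Cons t_Nil S.E_Gen T.E_Gen del: word_map.simps list.map)
next
  case (ZL a)
  then show ?thesis
    using assms S.T.ZL_square[of "Component \<phi> a" "Component \<psi> \<zero>\<^bsub>B\<^esub>" "Unt G"]
    by (simp add: t_Nil[simplified] S.E_Gen T.E_Gen \<psi>.Component_Unt del: word_map.simps)
next
  case (ZR b)
  then show ?thesis
    using assms S.T.ZR_square[of "Component \<psi> b" "Component \<phi> \<zero>\<^bsub>A\<^esub>" "Unt F"]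
    by (simp add: t_Nil[simplified] S.E_Gen T.E_Gen \<phi>.Component_Unt del: word_map.simps)
qed

text \<open>Interchange splits the square into the first summand, where \<phi> and \<psi> are
  natural separately, and the remaining ones.\<close>

lemma t_natural_Base:
  "S.S.wfw (Base fs) \<Longrightarrow> t (S.S.cd (Base fs)) \<cdot>\<^bsub>S.P\<^esub> S.E (Base fs) = T.E (Base fs) \<cdot>\<^bsub>S.P\<^esub> t (S.S.dm (Base fs))"
proof (induction fs)
  case Nil
  then show ?case by simp
next
  case (Cons p fs)
  obtain f g where [simp]: "p = (f, g)" by (cases p)
  have ar: "f \<in> Ar A" "g \<in> Ar B" "S.S.wfw (Base fs)" using Cons.prems by auto
  let ?s = "S.T.cls (Component \<phi> (Dom A f) \<odot> Component \<psi> (Dom B g))"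
    and ?c = "S.T.cls (Component \<phi> (Cod A f) \<odot> Component \<psi> (Cod B g))"
  have E: "S.E (Base (p # fs)) = S.T.cls (On_ar F f \<odot> On_ar G g) \<boxplus>\<^bsub>S.P\<^esub> S.E (Base fs)"
    "T.E (Base (p # fs)) = S.T.cls (On_ar F' f \<odot> On_ar G' g) \<boxplus>\<^bsub>S.P\<^esub> T.E (Base fs)"
    using ar S.wm_wf(1)[OF ar(3)] T.wm_wf(1)[OF ar(3)]
      S.T.cls_Base_Cons[of "On_ar F f" "On_ar G g" "map (map_prod (On_ar F) (On_ar G)) fs"]
      S.T.cls_Base_Cons[of "On_ar F' f" "On_ar G' g" "map (map_prod (On_ar F') (On_ar G')) fs"]
    by simp_all
  have t: "t (S.S.cd (Base (p # fs))) = ?c \<boxplus>\<^bsub>S.P\<^esub> t (S.S.cd (Base fs))"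
    "t (S.S.dm (Base (p # fs))) = ?s \<boxplus>\<^bsub>S.P\<^esub> t (S.S.dm (Base fs))"
    using ar t_Cons[of "Cod A f" "Cod B g" "S.S.cd (Base fs)"]
      t_Cons[of "Dom A f" "Dom B g" "S.S.dm (Base fs)"] S.S.wf_ob[OF ar(3)] by simp_all
  have p: "?c \<cdot>\<^bsub>S.P\<^esub> S.T.cls (On_ar F f \<odot> On_ar G g) = S.T.cls (On_ar F' f \<odot> On_ar G' g) \<cdot>\<^bsub>S.P\<^esub> ?s"
    using ar by (simp add: S.T.cls_dot_Cmp \<phi>.Component_natural_ar \<psi>.Component_natural_ar)
  \<comment> \<open>Opaque names keep the simplifier from unfolding the words of the remaining
    summands, which are known only through the induction hypothesis.\<close>
  define x y X Y where defs: "x = S.S.dm (Base fs)" "y = S.S.cd (Base fs)"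
    "X = S.E (Base fs)" "Y = T.E (Base fs)"
  have [simp]: "x \<in> S.S.obs" "y \<in> S.S.obs"
    using S.S.wf_ob[OF ar(3)] unfolding defs by auto
  have [simp]: "X \<in> Ar S.P" "Dom S.P X = S.h x" "Cod S.P X = S.h y"
      "Y \<in> Ar S.P" "Dom S.P Y = T.h x" "Cod S.P Y = T.h y"
    using ar(3) unfolding defs by (simp_all del: word_map.simps wdom.simps wcod.simps wf_word.simps)
  have "(?c \<boxplus>\<^bsub>S.P\<^esub> t y) \<cdot>\<^bsub>S.P\<^esub> (S.T.cls (On_ar F f \<odot> On_ar G g) \<boxplus>\<^bsub>S.P\<^esub> X) =
      (S.T.cls (On_ar F' f \<odot> On_ar G' g) \<boxplus>\<^bsub>S.P\<^esub> Y) \<cdot>\<^bsub>S.P\<^esub> (?s \<boxplus>\<^bsub>S.P\<^esub> t x)"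
    using p Cons.IH[OF ar(3)] ar(1,2) unfolding defs[symmetric] by (simp add: S.T.T.Plus_Cmp_ar)
  then show ?case unfolding E t defs .
qed

lemma t_natural:
  "S.S.wfw w \<Longrightarrow> t (S.S.cd w) \<cdot>\<^bsub>S.P\<^esub> S.E w = T.E w \<cdot>\<^bsub>S.P\<^esub> t (S.S.dm w)"
proof (induction w)
  case (Base fs)
  then show ?case by (rule t_natural_Base)
next
  case (Gen i)
  then show ?case using t_natural_Gen[of i] by simp
next
  case (GenInv i)
  then have i: "gen_ok A B i" by simp
  \<comment> \<open>Both images of the formal inverse are inverses in the target, so the square at
    the generator can be reversed.\<close>
  show ?case
    using S.T.T.inverse_pair_square[OF S.inverse_pair_E[OF i] T.inverse_pair_E[OF i] t_natural_Gen[OF i]]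
      i S.S.gen_ob[OF i] S.wm_wf[of "Gen i"] T.wm_wf[of "Gen i"]
    by (simp del: word_map.simps list.map)
next
  case (Then w v)
  then have [simp]: "S.S.wfw w" "S.S.wfw v" "S.S.dm w = S.S.cd v" by simp_all
  have "t (S.S.cd (w \<bullet> v)) \<cdot>\<^bsub>S.P\<^esub> S.E (w \<bullet> v) = (t (S.S.cd w) \<cdot>\<^bsub>S.P\<^esub> S.E w) \<cdot>\<^bsub>S.P\<^esub> S.E v"
    by (simp add: S.E_Then del: word_map.simps)
  also have "\<dots> = T.E w \<cdot>\<^bsub>S.P\<^esub> (t (S.S.cd v) \<cdot>\<^bsub>S.P\<^esub> S.E v)"
    using Then.IH(1) by (simp del: word_map.simps)
  also have "\<dots> = T.E (w \<bullet> v) \<cdot>\<^bsub>S.P\<^esub> t (S.S.dm (w \<bullet> v))"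
    using Then.IH(2) by (simp add: T.E_Then del: word_map.simps)
  finally show ?case .
next
  case (Sum w v)
  then show ?case
    by (simp add: S.E_Sum T.E_Sum t_append S.T.T.Plus_Cmp_ar del: word_map.simps map_append)
qed

lemma tensor_mtrans_sel [simp]:
  "Src_fun (\<phi> \<otimes>\<^sub>2 \<psi>) = F \<otimes>\<^sub>1 G" "Trg_fun (\<phi> \<otimes>\<^sub>2 \<psi>) = F' \<otimes>\<^sub>1 G'"
  "x \<in> S.S.obs \<Longrightarrow> Component (\<phi> \<otimes>\<^sub>2 \<psi>) x = t x"
  by (simp_all add: tensor_mtrans_def \<phi>.Src_fun \<psi>.Src_fun \<phi>.Trg_fun \<psi>.Trg_fun
    \<phi>.F.Src \<phi>.F.Trg \<psi>.F.Src \<psi>.F.Trg)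

text \<open>Between strict functors monoidality means additivity of the components, that is
  \<open>t_append\<close> and \<open>t_Nil\<close>.\<close>

lemma tensor_mtrans: "monoidal_transformation (A \<otimes>\<^sub>0 B) S.P (F \<otimes>\<^sub>1 G) (F' \<otimes>\<^sub>1 G') (\<phi> \<otimes>\<^sub>2 \<psi>)"
proof (rule monoidal_transformationI)
  show "symmetric_monoidal_functor (A \<otimes>\<^sub>0 B) S.P (F \<otimes>\<^sub>1 G)"
    "symmetric_monoidal_functor (A \<otimes>\<^sub>0 B) S.P (F' \<otimes>\<^sub>1 G')" ..
  show "Component (\<phi> \<otimes>\<^sub>2 \<psi>) \<in> extensional (Ob (A \<otimes>\<^sub>0 B))"
    by (simp add: tensor_mtrans_def \<phi>.Src_fun \<psi>.Src_fun \<phi>.F.Src \<psi>.F.Src)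
next
  fix f assume "f \<in> Ar (A \<otimes>\<^sub>0 B)"
  then obtain w where "S.S.wfw w" "f = S.S.cls w" by (auto simp: S.S.Ar_T)
  then show "Component (\<phi> \<otimes>\<^sub>2 \<psi>) (Cod (A \<otimes>\<^sub>0 B) f) \<cdot>\<^bsub>S.P\<^esub> On_ar (F \<otimes>\<^sub>1 G) f =
      On_ar (F' \<otimes>\<^sub>1 G') f \<cdot>\<^bsub>S.P\<^esub> Component (\<phi> \<otimes>\<^sub>2 \<psi>) (Dom (A \<otimes>\<^sub>0 B) f)"
    using t_natural[of w] by simp
qed (simp_all add: t_append t_Nil del: map_append list.map)

end

section \<open>Identities and composites of 2-cells\<close>

lemma tensor_mtrans_id:
  assumes "symmetric_monoidal_functor A A' F" "symmetric_monoidal_functor B B' G"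
  shows "id_mtrans F \<otimes>\<^sub>2 id_mtrans G = id_mtrans (F \<otimes>\<^sub>1 G)"
proof -
  interpret F: symmetric_monoidal_functor A A' F by fact
  interpret G: symmetric_monoidal_functor B B' G by fact
  interpret tensor_mtranses A A' B B' F F G G "id_mtrans F" "id_mtrans G"
    by (intro tensor_mtranses.intro F.id_mtrans G.id_mtrans)
  have "map (map_prod (Component (id_mtrans F)) (Component (id_mtrans G))) x =
      map (map_prod \<one>\<^bsub>A'\<^esub> \<one>\<^bsub>B'\<^esub>) (S.h x)" if "x \<in> S.S.obs" for x
    using that by (induction x) auto
  then show ?thesis
    by (intro mtrans_eqI[OF tensor_mtrans S.FG.id_mtrans])
      (simp add: S.T.tensor_sel(4) id_word_def del: S.T.cls_idw_symw map_map map_eq_conv)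
qed

text \<open>Composition is exchanged first with the sum, by interchange in the target, and then with
  the dot of each summand.\<close>

lemma tensor_mtrans_vcomp:
  assumes "monoidal_transformation A A' F F' \<phi>" "monoidal_transformation A A' F' F'' \<phi>'"
    and "monoidal_transformation B B' G G' \<psi>" "monoidal_transformation B B' G' G'' \<psi>'"
  shows "vcomp_mtrans \<phi>' \<phi> \<otimes>\<^sub>2 vcomp_mtrans \<psi>' \<psi> = vcomp_mtrans (\<phi>' \<otimes>\<^sub>2 \<psi>') (\<phi> \<otimes>\<^sub>2 \<psi>)"
proof -
  interpret v: mtrans_vpair A A' F F' F'' \<phi> \<phi>' by (intro mtrans_vpair.intro assms)
  interpret w: mtrans_vpair B B' G G' G'' \<psi> \<psi>' by (intro mtrans_vpair.intro assms)
  interpret s: tensor_mtranses A A' B B' F F' G G' \<phi> \<psi> by (intro tensor_mtranses.intro assms)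
  interpret t: tensor_mtranses A A' B B' F' F'' G' G'' \<phi>' \<psi>' by (intro tensor_mtranses.intro assms)
  interpret l: tensor_mtranses A A' B B' F F'' G G'' "vcomp_mtrans \<phi>' \<phi>" "vcomp_mtrans \<psi>' \<psi>"
    by (intro tensor_mtranses.intro v.vcomp_mtrans w.vcomp_mtrans)
  interpret r: mtrans_vpair "A \<otimes>\<^sub>0 B" "A' \<otimes>\<^sub>0 B'" "F \<otimes>\<^sub>1 G" "F' \<otimes>\<^sub>1 G'" "F'' \<otimes>\<^sub>1 G''"
    "\<phi> \<otimes>\<^sub>2 \<psi>" "\<phi>' \<otimes>\<^sub>2 \<psi>'"
    by (intro mtrans_vpair.intro s.tensor_mtrans t.tensor_mtrans)
  have "l.t x = t.t x \<cdot>\<^bsub>s.S.P\<^esub> s.t x" if "x \<in> s.S.S.obs" for x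
    using that
  proof (induction x)
    case Nil
    then show ?case by (simp add: s.t_Nil[simplified])
  next
    case (Cons p x)
    obtain a b where p: "p = (a, b)" by (cases p)
    then have x: "a \<in> Ob A" "b \<in> Ob B" "x \<in> s.S.S.obs" using Cons.prems by auto
    then show ?case
      unfolding p s.t_Cons[OF x] t.t_Cons[OF x] l.t_Cons[OF x] Cons.IH[OF x(3)]
      by (simp add: s.S.T.T.Plus_Cmp_ar s.S.T.cls_dot_Cmp)
  qed
  then show ?thesis
    by (intro mtrans_eqI[OF l.tensor_mtrans r.vcomp_mtrans]) simp
qed

text \<open>As for vertical composition, but one factor is \<open>H \<otimes>\<^sub>1 K\<close>
  applied to a component; strictness distributes it over the summands.\<close>

lemma tensor_mtrans_hcomp:
  assumes "monoidal_transformation A A' F F' \<phi>" "monoidal_transformation A' A'' H H' \<phi>'"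
    and "monoidal_transformation B B' G G' \<psi>" "monoidal_transformation B' B'' K K' \<psi>'"
  shows "hcomp_mtrans \<phi>' \<phi> \<otimes>\<^sub>2 hcomp_mtrans \<psi>' \<psi> = hcomp_mtrans (\<phi>' \<otimes>\<^sub>2 \<psi>') (\<phi> \<otimes>\<^sub>2 \<psi>)"
proof -
  interpret v: mtrans_hpair A A' A'' F F' H H' \<phi> \<phi>' by (intro mtrans_hpair.intro assms)
  interpret w: mtrans_hpair B B' B'' G G' K K' \<psi> \<psi>' by (intro mtrans_hpair.intro assms)
  interpret s: tensor_mtranses A A' B B' F F' G G' \<phi> \<psi> by (intro tensor_mtranses.intro assms)
  interpret t: tensor_mtranses A' A'' B' B'' H H' K K' \<phi>' \<psi>' by (intro tensor_mtranses.intro assms)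
  interpret l: tensor_mtranses A A'' B B'' "comp_smfun H F" "comp_smfun H' F'"
    "comp_smfun K G" "comp_smfun K' G'" "hcomp_mtrans \<phi>' \<phi>" "hcomp_mtrans \<psi>' \<psi>"
    by (intro tensor_mtranses.intro v.hcomp_mtrans w.hcomp_mtrans)
  interpret r: mtrans_hpair "A \<otimes>\<^sub>0 B" "A' \<otimes>\<^sub>0 B'" "A'' \<otimes>\<^sub>0 B''" "F \<otimes>\<^sub>1 G" "F' \<otimes>\<^sub>1 G'"
    "H \<otimes>\<^sub>1 K" "H' \<otimes>\<^sub>1 K'" "\<phi> \<otimes>\<^sub>2 \<psi>" "\<phi>' \<otimes>\<^sub>2 \<psi>'"
    by (intro mtrans_hpair.intro s.tensor_mtrans t.tensor_mtrans)
  \<comment> \<open>The two sides have as ends a tensor product of composites and a composite of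
    tensor products; these interpretations supply the equality that makes them parallel.\<close>
  interpret p: tensor_functors_pair A A' A'' B B' B'' F G H K ..
  interpret p': tensor_functors_pair A A' A'' B B' B'' F' G' H' K' ..
  have "l.t x = t.t (s.T.h x) \<cdot>\<^bsub>t.S.P\<^esub> On_ar (H \<otimes>\<^sub>1 K) (s.t x)" if "x \<in> s.S.S.obs" for x
    using that
  proof (induction x)
    case Nil
    then show ?case
      using t.S.FG.On_simps(5)[of "[]"] by (simp add: s.t_Nil[simplified] t.t_Nil[simplified])
  next
    case (Cons p x)
    obtain a b where p: "p = (a, b)" by (cases p)
    then have x: "a \<in> Ob A" "b \<in> Ob B" "x \<in> s.S.S.obs" using Cons.prems by auto
    then have x': "On_ob F' a \<in> Ob A'" "On_ob G' b \<in> Ob B'" "s.T.h x \<in> tensor_ob A' B'" by simp_all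
    have h: "s.T.h ((a, b) # x) = (On_ob F' a, On_ob G' b) # s.T.h x" by simp
    have c: "On_ar (H \<otimes>\<^sub>1 K) (s.t ((a, b) # x)) =
        t.S.T.cls (On_ar H (Component \<phi> a) \<odot> On_ar K (Component \<psi> b)) \<boxplus>\<^bsub>t.S.P\<^esub> On_ar (H \<otimes>\<^sub>1 K) (s.t x)"
      unfolding s.t_Cons[OF x] using x by (subst t.S.tensor_smfun_Plus) auto
    show ?case
      unfolding p h c t.t_Cons[OF x'] l.t_Cons[OF x] Cons.IH[OF x(3)]
      using x x' by (simp add: t.S.T.T.Plus_Cmp_ar t.S.T.cls_dot_Cmp del: map_map)
  qed
  then show ?thesis
    using l.tensor_mtrans
    by (intro mtrans_eqI[OF _ r.hcomp_mtrans]) (simp_all add: p.tensor_smfun_comp p'.tensor_smfun_comp)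
qed

theorem proposition4p9:
  shows "two_functor
    ((PermCat :: (('a, 'm) permcat, ('a, 'm, 'a, 'm) smfun, ('a, 'm, 'a, 'm) mtrans) two_cat) \<times>\<^sub>2
     (PermCat :: (('b, 'n) permcat, ('b, 'n, 'b, 'n) smfun, ('b, 'n, 'b, 'n) mtrans) two_cat))
    PermCat
    (\<lambda>(A, B). A \<otimes>\<^sub>0 B) (\<lambda>(F, G). F \<otimes>\<^sub>1 G) (\<lambda>(\<phi>, \<psi>). \<phi> \<otimes>\<^sub>2 \<psi>)"
    (is "two_functor ?K ?L ?T0 ?T1 ?T2")
\<comment> \<open>\<open>two_category_PermCat\<close> enters at three choices of types: for the two
  factors of the source and for the target.\<close>
proof (intro two_functor.intro two_functor_axioms.intro two_category_prod two_category_PermCat)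
  fix X assume "X \<in> Cell0 ?K"
  then obtain A B where X: "X = (A, B)" "permutative_category A" "permutative_category B"
    by (auto simp: prod_two_cat_def)
  then interpret tensor_pair A B by (intro tensor_pair.intro)
  show "?T0 X \<in> Cell0 ?L" using X(1) permutative_tensor by simp
  show "?T1 (Id1 ?K X) = Id1 ?L (?T0 X)"
    using tensor_smfun_id[OF X(2,3)] X(1) by (simp add: prod_two_cat_def)
next
  fix X assume "X \<in> Cell1 ?K"
  then obtain F G where X: "X = (F, G)" and F: "symmetric_monoidal_functor (Src F) (Trg F) F"
    and G: "symmetric_monoidal_functor (Src G) (Trg G) G"
    by (auto simp: prod_two_cat_def)
  interpret tensor_functors "Src F" "Trg F" "Src G" "Trg G" F G
    by (intro tensor_functors.intro F G)
  show "?T1 X \<in> Cell1 ?L \<and> Src1 ?L (?T1 X) = ?T0 (Src1 ?K X) \<and> Trg1 ?L (?T1 X) = ?T0 (Trg1 ?K X)"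
    using X tensor_smfun by (simp add: prod_two_cat_def)
  show "?T2 (Id2 ?K X) = Id2 ?L (?T1 X)"
    using X tensor_mtrans_id[OF F G] by (simp add: prod_two_cat_def)
next
  fix X Y assume "X \<in> Cell1 ?K" "Y \<in> Cell1 ?K" "Src1 ?K Y = Trg1 ?K X"
  then obtain F G H K where X: "X = (F, G)" "Y = (H, K)"
    and c: "symmetric_monoidal_functor (Src F) (Trg F) F" "symmetric_monoidal_functor (Src G) (Trg G) G"
      "symmetric_monoidal_functor (Trg F) (Trg H) H" "symmetric_monoidal_functor (Trg G) (Trg K) K"
    by (auto simp: prod_two_cat_def)
  interpret tensor_functors_pair "Src F" "Trg F" "Trg H" "Src G" "Trg G" "Trg K" F G H K
    by (intro tensor_functors_pair.intro tensor_functors.intro c)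
  show "?T1 (Comp1 ?K Y X) = Comp1 ?L (?T1 Y) (?T1 X)"
    using X tensor_smfun_comp by (simp add: prod_two_cat_def)
next
  fix X assume "X \<in> Cell2 ?K"
  then obtain \<phi> \<psi> where X: "X = (\<phi>, \<psi>)" and
    c: "monoidal_transformation (Src (Src_fun \<phi>)) (Trg (Src_fun \<phi>)) (Src_fun \<phi>) (Trg_fun \<phi>) \<phi>"
      "monoidal_transformation (Src (Src_fun \<psi>)) (Trg (Src_fun \<psi>)) (Src_fun \<psi>) (Trg_fun \<psi>) \<psi>"
    by (auto simp: prod_two_cat_def)
  interpret tensor_mtranses "Src (Src_fun \<phi>)" "Trg (Src_fun \<phi>)" "Src (Src_fun \<psi>)" "Trg (Src_fun \<psi>)"
    "Src_fun \<phi>" "Trg_fun \<phi>" "Src_fun \<psi>" "Trg_fun \<psi>" \<phi> \<psi>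
    by (intro tensor_mtranses.intro c)
  show "?T2 X \<in> Cell2 ?L \<and> Src2 ?L (?T2 X) = ?T1 (Src2 ?K X) \<and> Trg2 ?L (?T2 X) = ?T1 (Trg2 ?K X)"
    using X mtrans_Src_Trg[OF tensor_mtrans] by (simp add: prod_two_cat_def)
next
  fix X Y assume "X \<in> Cell2 ?K" "Y \<in> Cell2 ?K" "Src2 ?K Y = Trg2 ?K X"
  then obtain \<phi> \<psi> \<phi>' \<psi>' where X: "X = (\<phi>, \<psi>)" "Y = (\<phi>', \<psi>')"
    and c: "\<phi> \<in> Cell2 PermCat" "\<psi> \<in> Cell2 PermCat" "\<phi>' \<in> Cell2 PermCat" "\<psi>' \<in> Cell2 PermCat"
    and e: "Src_fun \<phi>' = Trg_fun \<phi>" "Src_fun \<psi>' = Trg_fun \<psi>"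
    by (auto simp: prod_two_cat_def)
  from c(1) obtain A A' F F' where p: "monoidal_transformation A A' F F' \<phi>" "Src F' = A" "Trg F' = A'"
    "Trg_fun \<phi> = F'" by (rule mtrans_cellE)
  from c(2) obtain B B' G G' where q: "monoidal_transformation B B' G G' \<psi>" "Src G' = B" "Trg G' = B'"
    "Trg_fun \<psi> = G'" by (rule mtrans_cellE)
  have "monoidal_transformation A A' F' (Trg_fun \<phi>') \<phi>'" "monoidal_transformation B B' G' (Trg_fun \<psi>') \<psi>'"
    using c(3,4) e p q by auto
  then show "?T2 (VComp ?K Y X) = VComp ?L (?T2 Y) (?T2 X)"
    using X tensor_mtrans_vcomp[OF p(1) _ q(1)] by (simp add: prod_two_cat_def)
next
  fix X Y assume "X \<in> Cell2 ?K" "Y \<in> Cell2 ?K" "Src1 ?K (Src2 ?K Y) = Trg1 ?K (Src2 ?K X)"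
  then obtain \<phi> \<psi> \<phi>' \<psi>' where X: "X = (\<phi>, \<psi>)" "Y = (\<phi>', \<psi>')" and
    c: "monoidal_transformation (Src (Src_fun \<phi>)) (Trg (Src_fun \<phi>)) (Src_fun \<phi>) (Trg_fun \<phi>) \<phi>"
      "monoidal_transformation (Trg (Src_fun \<phi>)) (Trg (Src_fun \<phi>')) (Src_fun \<phi>') (Trg_fun \<phi>') \<phi>'"
      "monoidal_transformation (Src (Src_fun \<psi>)) (Trg (Src_fun \<psi>)) (Src_fun \<psi>) (Trg_fun \<psi>) \<psi>"
      "monoidal_transformation (Trg (Src_fun \<psi>)) (Trg (Src_fun \<psi>')) (Src_fun \<psi>') (Trg_fun \<psi>') \<psi>'"
    by (auto simp: prod_two_cat_def)
  then show "?T2 (HComp ?K Y X) = HComp ?L (?T2 Y) (?T2 X)"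
    using tensor_mtrans_hcomp[OF c] by (simp add: prod_two_cat_def)
qed

end
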